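(* Let $U_q(\mathfrak g)$ be the quantum Borcherds-Bozec algebra associated with a Borcherds-Cartan datum (with an even symmetrizable Borcherds-Cartan matrix). Let $U^{+}$ (resp. $U^{-}$) be the subalgebra of $U_q(\mathfrak g)$ generated by all $e_{il}$ (resp. all $f_{il}$), $(i,l)\in I^{\infty}$, and let $U^{0}$ be the subalgebra generated by all $q^{h}$, $h\in P^{\vee}$. Then $U_q(\mathfrak g)$ has the triangular decomposition $$U_q(\mathfrak g)\;\cong\; U^{-}\otimes U^{0}\otimes U^{+},$$ i.e. the multiplication map $U^{-}\otimes U^{0}\otimes U^{+}\to U_q(\mathfrak g)$, $x\otimes y\otimes z\mapsto xyz$, is an isomorphism of $\mathbf{Q}(q)$-vector spaces (tensor products over $\mathbf{Q}(q)$).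
   Context: **Borcherds-Cartan datum.** $I$ is a (finite or countably infinite) index set. An even symmetrizable Borcherds-Cartan matrix is an integer matrix $A=(a_{ij})_{i,j\in I}$ such that $a_{ii}\in\{2,0,-2,-4,\dots\}$, $a_{ij}\le 0$ for $i\ne j$, and there is $D=\mathrm{diag}(s_i\in\mathbf{Z}_{>0}\mid i\in I)$ with $DA$ symmetric. Put $I^{\mathrm{re}}=\{i: a_{ii}=2\}$, $I^{\mathrm{im}}=\{i: a_{ii}\le 0\}$. A Borcherds-Cartan datum consists of such $A$ (with $D$), a free abelian group $P$ (weight lattice), $P^{\vee}=\mathrm{Hom}(P,\mathbf{Z})$ with pairing $\langle\ ,\ \rangle$, simple roots $\alpha_i\in P$ and simple coroots $h_i\in P^{\vee}$ $(i\in I)$ such that $\langle h_i,\alpha_j\rangle=a_{ij}$, the $\alpha_i$ are linearly independent over $\mathbf{Q}$, and for each $i$ there is $\Lambda_i\in P$ with $\langle h_j,\Lambda_i\rangle=\delta_{ij}$ for all $j$. **Notation.** $q$ is an indeterminate, $q_i=q^{s_i}$, $q_{(i)}=q_i^{a_{ii}/2}$, $K_i=q^{s_ih_i}$. For $i\in I^{\mathrm{re}}$: $[n]_i=\frac{q_i^{n}-q_i^{-n}}{q_i-q_i^{-1}}$, $[n]_i!=[n]_i\cdots[1]_i$, $\left[\begin{smallmatrix}n\\k\end{smallmatrix}\right]_i=\frac{[n]_i!}{[k]_i!\,[n-k]_i!}$. $I^{\infty}=(I^{\mathrm{re}}\times\{1\})\cup(I^{\mathrm{im}}\times\mathbf{Z}_{>0})$;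 for $i\in I^{\mathrm{re}}$ write $i=(i,1)$, $e_i=e_{i1}$, $f_i=f_{i1}$. Convention: $e_{i0}=f_{i0}=1$. Fix $\tau_{il}\in\mathbf{Q}(q)$ with $\tau_{il}\in 1+q\mathbf{Z}_{\ge0}[[q]]$ for all $(i,l)\in I^{\infty}$, and put $\tau_{i0}=1$. **Quantum Borcherds-Bozec algebra.** $\widehat U$ is the associative unital $\mathbf{Q}(q)$-algebra generated by $q^h$ $(h\in P^{\vee})$, $e_{il},f_{il}$ $((i,l)\in I^{\infty})$ with relations: $q^0=1$, $q^hq^{h'}=q^{h+h'}$; $q^he_{jl}q^{-h}=q^{l\langle h,\alpha_j\rangle}e_{jl}$, $q^hf_{jl}q^{-h}=q^{-l\langle h,\alpha_j\rangle}f_{jl}$; for $i\in I^{\mathrm{re}}$, $(j,l)\in I^{\infty}$, $(j,l)\ne(i,1)$: $\sum_{k=0}^{1-la_{ij}}(-1)^k\left[\begin{smallmatrix}1-la_{ij}\\k\end{smallmatrix}\right]_i e_i^{1-la_{ij}-k}e_{jl}e_i^k=0$ and the same with $e$ replaced by $f$; $e_{ik}e_{jl}=e_{jl}e_{ik}$ and $f_{ik}f_{jl}=f_{jl}f_{ik}$ whenever $a_{ij}=0$ (including $i=j$ with $a_{ii}=0$). $U_q(\mathfrak g)$ is the quotient of $\widehat U$ by the (Drinfeld-type) relations: $e_{jl}f_{ik}=f_{ik}e_{jl}$ for $i\neq j$, $(i,k),(j,l)\in I^\infty$; and for all $i\in I$ and $(i,k),(i,l)\in I^{\infty}$, $$\sum_{\substack{m+n=k\\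 n+s=l}}q_{(i)}^{n(m-s)}\tau_{in}\,e_{is}f_{im}K_i^{-n}=\sum_{\substack{m+n=k\\ n+s=l}}q_{(i)}^{-n(m-s)}\tau_{in}\,f_{im}e_{is}K_i^{n},$$ where $m,n,s\ge0$. *)

theory Defs
  imports
    "HOL-Algebra.Algebra"
    "HOL-Algebra.Algebraic_Closure_Type"
    "HOL-Computational_Algebra.Computational_Algebra"
    "HOL-Library.Poly_Mapping"
    "HOL-Library.Countable_Set"
begin

section \<open>Modules over a commutative ring type: quotients, subalgebras, tensor products\<close>

abbreviation scalars :: "'k::comm_ring_1 ring" where
  "scalars \<equiv> ring_of_type_algebra"

definition pscale :: "'k::comm_ring_1 \<Rightarrow> ('x \<Rightarrow>\<^sub>0 'k) \<Rightarrow> ('x \<Rightarrow>\<^sub>0 'k)"  (infixr \<open>*\<^sub>s\<close> 75) where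
  "c *\<^sub>s f = Poly_Mapping.map (\<lambda>a. c * a) f"

text \<open>For an ideal \<open>N\<close> of an algebra this is the quotient algebra. For a mere submodule \<open>N\<close> of a
  module only the additive structure and the scalar multiplication are meaningful.\<close>

definition quotient_module ::
    "('k, 'a, 'z) module_scheme \<Rightarrow> 'a set \<Rightarrow> ('k, 'a set) module" where
  "quotient_module M N =
    \<lparr>carrier = carrier (M Quot N), monoid.mult = monoid.mult (M Quot N), one = one (M Quot N),
     ring.zero = ring.zero (M Quot N), add = add (M Quot N),
     module.smult = (\<lambda>c C. \<Union>x\<in>C. N +>\<^bsub>M\<^esub> (c \<odot>\<^bsub>M\<^esub> x))\<rparr>"

definition generated_submodule ::
    "('k::comm_ring_1, 'a, 'z) module_scheme \<Rightarrow> 'a set \<Rightarrow> 'a set" where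
  "generated_submodule M G = \<Inter>{S. submodule S scalars M \<and> G \<subseteq> S}"

definition generated_subalgebra ::
    "('k::comm_ring_1, 'a, 'z) module_scheme \<Rightarrow> 'a set \<Rightarrow> 'a set" where
  "generated_subalgebra M G = \<Inter>{S. subring S M \<and> submodule S scalars M \<and> G \<subseteq> S}"

definition module_iso ::
    "('k::comm_ring_1, 'a, 'z) module_scheme \<Rightarrow> ('k, 'b, 'w) module_scheme \<Rightarrow> ('a \<Rightarrow> 'b) set" where
  "module_iso M N = {f \<in> iso (add_monoid M) (add_monoid N).
     \<forall>c. \<forall>x\<in>carrier M. f (c \<odot>\<^bsub>M\<^esub> x) = c \<odot>\<^bsub>N\<^esub> f x}"

text \<open>The free module on a set carries no multiplication; those two record fields are irrelevant.\<close>

definition free_module :: "'x set \<Rightarrow> ('k::comm_ring_1, 'x \<Rightarrow>\<^sub>0 'k) module" where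
  "free_module G =
    \<lparr>carrier = {f. Poly_Mapping.keys f \<subseteq> G}, monoid.mult = undefined, one = undefined,
     ring.zero = 0, add = (+), module.smult = (*\<^sub>s)\<rparr>"

inductive_set tensor_relators ::
    "('k::comm_ring_1, 'a, 'z) module_scheme \<Rightarrow> ('k, 'b, 'w) module_scheme \<Rightarrow> ('a \<times> 'b \<Rightarrow>\<^sub>0 'k) set"
  for M N where
  add_left: "\<lbrakk>x \<in> carrier M; x' \<in> carrier M; y \<in> carrier N\<rbrakk> \<Longrightarrow>
    Poly_Mapping.single (x \<oplus>\<^bsub>M\<^esub> x', y) 1 - Poly_Mapping.single (x, y) 1
      - Poly_Mapping.single (x', y) 1 \<in> tensor_relators M N"
| add_right: "\<lbrakk>x \<in> carrier M; y \<in> carrier N; y' \<in> carrier N\<rbrakk> \<Longrightarrow>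
    Poly_Mapping.single (x, y \<oplus>\<^bsub>N\<^esub> y') 1 - Poly_Mapping.single (x, y) 1
      - Poly_Mapping.single (x, y') 1 \<in> tensor_relators M N"
| smult_left: "\<lbrakk>x \<in> carrier M; y \<in> carrier N\<rbrakk> \<Longrightarrow>
    Poly_Mapping.single (c \<odot>\<^bsub>M\<^esub> x, y) 1 - Poly_Mapping.single (x, y) c \<in> tensor_relators M N"
| smult_right: "\<lbrakk>x \<in> carrier M; y \<in> carrier N\<rbrakk> \<Longrightarrow>
    Poly_Mapping.single (x, c \<odot>\<^bsub>N\<^esub> y) 1 - Poly_Mapping.single (x, y) c \<in> tensor_relators M N"

definition tensor_kernel ::
    "('k::comm_ring_1, 'a, 'z) module_scheme \<Rightarrow> ('k, 'b, 'w) module_scheme \<Rightarrow> ('a \<times> 'b \<Rightarrow>\<^sub>0 'k) set" where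
  "tensor_kernel M N =
    generated_submodule (free_module (carrier M \<times> carrier N)) (tensor_relators M N)"

definition tensor ::
    "('k::comm_ring_1, 'a, 'z) module_scheme \<Rightarrow> ('k, 'b, 'w) module_scheme \<Rightarrow>
      ('k, ('a \<times> 'b \<Rightarrow>\<^sub>0 'k) set) module" where
  "tensor M N = quotient_module (free_module (carrier M \<times> carrier N)) (tensor_kernel M N)"

definition pure_tensor ::
    "('k::comm_ring_1, 'a, 'z) module_scheme \<Rightarrow> ('k, 'b, 'w) module_scheme \<Rightarrow>
      'a \<Rightarrow> 'b \<Rightarrow> ('a \<times> 'b \<Rightarrow>\<^sub>0 'k) set" where
  "pure_tensor M N x y =
    tensor_kernel M N +>\<^bsub>free_module (carrier M \<times> carrier N)\<^esub> Poly_Mapping.single (x, y) 1"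


section \<open>Free associative algebras\<close>

text \<open>Words under concatenation, as an additive monoid, so that \<open>\<Rightarrow>\<^sub>0\<close> over words has the
  multiplication of the noncommutative polynomial ring.\<close>

datatype 'g free_mon = Wd (letters: "'g list")

instantiation free_mon :: (type) monoid_add
begin
definition zero_free_mon :: "'a free_mon" where "0 = Wd []"
definition plus_free_mon :: "'a free_mon \<Rightarrow> 'a free_mon \<Rightarrow> 'a free_mon" where
  "u + v = Wd (letters u @ letters v)"
instance by standard (simp_all add: zero_free_mon_def plus_free_mon_def)
end

definition free_algebra :: "'g set \<Rightarrow> ('k::comm_ring_1, 'g free_mon \<Rightarrow>\<^sub>0 'k) module" where
  "free_algebra G =
    \<lparr>carrier = {f. \<forall>w\<in>Poly_Mapping.keys f. set (letters w) \<subseteq> G}, monoid.mult = (*), one = 1,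
     ring.zero = 0, add = (+), module.smult = (*\<^sub>s)\<rparr>"

definition letter :: "'g \<Rightarrow> ('g free_mon \<Rightarrow>\<^sub>0 'k::comm_ring_1)" where
  "letter g = Poly_Mapping.single (Wd [g]) 1"


section \<open>Borcherds-Cartan data\<close>

text \<open>The weight lattice is the whole type \<open>'p\<close>; its dual is the set of additive maps to the
  integers. The field \<open>symm\<close> holds the diagonal entries \<open>s\<^sub>i\<close> of the symmetrizing matrix.\<close>

record ('i, 'p) bc_datum =
  index_set :: "'i set"
  cartan :: "'i \<Rightarrow> 'i \<Rightarrow> int"
  symm :: "'i \<Rightarrow> int"
  simple_root :: "'i \<Rightarrow> 'p"
  simple_coroot :: "'i \<Rightarrow> 'p \<Rightarrow> int"

definition coweights :: "('p::ab_group_add \<Rightarrow> int) set" where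
  "coweights = {h. Modules.additive h}"

definition int_mul :: "int \<Rightarrow> 'p::ab_group_add \<Rightarrow> 'p" where
  "int_mul n x = (\<Sum>k<nat n. x) - (\<Sum>k<nat (- n). x)"

definition free_abelian :: "'p::ab_group_add itself \<Rightarrow> bool" where
  "free_abelian _ \<longleftrightarrow> (\<exists>B::'p set. \<not> Modules.module.dependent int_mul B
     \<and> Modules.module.span int_mul B = UNIV)"

text \<open>In \<open>linear_independent\<close> the coefficients are integers: a rational relation between elements
  of a torsion-free group becomes an integral one after clearing denominators.\<close>

locale borcherds_cartan_datum =
  fixes D :: "('i, 'p::ab_group_add) bc_datum"
  assumes countable_index: "countable (index_set D)"
    and diagonal: "i \<in> index_set D \<Longrightarrow> even (cartan D i i) \<and> cartan D i i \<le> 2"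
    and off_diagonal: "\<lbrakk>i \<in> index_set D; j \<in> index_set D; i \<noteq> j\<rbrakk> \<Longrightarrow> cartan D i j \<le> 0"
    and symm_pos: "i \<in> index_set D \<Longrightarrow> symm D i > 0"
    and symmetrizable: "\<lbrakk>i \<in> index_set D; j \<in> index_set D\<rbrakk> \<Longrightarrow>
      symm D i * cartan D i j = symm D j * cartan D j i"
    and free_weights: "free_abelian TYPE('p)"
    and coroots: "i \<in> index_set D \<Longrightarrow> simple_coroot D i \<in> coweights"
    and pairing: "\<lbrakk>i \<in> index_set D; j \<in> index_set D\<rbrakk> \<Longrightarrow>
      simple_coroot D i (simple_root D j) = cartan D i j"
    and linear_independent: "\<lbrakk>finite J; J \<subseteq> index_set D;
      (\<Sum>j\<in>J. int_mul (c j) (simple_root D j)) = 0; j \<in> J\<rbrakk> \<Longrightarrow> c j = 0"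
    and fundamental_weights: "i \<in> index_set D \<Longrightarrow>
      \<exists>\<Lambda>. \<forall>j\<in>index_set D. simple_coroot D j \<Lambda> = (if i = j then 1 else 0)"

definition real_indices :: "('i, 'p) bc_datum \<Rightarrow> 'i set" where
  "real_indices D = {i \<in> index_set D. cartan D i i = 2}"

definition imaginary_indices :: "('i, 'p) bc_datum \<Rightarrow> 'i set" where
  "imaginary_indices D = {i \<in> index_set D. cartan D i i \<le> 0}"

definition I_infty :: "('i, 'p) bc_datum \<Rightarrow> ('i \<times> nat) set" where
  "I_infty D = real_indices D \<times> {1} \<union> imaginary_indices D \<times> {0<..}"


section \<open>The field \<open>\<rat>(q)\<close> and quantum integers\<close>

type_synonym qfield = "rat poly fract"

definition q_var :: qfield where
  "q_var = Fraction_Field.Fract [:0, 1:] 1"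

definition q_sub :: "('i, 'p) bc_datum \<Rightarrow> 'i \<Rightarrow> qfield" where
  "q_sub D i = q_var powi symm D i"

text \<open>\<open>q\<^sub>(\<^sub>i\<^sub>)\<close>; the division is exact since \<open>a\<^sub>i\<^sub>i\<close> is even.\<close>

definition q_paren :: "('i, 'p) bc_datum \<Rightarrow> 'i \<Rightarrow> qfield" where
  "q_paren D i = q_sub D i powi (cartan D i i div 2)"

definition qint :: "('i, 'p) bc_datum \<Rightarrow> 'i \<Rightarrow> nat \<Rightarrow> qfield" where
  "qint D i n =
    (q_sub D i powi int n - q_sub D i powi (- int n)) / (q_sub D i - inverse (q_sub D i))"

definition qfact :: "('i, 'p) bc_datum \<Rightarrow> 'i \<Rightarrow> nat \<Rightarrow> qfield" where
  "qfact D i n = (\<Prod>k=1..n. qint D i k)"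

definition qbinom :: "('i, 'p) bc_datum \<Rightarrow> 'i \<Rightarrow> nat \<Rightarrow> nat \<Rightarrow> qfield" where
  "qbinom D i n k = qfact D i n / (qfact D i k * qfact D i (n - k))"

text \<open>The rational function \<open>r\<close> has the power series expansion \<open>F\<close> at \<open>q = 0\<close>.\<close>

definition has_q_expansion :: "qfield \<Rightarrow> rat fps \<Rightarrow> bool" where
  "has_q_expansion r F \<longleftrightarrow> (\<exists>a b. b \<noteq> 0 \<and> r = Fraction_Field.Fract a b
     \<and> fps_of_poly b * F = fps_of_poly a)"

definition admissible_tau :: "('i, 'p) bc_datum \<Rightarrow> ('i \<Rightarrow> nat \<Rightarrow> qfield) \<Rightarrow> bool" where
  "admissible_tau D \<tau> \<longleftrightarrow>
    (\<forall>i\<in>index_set D. \<tau> i 0 = 1) \<and>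
    (\<forall>(i, l)\<in>I_infty D. \<exists>F. has_q_expansion (\<tau> i l) F \<and> fps_nth F 0 = 1 \<and> (\<forall>n. fps_nth F n \<in> \<nat>))"


section \<open>The quantum Borcherds-Bozec algebra\<close>

text \<open>\<open>Gq h\<close>, \<open>Ge i l\<close>, \<open>Gf i l\<close> stand for \<open>q\<^sup>h\<close>, \<open>e\<^sub>i\<^sub>l\<close>, \<open>f\<^sub>i\<^sub>l\<close>; only those in \<open>gens\<close> generate the algebra.\<close>

datatype ('i, 'p) gen = Gq "'p \<Rightarrow> int" | Ge 'i nat | Gf 'i nat

type_synonym ('i, 'p) falg = "('i, 'p) gen free_mon \<Rightarrow>\<^sub>0 qfield"

definition gens :: "('i, 'p::ab_group_add) bc_datum \<Rightarrow> ('i, 'p) gen set" where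
  "gens D = Gq ` coweights \<union> {Ge i l |i l. (i, l) \<in> I_infty D} \<union> {Gf i l |i l. (i, l) \<in> I_infty D}"

definition qexp :: "('p \<Rightarrow> int) \<Rightarrow> ('i, 'p) falg" where
  "qexp h = letter (Gq h)"

definition e_gen :: "'i \<Rightarrow> nat \<Rightarrow> ('i, 'p) falg" where
  "e_gen i l = (if l = 0 then 1 else letter (Ge i l))"

definition f_gen :: "'i \<Rightarrow> nat \<Rightarrow> ('i, 'p) falg" where
  "f_gen i l = (if l = 0 then 1 else letter (Gf i l))"

text \<open>\<open>K_pow D i n\<close> is \<open>K\<^sub>i\<^sup>n = q\<^bsup>n s\<^sub>i h\<^sub>i\<^esup>\<close> for an integer \<open>n\<close>.\<close>

definition K_pow :: "('i, 'p) bc_datum \<Rightarrow> 'i \<Rightarrow> int \<Rightarrow> ('i, 'p) falg" where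
  "K_pow D i n = qexp (\<lambda>x. n * symm D i * simple_coroot D i x)"

text \<open>A defining relation \<open>x = y\<close> is encoded as the relator \<open>x - y\<close>.\<close>

inductive_set relators ::
    "('i, 'p::ab_group_add) bc_datum \<Rightarrow> ('i \<Rightarrow> nat \<Rightarrow> qfield) \<Rightarrow> ('i, 'p) falg set"
  for D :: "('i, 'p::ab_group_add) bc_datum" and \<tau> :: "'i \<Rightarrow> nat \<Rightarrow> qfield" where
  q_zero: "qexp (\<lambda>_. 0) - 1 \<in> relators D \<tau>"
| q_add: "\<lbrakk>h \<in> coweights; h' \<in> coweights\<rbrakk> \<Longrightarrow>
    qexp h * qexp h' - qexp (\<lambda>x. h x + h' x) \<in> relators D \<tau>"
| q_e: "\<lbrakk>h \<in> coweights; (j, l) \<in> I_infty D\<rbrakk> \<Longrightarrow>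
    qexp h * e_gen j l * qexp (\<lambda>x. - h x) - q_var powi (int l * h (simple_root D j)) *\<^sub>s e_gen j l
      \<in> relators D \<tau>"
| q_f: "\<lbrakk>h \<in> coweights; (j, l) \<in> I_infty D\<rbrakk> \<Longrightarrow>
    qexp h * f_gen j l * qexp (\<lambda>x. - h x) - q_var powi (- (int l * h (simple_root D j))) *\<^sub>s f_gen j l
      \<in> relators D \<tau>"
| serre_e: "\<lbrakk>i \<in> real_indices D; (j, l) \<in> I_infty D; (j, l) \<noteq> (i, 1);
      n = nat (1 - int l * cartan D i j)\<rbrakk> \<Longrightarrow>
    (\<Sum>k\<le>n. ((-1) ^ k * qbinom D i n k) *\<^sub>s (e_gen i 1 ^ (n - k) * e_gen j l * e_gen i 1 ^ k)) \<in> relators D \<tau>"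
| serre_f: "\<lbrakk>i \<in> real_indices D; (j, l) \<in> I_infty D; (j, l) \<noteq> (i, 1);
      n = nat (1 - int l * cartan D i j)\<rbrakk> \<Longrightarrow>
    (\<Sum>k\<le>n. ((-1) ^ k * qbinom D i n k) *\<^sub>s (f_gen i 1 ^ (n - k) * f_gen j l * f_gen i 1 ^ k)) \<in> relators D \<tau>"
| comm_e: "\<lbrakk>(i, k) \<in> I_infty D; (j, l) \<in> I_infty D; cartan D i j = 0\<rbrakk> \<Longrightarrow>
    e_gen i k * e_gen j l - e_gen j l * e_gen i k \<in> relators D \<tau>"
| comm_f: "\<lbrakk>(i, k) \<in> I_infty D; (j, l) \<in> I_infty D; cartan D i j = 0\<rbrakk> \<Longrightarrow>
    f_gen i k * f_gen j l - f_gen j l * f_gen i k \<in> relators D \<tau>"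
| comm_e_f: "\<lbrakk>(i, k) \<in> I_infty D; (j, l) \<in> I_infty D; i \<noteq> j\<rbrakk> \<Longrightarrow>
    e_gen j l * f_gen i k - f_gen i k * e_gen j l \<in> relators D \<tau>"
| drinfeld: "\<lbrakk>(i, k) \<in> I_infty D; (i, l) \<in> I_infty D\<rbrakk> \<Longrightarrow>
    (\<Sum>(m, n, s) \<in> {(m, n, s). m + n = k \<and> n + s = l}.
       (q_paren D i powi (int n * (int m - int s)) * \<tau> i n) *\<^sub>s (e_gen i s * f_gen i m * K_pow D i (- int n)))
    - (\<Sum>(m, n, s) \<in> {(m, n, s). m + n = k \<and> n + s = l}.
       (q_paren D i powi (- (int n * (int m - int s))) * \<tau> i n) *\<^sub>s (f_gen i m * e_gen i s * K_pow D i (int n)))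
      \<in> relators D \<tau>"

definition defining_ideal ::
    "('i, 'p::ab_group_add) bc_datum \<Rightarrow> ('i \<Rightarrow> nat \<Rightarrow> qfield) \<Rightarrow> ('i, 'p) falg set" where
  "defining_ideal D \<tau> = Idl\<^bsub>free_algebra (gens D)\<^esub> (relators D \<tau>)"

definition Uq ::
    "('i, 'p::ab_group_add) bc_datum \<Rightarrow> ('i \<Rightarrow> nat \<Rightarrow> qfield) \<Rightarrow> (qfield, ('i, 'p) falg set) module" where
  "Uq D \<tau> = quotient_module (free_algebra (gens D)) (defining_ideal D \<tau>)"

definition Uq_class ::
    "('i, 'p::ab_group_add) bc_datum \<Rightarrow> ('i \<Rightarrow> nat \<Rightarrow> qfield) \<Rightarrow> ('i, 'p) falg \<Rightarrow> ('i, 'p) falg set" where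
  "Uq_class D \<tau> x = defining_ideal D \<tau> +>\<^bsub>free_algebra (gens D)\<^esub> x"

definition U_plus ::
    "('i, 'p::ab_group_add) bc_datum \<Rightarrow> ('i \<Rightarrow> nat \<Rightarrow> qfield) \<Rightarrow> (qfield, ('i, 'p) falg set) module" where
  "U_plus D \<tau> = Uq D \<tau>\<lparr>carrier :=
     generated_subalgebra (Uq D \<tau>) {Uq_class D \<tau> (e_gen i l) |i l. (i, l) \<in> I_infty D}\<rparr>"

definition U_minus ::
    "('i, 'p::ab_group_add) bc_datum \<Rightarrow> ('i \<Rightarrow> nat \<Rightarrow> qfield) \<Rightarrow> (qfield, ('i, 'p) falg set) module" where
  "U_minus D \<tau> = Uq D \<tau>\<lparr>carrier :=
     generated_subalgebra (Uq D \<tau>) {Uq_class D \<tau> (f_gen i l) |i l. (i, l) \<in> I_infty D}\<rparr>"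

definition U_zero ::
    "('i, 'p::ab_group_add) bc_datum \<Rightarrow> ('i \<Rightarrow> nat \<Rightarrow> qfield) \<Rightarrow> (qfield, ('i, 'p) falg set) module" where
  "U_zero D \<tau> = Uq D \<tau>\<lparr>carrier :=
     generated_subalgebra (Uq D \<tau>) {Uq_class D \<tau> (qexp h) |h. h \<in> coweights}\<rparr>"

end

theory Submission
  imports Defs "HOL-Library.Function_Algebras" "HOL-Library.Product_Plus"
begin

text \<open>
  Let \<open>F\<close> be the free algebra on letters indexed by \<open>I\<^sup>\<infinity>\<close>, which serves for the \<open>e\<^sub>i\<^sub>l\<close> as well as for the
  \<open>f\<^sub>i\<^sub>l\<close>, and \<open>J\<close> the ideal of \<open>F\<close> generated by the quantum Serre elements and the commutators
  belonging to \<open>a\<^sub>i\<^sub>j = 0\<close>. Let \<open>U'\<close> be the algebra given by all defining relations that involve the torus or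
  both an \<open>e\<close> and an \<open>f\<close>. In \<open>U'\<close> every \<open>e\<close> can be moved to the right of every \<open>f\<close>, and \<open>U'\<close> has the normal
  words (a word in the \<open>f\<^sub>i\<^sub>l\<close>, then one \<open>q\<^sup>h\<close>, then a word in the \<open>e\<^sub>i\<^sub>l\<close>) as a basis. The independence of
  these words is shown by letting the free algebra act on the space spanned by them, in such a way that
  the relations of \<open>U'\<close> hold (\<open>act_cross_relator\<close>).

  What has to be explained is why the relations in \<open>J\<close> do not destroy this picture. Moving powers of \<open>K\<^sub>j\<close> turns
  the relation between \<open>e\<^sub>j\<^sub>l\<close> and \<open>f\<^sub>j\<^sub>k\<close> into
  \<open>\<Sum>\<^sub>n \<tau>\<^sub>n q\<^sup>-\<^sup>n\<^sup>(\<^sup>m\<^sup>+\<^sup>s\<^sup>) e\<^sub>s K\<^sup>-\<^sup>n f\<^sub>m = \<Sum>\<^sub>n \<tau>\<^sub>n q\<^sup>-\<^sup>n\<^sup>(\<^sup>m\<^sup>+\<^sup>s\<^sup>) f\<^sub>m K\<^sup>n e\<^sub>s\<close>, where \<open>m = k - n\<close>, \<open>s = l - n\<close> and \<open>q\<close> stands for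
  \<open>q\<^sub>(\<^sub>j\<^sub>)\<close>. In this form it extends to every element \<open>x\<close> of the positive half:
  \<open>\<Sum>\<^sub>n q\<^sup>-\<^sup>n\<^sup>m R\<^sub>n(x) K\<^sup>-\<^sup>n f\<^sub>m = \<Sum>\<^sub>n q\<^sup>-\<^sup>n\<^sup>m f\<^sub>m K\<^sup>n L\<^sub>n(x)\<close> (\<open>cross_lhs_eqv_rhs\<close>), where the \<open>R\<^sub>n\<close> (\<open>skew\<close>) are the components of a
  higher skew derivation of \<open>F\<close> and the \<open>L\<^sub>n\<close> (\<open>coskew\<close>) are their mirror images. The heart of the matter is that
  the \<open>R\<^sub>n\<close> and \<open>L\<^sub>n\<close> that occur here map \<open>J\<close> into itself (\<open>skew_J\<close>, \<open>coskew_J\<close>). On a Serre element for the real index \<open>i\<close> this is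
  a telescoping sum if \<open>j = i\<close>; if \<open>j \<noteq> i\<close> the result is a Serre expression that is a multiple, by linear
  factors in left and right multiplication with \<open>e\<^sub>i\<close>, of the Serre element for a smaller \<open>l\<close>
  (\<open>serre_sum_shift_in_ideal\<close>).

  It follows by induction on \<open>l\<close> that \<open>e\<^sub>i\<^sub>l J\<close> is contained in the right ideal of \<open>U'\<close> generated by the copy of \<open>J\<close>
  in the negative half, so this right ideal is two-sided; by the antiautomorphism that exchanges \<open>e\<close> and \<open>f\<close>
  the left ideal generated by the copy of \<open>J\<close> in the positive half is two-sided as well. Hence the
  kernel of \<open>U' \<rightarrow> U\<^sub>q\<close> is the sum of these two ideals (\<open>relators_subset_NN\<close>), and in terms of the basis of normal
  words \<open>U\<^sub>q\<close> is \<open>F/J \<otimes> U\<^sup>0 \<otimes> F/J\<close>. Since the map \<open>Psi\<close> from normal words onto \<open>U\<^sup>- \<otimes> U\<^sup>0 \<otimes> U\<^sup>+\<close> kills the same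
  subspace, multiplication is injective; it is surjective because normal words span.\<close>

section \<open>Linear algebra of finitely supported functions\<close>

abbreviation (input) "lookup \<equiv> Poly_Mapping.lookup"

lemma lookup_pscale [simp]: "lookup (c *\<^sub>s f) k = c * lookup f k"
  by (simp add: pscale_def Poly_Mapping.map.rep_eq when_def)

interpretation pm: Modules.module "(*\<^sub>s) :: 'k::comm_ring_1 \<Rightarrow> ('x \<Rightarrow>\<^sub>0 'k) \<Rightarrow> ('x \<Rightarrow>\<^sub>0 'k)"
  by unfold_locales (auto intro!: poly_mapping_eqI simp: lookup_add algebra_simps)

abbreviation plinear :: "(('x \<Rightarrow>\<^sub>0 'k::comm_ring_1) \<Rightarrow> ('y \<Rightarrow>\<^sub>0 'k)) \<Rightarrow> bool" where
  "plinear \<equiv> Modules.module_hom (*\<^sub>s) (*\<^sub>s)"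

lemma plinearI:
  assumes "\<And>x y. f (x + y) = f x + f y" "\<And>c x. f (c *\<^sub>s x) = c *\<^sub>s f x"
  shows "plinear f"
  by unfold_locales (use assms in auto)

lemmas plinear_simps = module_hom.add module_hom.scale module_hom.diff module_hom.sum
  module_hom.zero module_hom.neg

lemma pscale_single [simp]: "c *\<^sub>s Poly_Mapping.single k d = Poly_Mapping.single k (c * d)"
  by (rule poly_mapping_eqI) (simp add: lookup_single when_def)

lemma pscale_conv_mult:
  fixes x :: "'x::monoid_add \<Rightarrow>\<^sub>0 'k::comm_ring_1"
  shows "c *\<^sub>s x = Poly_Mapping.single 0 c * x"
proof (rule poly_mapping_eqI)
  fix k
  have "lookup (Poly_Mapping.single 0 c * x) k
    = (\<Sum>l. c * (\<Sum>q. lookup x q when k = l + q) when 0 = l)"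
    by (subst lookup_mult, rule Sum_any.cong) (auto simp: lookup_single when_def)
  then show "lookup (c *\<^sub>s x) k = lookup (Poly_Mapping.single 0 c * x) k"
    by simp
qed

lemma mult_pscale_left [simp]:
  fixes x y :: "'x::monoid_add \<Rightarrow>\<^sub>0 'k::comm_ring_1"
  shows "(c *\<^sub>s x) * y = c *\<^sub>s (x * y)"
  by (simp add: pscale_conv_mult mult.assoc)

lemma poly_mapping_expand: "x = (\<Sum>k\<in>Poly_Mapping.keys x. lookup x k *\<^sub>s Poly_Mapping.single k 1)"
  by (rule poly_mapping_eqI)
     (auto simp: lookup_sum lookup_single when_def in_keys_iff if_distrib sum.If_cases cong: if_cong)

lemma pscale_conv_mult_right:
  fixes x :: "'x::monoid_add \<Rightarrow>\<^sub>0 'k::comm_ring_1"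
  shows "c *\<^sub>s x = x * Poly_Mapping.single 0 c"
proof -
  have "x * Poly_Mapping.single 0 c
    = (\<Sum>k\<in>Poly_Mapping.keys x. lookup x k *\<^sub>s Poly_Mapping.single k 1) * Poly_Mapping.single 0 c"
    by (simp only: poly_mapping_expand[symmetric])
  also have "\<dots> = c *\<^sub>s (\<Sum>k\<in>Poly_Mapping.keys x. lookup x k *\<^sub>s Poly_Mapping.single k 1)"
    by (simp add: sum_distrib_right pm.scale_sum_right mult_single mult.commute)
  finally show ?thesis
    by (simp only: poly_mapping_expand[symmetric])
qed

lemma mult_pscale_right [simp]:
  fixes x y :: "'x::monoid_add \<Rightarrow>\<^sub>0 'k::comm_ring_1"
  shows "x * (c *\<^sub>s y) = c *\<^sub>s (x * y)"
  by (simp add: pscale_conv_mult_right mult.assoc)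

text \<open>The linear extension of a map on the basis.\<close>

definition lin_ext :: "('x \<Rightarrow> 'y \<Rightarrow>\<^sub>0 'k::comm_ring_1) \<Rightarrow> ('x \<Rightarrow>\<^sub>0 'k) \<Rightarrow> ('y \<Rightarrow>\<^sub>0 'k)" where
  "lin_ext f x = (\<Sum>k\<in>Poly_Mapping.keys x. lookup x k *\<^sub>s f k)"

lemma lin_ext_superset:
  assumes "finite K" "Poly_Mapping.keys x \<subseteq> K"
  shows "lin_ext f x = (\<Sum>k\<in>K. lookup x k *\<^sub>s f k)"
  unfolding lin_ext_def
  by (rule sum.mono_neutral_left) (use assms in \<open>auto simp: in_keys_iff\<close>)

lemma plinear_lin_ext [intro, simp]:
  fixes f :: "'x \<Rightarrow> 'y \<Rightarrow>\<^sub>0 'k::comm_ring_1"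
  shows "plinear (lin_ext f)"
proof (rule plinearI)
  fix x y :: "'x \<Rightarrow>\<^sub>0 'k"
  let ?K = "Poly_Mapping.keys x \<union> Poly_Mapping.keys y"
  have "lin_ext f (x + y) = (\<Sum>k\<in>?K. lookup (x + y) k *\<^sub>s f k)"
    by (rule lin_ext_superset) (auto simp: Poly_Mapping.keys_add)
  then show "lin_ext f (x + y) = lin_ext f x + lin_ext f y"
    by (simp add: lin_ext_superset[of ?K] lookup_add pm.scale_left_distrib sum.distrib)
next
  fix c and x :: "'x \<Rightarrow>\<^sub>0 'k"
  have "lin_ext f (c *\<^sub>s x) = (\<Sum>k\<in>Poly_Mapping.keys x. lookup (c *\<^sub>s x) k *\<^sub>s f k)"
    by (rule lin_ext_superset) (auto simp: in_keys_iff)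
  then show "lin_ext f (c *\<^sub>s x) = c *\<^sub>s lin_ext f x"
    by (simp add: lin_ext_def pm.scale_sum_right)
qed

lemma lin_ext_single [simp]: "lin_ext f (Poly_Mapping.single k c) = c *\<^sub>s f k"
  by (subst lin_ext_superset[of "{k}"]) (auto simp: lookup_single)

lemmas lin_ext_simps [simp] = plinear_simps[OF plinear_lin_ext]

lemma plinear_eq_on:
  assumes "plinear f" "plinear g"
    and "\<And>k. k \<in> Poly_Mapping.keys x \<Longrightarrow> f (Poly_Mapping.single k 1) = g (Poly_Mapping.single k 1)"
  shows "f x = g x"
  by (subst (1 2) poly_mapping_expand[of x])
     (simp add: plinear_simps[OF assms(1)] plinear_simps[OF assms(2)] assms(3) del: pscale_single)

lemma plinear_compose: "plinear f \<Longrightarrow> plinear g \<Longrightarrow> plinear (\<lambda>x. f (g x))"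
  by (rule plinearI) (simp_all add: plinear_simps)

lemma plinear_intros [intro, simp]:
  "plinear (\<lambda>x. x)"
  "plinear f \<Longrightarrow> plinear (\<lambda>x. c *\<^sub>s f x)"
  "plinear f \<Longrightarrow> plinear g \<Longrightarrow> plinear (\<lambda>x. f x + g x)"
  "plinear f \<Longrightarrow> plinear g \<Longrightarrow> plinear (\<lambda>x. f x - g x)"
  "(\<And>i. i \<in> I \<Longrightarrow> plinear (h i)) \<Longrightarrow> plinear (\<lambda>x. \<Sum>i\<in>I. h i x)"
proof -
  show "plinear (\<lambda>x. c *\<^sub>s f x)" if "plinear f"
    by (rule plinearI) (simp_all add: plinear_simps[OF that] pm.scale_right_distrib mult.commute)
  show "plinear (\<lambda>x. \<Sum>i\<in>I. h i x)" if *: "\<And>i. i \<in> I \<Longrightarrow> plinear (h i)"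
    by (rule plinearI)
       (simp_all add: sum.distrib[symmetric] pm.scale_sum_right plinear_simps[OF *] cong: sum.cong)
qed (auto intro!: plinearI simp: plinear_simps pm.scale_right_distrib pm.scale_right_diff_distrib)

lemma plinear_mult [intro, simp]:
  fixes f :: "('x \<Rightarrow>\<^sub>0 'k::comm_ring_1) \<Rightarrow> ('y::monoid_add \<Rightarrow>\<^sub>0 'k)"
  shows "plinear f \<Longrightarrow> plinear (\<lambda>x. f x * a)"
    and "plinear f \<Longrightarrow> plinear (\<lambda>x. a * f x)"
  by (auto intro!: plinearI simp: plinear_simps distrib_left distrib_right)

lemma plinear_lin_ext_compose [intro, simp]:
  "plinear f \<Longrightarrow> plinear (\<lambda>x. lin_ext g (f x))"
  by (rule plinear_compose) auto

lemma plinear_bilinear_eqI: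
  assumes "\<And>y. plinear (\<lambda>x. f x y)" "\<And>y. plinear (\<lambda>x. g x y)"
    and "\<And>x. plinear (f x)" "\<And>x. plinear (g x)"
    and "\<And>k l. f (Poly_Mapping.single k 1) (Poly_Mapping.single l 1)
      = g (Poly_Mapping.single k 1) (Poly_Mapping.single l 1)"
  shows "f x y = g x y"
proof -
  have "f (Poly_Mapping.single k 1) y = g (Poly_Mapping.single k 1) y" for k
    by (rule plinear_eq_on[OF assms(3) assms(4)]) (rule assms(5))
  then show ?thesis
    by (rule plinear_eq_on[OF assms(1) assms(2)])
qed

lemma plinear_image_span_subset:
  assumes "plinear f" "\<And>x. x \<in> S \<Longrightarrow> f x \<in> V" "pm.subspace V" "x \<in> pm.span S"
  shows "f x \<in> V"
  using assms(4)
proof (induction rule: pm.span_induct_alt)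
  case base
  show ?case using assms by (simp add: plinear_simps pm.subspace_0)
next
  case (step c x y)
  then show ?case using assms by (simp add: plinear_simps pm.subspace_add pm.subspace_scale)
qed

section \<open>Words and free algebras\<close>

text \<open>The monomial given by a word.\<close>

definition mon :: "'g list \<Rightarrow> ('g free_mon \<Rightarrow>\<^sub>0 'k::comm_ring_1)" where
  "mon u = Poly_Mapping.single (Wd u) 1"

lemma mon_Nil [simp]: "mon [] = 1"
  by (simp add: mon_def zero_free_mon_def[symmetric])

lemma mon_append: "mon (u @ v) = mon u * mon v"
  by (simp add: mon_def mult_single plus_free_mon_def)

lemma mon_Cons: "mon (g # v) = mon [g] * mon v"
  using mon_append[of "[g]" v] by simp

lemma single_free_mon: "Poly_Mapping.single w 1 = mon (letters w)"
  by (simp add: mon_def)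

lemma letter_mon: "letter g = mon [g]"
  by (simp add: letter_def mon_def)

lemma lin_ext_mon [simp]: "lin_ext f (mon u) = f (Wd u)"
  by (simp add: mon_def)

lemma lin_ext_one [simp]: "lin_ext f (1 :: 'g free_mon \<Rightarrow>\<^sub>0 'k::comm_ring_1) = f (Wd [])"
  using lin_ext_mon[of f "[]"] by (simp del: lin_ext_mon)

lemma free_bilinear_eqI:
  assumes "\<And>y. plinear (\<lambda>x. f x y)" "\<And>y. plinear (\<lambda>x. g x y)"
    and "\<And>x. plinear (f x)" "\<And>x. plinear (g x)"
    and "\<And>u v. f (mon u) (mon v) = g (mon u) (mon v)"
  shows "f x y = g x y"
  by (rule plinear_bilinear_eqI[OF assms(1-4)]) (simp add: single_free_mon assms(5))

text \<open>The subalgebra spanned by the words in the letters \<open>G\<close>, that is, the carrier of \<open>free_algebra G\<close>.\<close>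

definition word_span :: "'g set \<Rightarrow> ('g free_mon \<Rightarrow>\<^sub>0 'k::comm_ring_1) set" where
  "word_span G = pm.span (mon ` lists G)"

lemma subspace_word_span [simp, intro]: "pm.subspace (word_span G)"
  by (simp add: word_span_def)

lemma mon_in_word_span [simp, intro]: "set u \<subseteq> G \<Longrightarrow> mon u \<in> word_span G"
  by (auto simp: word_span_def lists_eq_set intro!: pm.span_base)

lemma carrier_free_algebra:
  "carrier (free_algebra G :: ('k::comm_ring_1, 'g free_mon \<Rightarrow>\<^sub>0 'k) module) = word_span G"
  (is "?C = _")
proof (rule subset_antisym)
  show "?C \<subseteq> word_span G"
  proof
    fix x
    assume "x \<in> ?C"
    then have *: "\<And>w. w \<in> Poly_Mapping.keys x \<Longrightarrow> set (letters w) \<subseteq> G"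
      by (auto simp: free_algebra_def)
    have "(\<Sum>k\<in>Poly_Mapping.keys x. lookup x k *\<^sub>s mon (letters k)) \<in> word_span G"
      by (rule pm.subspace_sum[OF subspace_word_span])
         (rule pm.subspace_scale[OF subspace_word_span mon_in_word_span[OF *]])
    then show "x \<in> word_span G"
      by (simp only: single_free_mon[symmetric] poly_mapping_expand[symmetric])
  qed
  have "x + y \<in> ?C" if "x \<in> ?C" "y \<in> ?C" for x y
    using that Poly_Mapping.keys_add[of x y] unfolding free_algebra_def by auto
  moreover have "c *\<^sub>s x \<in> ?C" if "x \<in> ?C" for c x
    using that unfolding free_algebra_def by (auto simp: in_keys_iff)
  moreover have "0 \<in> ?C"
    by (simp add: free_algebra_def)
  ultimately have sub: "pm.subspace ?C"
    unfolding pm.subspace_def by blast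
  show "word_span G \<subseteq> ?C"
    unfolding word_span_def
    by (rule pm.span_minimal[OF _ sub]) (auto simp: free_algebra_def mon_def lists_eq_set)
qed

lemma word_span_induct [consumes 1, case_names zero step]:
  assumes "x \<in> word_span G" "P 0"
    and "\<And>c u x. set u \<subseteq> G \<Longrightarrow> x \<in> word_span G \<Longrightarrow> P x \<Longrightarrow> P (c *\<^sub>s mon u + x)"
  shows "P x"
proof -
  have "x \<in> word_span G \<and> P x"
    using assms(1) unfolding word_span_def
  proof (induction rule: pm.span_induct_alt)
    case base
    then show ?case by (simp add: assms pm.span_zero)
  next
    case (step c x y)
    then show ?case
      using assms(3)[of _ y c]
      by (auto simp: word_span_def lists_eq_set intro!: pm.span_add pm.span_scale intro: pm.span_base)
  qed
  then show ?thesis by simp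
qed

lemma plinear_word_span:
  assumes "plinear f" "\<And>u. set u \<subseteq> G \<Longrightarrow> f (mon u) \<in> V" "pm.subspace V" "x \<in> word_span G"
  shows "f x \<in> V"
  by (rule plinear_image_span_subset[OF assms(1) _ assms(3)])
     (use assms in \<open>auto simp: word_span_def lists_eq_set\<close>)

lemma plinear_eq_on_word_span:
  assumes "plinear f" "plinear g" "\<And>u. set u \<subseteq> G \<Longrightarrow> f (mon u) = g (mon u)" "x \<in> word_span G"
  shows "f x = g x"
proof -
  have "f x - g x \<in> {0}"
    by (rule plinear_word_span[of "\<lambda>x. f x - g x" G "{0}"]) (use assms in auto)
  then show ?thesis by simp
qed

lemma word_span_mult [simp, intro]:
  assumes "x \<in> word_span G" "y \<in> word_span G" shows "x * y \<in> word_span G"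
proof -
  have "mon u * y \<in> word_span G" if "set u \<subseteq> G" for u
    by (rule plinear_word_span[of "\<lambda>y. mon u * y", OF _ _ _ assms(2)])
       (use that in \<open>auto simp: mon_append[symmetric]\<close>)
  then show ?thesis
    by (intro plinear_word_span[of "\<lambda>x. x * y", OF _ _ _ assms(1)]) auto
qed

lemma word_span_one [simp, intro]: "1 \<in> word_span G"
  using mon_in_word_span[of "[]" G] by (simp del: mon_in_word_span)

lemma word_span_power [simp, intro]: "x \<in> word_span G \<Longrightarrow> x ^ n \<in> word_span G"
  by (induction n) auto

lemma word_span_closed [simp, intro]:
  "x \<in> word_span G \<Longrightarrow> y \<in> word_span G \<Longrightarrow> x + y \<in> word_span G"
  "x \<in> word_span G \<Longrightarrow> y \<in> word_span G \<Longrightarrow> x - y \<in> word_span G"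
  "x \<in> word_span G \<Longrightarrow> c *\<^sub>s x \<in> word_span G"
  "(\<And>i. i \<in> A \<Longrightarrow> h i \<in> word_span G) \<Longrightarrow> (\<Sum>i\<in>A. h i) \<in> word_span G"
  "0 \<in> word_span G"
  by (auto intro: pm.subspace_add pm.subspace_diff pm.subspace_scale pm.subspace_sum pm.subspace_0)

subsection \<open>Substitutions of letters\<close>

text \<open>The homomorphism and the antihomomorphism of free algebras given by a substitution of letters.\<close>

definition alg_map :: "('g \<Rightarrow> 'h) \<Rightarrow> ('g free_mon \<Rightarrow>\<^sub>0 'k::comm_ring_1) \<Rightarrow> ('h free_mon \<Rightarrow>\<^sub>0 'k)" where
  "alg_map \<phi> = lin_ext (\<lambda>w. mon (map \<phi> (letters w)))"

definition anti_map :: "('g \<Rightarrow> 'h) \<Rightarrow> ('g free_mon \<Rightarrow>\<^sub>0 'k::comm_ring_1) \<Rightarrow> ('h free_mon \<Rightarrow>\<^sub>0 'k)" where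
  "anti_map \<phi> = lin_ext (\<lambda>w. mon (rev (map \<phi> (letters w))))"

lemma alg_map_mon [simp]: "alg_map \<phi> (mon u) = mon (map \<phi> u)"
  and anti_map_mon [simp]: "anti_map \<phi> (mon u) = mon (rev (map \<phi> u))"
  by (simp_all add: alg_map_def anti_map_def)

lemma plinear_alg_map [simp, intro]: "plinear f \<Longrightarrow> plinear (\<lambda>x. alg_map \<phi> (f x))"
  and plinear_anti_map [simp, intro]: "plinear f \<Longrightarrow> plinear (\<lambda>x. anti_map \<phi> (f x))"
  unfolding alg_map_def anti_map_def by auto

lemma plinear_alg_map' [simp, intro]: "plinear (alg_map \<phi>)"
  and plinear_anti_map' [simp, intro]: "plinear (anti_map \<phi>)"
  unfolding alg_map_def anti_map_def by auto

lemmas alg_map_simps [simp] = plinear_simps[OF plinear_alg_map']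
lemmas anti_map_simps [simp] = plinear_simps[OF plinear_anti_map']

lemma alg_map_one [simp]: "alg_map \<phi> 1 = 1"
  and anti_map_one [simp]: "anti_map \<phi> 1 = 1"
  by (simp_all add: alg_map_def anti_map_def)

lemma alg_map_mult [simp]: "alg_map \<phi> (x * y) = alg_map \<phi> x * alg_map \<phi> y"
  by (rule free_bilinear_eqI) (auto simp: mon_append[symmetric])

lemma anti_map_mult [simp]: "anti_map \<phi> (x * y) = anti_map \<phi> y * anti_map \<phi> x"
  by (rule free_bilinear_eqI) (auto simp: mon_append[symmetric])

lemma alg_map_power [simp]: "alg_map \<phi> (x ^ n) = alg_map \<phi> x ^ n"
  by (induction n) auto

lemma anti_map_power [simp]: "anti_map \<phi> (x ^ n) = anti_map \<phi> x ^ n"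
  by (induction n) (auto simp: power_commutes)

lemma alg_map_word_span:
  assumes "x \<in> word_span G" "\<phi> ` G \<subseteq> H" shows "alg_map \<phi> x \<in> word_span H"
  by (rule plinear_word_span[OF _ _ _ assms(1)]) (use assms(2) in \<open>auto intro!: mon_in_word_span simp: image_subset_iff subset_iff\<close>)

lemma anti_map_word_span:
  assumes "x \<in> word_span G" "\<phi> ` G \<subseteq> H" shows "anti_map \<phi> x \<in> word_span H"
  by (rule plinear_word_span[OF _ _ _ assms(1)]) (use assms(2) in \<open>auto intro!: mon_in_word_span simp: image_subset_iff subset_iff\<close>)

subsection \<open>Ideals\<close>

text \<open>The span of the products \<open>u r v\<close> with \<open>u\<close> and \<open>v\<close> words in \<open>G\<close> and \<open>H\<close>; it is the two-sided
  ideal of the free algebra on \<open>G\<close> generated by \<open>S\<close> when \<open>G = H\<close>, and the right or left ideal when \<open>G\<close> or \<open>H\<close> is empty.\<close>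

definition ideal_span :: "'g set \<Rightarrow> 'g set \<Rightarrow> ('g free_mon \<Rightarrow>\<^sub>0 'k::comm_ring_1) set
    \<Rightarrow> ('g free_mon \<Rightarrow>\<^sub>0 'k) set" where
  "ideal_span G H S = pm.span {mon u * r * mon v |u r v. set u \<subseteq> G \<and> r \<in> S \<and> set v \<subseteq> H}"

lemma subspace_ideal_span [simp, intro]: "pm.subspace (ideal_span G H S)"
  by (simp add: ideal_span_def)

lemmas ideal_span_closed [simp, intro] = 
  pm.subspace_add[OF subspace_ideal_span] pm.subspace_diff[OF subspace_ideal_span]
  pm.subspace_scale[OF subspace_ideal_span] pm.subspace_sum[OF subspace_ideal_span]
  pm.subspace_0[OF subspace_ideal_span]

lemma ideal_span_base: "r \<in> S \<Longrightarrow> r \<in> ideal_span G H S"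
  unfolding ideal_span_def by (rule pm.span_base) (auto intro!: exI[of _ "[]"] exI[of _ r])

lemma plinear_ideal_span:
  assumes "plinear f"
    and "\<And>u r v. set u \<subseteq> G \<Longrightarrow> r \<in> S \<Longrightarrow> set v \<subseteq> H \<Longrightarrow> f (mon u * r * mon v) \<in> V"
    and "pm.subspace V" "x \<in> ideal_span G H S"
  shows "f x \<in> V"
  using assms(4) unfolding ideal_span_def
  by (rule plinear_image_span_subset[OF assms(1) _ assms(3), rotated]) (use assms(2) in auto)

lemma ideal_span_mult_left:
  assumes "x \<in> ideal_span G H S" "y \<in> word_span G"
  shows "y * x \<in> ideal_span G H S"
proof -
  have *: "mon w * x \<in> ideal_span G H S" if "set w \<subseteq> G" for w
  proof (rule plinear_ideal_span[OF _ _ _ assms(1)])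
    fix u v r assume "set u \<subseteq> G" "r \<in> S" "set v \<subseteq> H"
    then have "mon (w @ u) * r * mon v \<in> ideal_span G H S"
      unfolding ideal_span_def using that by (intro pm.span_base) force
    then show "mon w * (mon u * r * mon v) \<in> ideal_span G H S"
      by (simp add: mon_append mult.assoc)
  qed auto
  show ?thesis
    by (rule plinear_word_span[of "\<lambda>y. y * x", OF _ _ _ assms(2)]) (auto simp: *)
qed

lemma ideal_span_mult_right:
  assumes "x \<in> ideal_span G H S" "y \<in> word_span H"
  shows "x * y \<in> ideal_span G H S"
proof -
  have *: "x * mon w \<in> ideal_span G H S" if "set w \<subseteq> H" for w
  proof (rule plinear_ideal_span[of "\<lambda>x. x * mon w", OF _ _ _ assms(1)])
    fix u v r assume "set u \<subseteq> G" "r \<in> S" "set v \<subseteq> H"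
    then have "mon u * r * mon (v @ w) \<in> ideal_span G H S"
      unfolding ideal_span_def using that by (intro pm.span_base) force
    then show "mon u * r * mon v * mon w \<in> ideal_span G H S"
      by (simp add: mon_append mult.assoc)
  qed auto
  show ?thesis
    by (rule plinear_word_span[of "\<lambda>y. x * y", OF _ _ _ assms(2)]) (auto simp: *)
qed

lemma anti_map_ideal_span:
  assumes "\<phi> ` G \<subseteq> H'" "\<phi> ` H \<subseteq> G'"
    and "\<And>r. r \<in> S \<Longrightarrow> anti_map \<phi> r \<in> ideal_span G' H' S'"
    and "x \<in> ideal_span G H S"
  shows "anti_map \<phi> x \<in> ideal_span G' H' S'"
proof (rule plinear_ideal_span[OF _ _ _ assms(4)])
  fix u r v assume *: "set u \<subseteq> G" "r \<in> S" "set v \<subseteq> H"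
  then have "mon (rev (map \<phi> v)) * anti_map \<phi> r * mon (rev (map \<phi> u)) \<in> ideal_span G' H' S'"
    using assms(1,2)
    by (intro ideal_span_mult_right[OF ideal_span_mult_left[OF assms(3)[OF *(2)]]] mon_in_word_span)
       (use * in \<open>auto simp: image_subset_iff subset_iff\<close>)
  then show "anti_map \<phi> (mon u * r * mon v) \<in> ideal_span G' H' S'"
    by (simp add: mult.assoc)
qed auto

lemma ideal_span_mono: "S \<subseteq> S' \<Longrightarrow> ideal_span G H S \<subseteq> ideal_span G H S'"
  unfolding ideal_span_def by (intro pm.span_mono) blast

lemma sum_triangle_assoc:
  fixes f :: "nat \<Rightarrow> nat \<Rightarrow> nat \<Rightarrow> 'a::comm_monoid_add"
  shows "(\<Sum>n\<le>k. \<Sum>a\<le>n. f a (n - a) (k - n)) = (\<Sum>a\<le>k. \<Sum>b\<le>k - a. f a b (k - a - b))"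
  using fps_mult_assoc_lemma[of f k k] by (simp add: atLeast0AtMost)

lemma sum_triangle_swap:
  fixes f :: "nat \<Rightarrow> nat \<Rightarrow> nat \<Rightarrow> 'a::comm_monoid_add"
  shows "(\<Sum>a\<le>k. \<Sum>b\<le>k - a. f a b (k - a - b)) = (\<Sum>b\<le>k. \<Sum>a\<le>k - b. f a b (k - b - a))"
proof -
  have "(\<Sum>n\<le>k. \<Sum>a\<le>n. f a (n - a) (k - n)) = (\<Sum>n\<le>k. \<Sum>b\<le>n. f (n - b) b (k - n))"
  proof (rule sum.cong[OF refl])
    fix n show "(\<Sum>a\<le>n. f a (n - a) (k - n)) = (\<Sum>b\<le>n. f (n - b) b (k - n))"
      by (rule sum.reindex_bij_witness[of _ "\<lambda>b. n - b" "\<lambda>b. n - b"]) auto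
  qed
  then show ?thesis
    using sum_triangle_assoc[of f k] sum_triangle_assoc[of "\<lambda>b a m. f a b m" k] by simp
qed

section \<open>Quotients of modules of finitely supported functions\<close>

lemma scalars_simps [simp]:
  "carrier scalars = UNIV" "\<zero>\<^bsub>scalars\<^esub> = 0" "\<one>\<^bsub>scalars\<^esub> = 1"
  "a \<oplus>\<^bsub>scalars\<^esub> b = a + b" "a \<otimes>\<^bsub>scalars\<^esub> b = a * b"
  by (simp_all add: ring_of_type_algebra_def)

text \<open>A module \<open>M\<close> whose elements are finitely supported functions with the pointwise operations, and a
  submodule \<open>N\<close>. This covers the quotients of free modules that define tensor products and the quotient \<open>U\<^sub>q\<close> of the
  free algebra.\<close>

locale fsupp_quotient =
  fixes M :: "('k::comm_ring_1, 'x \<Rightarrow>\<^sub>0 'k, 'z) module_scheme" and N :: "('x \<Rightarrow>\<^sub>0 'k) set"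
  assumes add_M: "\<And>x y. x \<oplus>\<^bsub>M\<^esub> y = x + y" and zero_M: "\<zero>\<^bsub>M\<^esub> = 0" and smult_M: "\<And>c x. c \<odot>\<^bsub>M\<^esub> x = c *\<^sub>s x"
    and subspace_carrier: "pm.subspace (carrier M)"
    and subspace_N: "pm.subspace N" and N_subset: "N \<subseteq> carrier M"
begin

abbreviation "cls \<equiv> \<lambda>x. N +>\<^bsub>M\<^esub> x"
abbreviation "Q \<equiv> quotient_module M N"

lemmas carrier_closed [simp, intro] = pm.subspace_add[OF subspace_carrier] pm.subspace_scale[OF subspace_carrier]
  pm.subspace_0[OF subspace_carrier] pm.subspace_diff[OF subspace_carrier] pm.subspace_neg[OF subspace_carrier]

lemmas N_closed = pm.subspace_add[OF subspace_N] pm.subspace_scale[OF subspace_N]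
  pm.subspace_0[OF subspace_N] pm.subspace_diff[OF subspace_N] pm.subspace_neg[OF subspace_N]

lemma cls_eq_set: "cls x = {y. y - x \<in> N}"
proof -
  have "cls x = {n + x |n. n \<in> N}"
    by (auto simp: a_r_coset_def r_coset_def add_M)
  also have "\<dots> = {y. y - x \<in> N}"
  proof safe
    fix y assume "y - x \<in> N"
    then show "\<exists>n. y = n + x \<and> n \<in> N" by (intro exI[of _ "y - x"]) simp
  qed simp
  finally show ?thesis .
qed

lemma cls_eq_iff: "cls x = cls y \<longleftrightarrow> x - y \<in> N"
proof
  assume eq: "cls x = cls y"
  have "x \<in> cls x"
    unfolding cls_eq_set using N_closed(3) by simp
  then have "x \<in> cls y"
    by (simp only: eq)
  then show "x - y \<in> N"
    unfolding cls_eq_set by simp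
next
  assume d: "x - y \<in> N"
  have "z - y \<in> N" if "z - x \<in> N" for z
    using N_closed(1)[OF that d] by simp
  moreover have "z - x \<in> N" if "z - y \<in> N" for z
    using N_closed(4)[OF that d] by simp
  ultimately show "cls x = cls y"
    unfolding cls_eq_set by blast
qed

lemma cls_0: "cls 0 = N"
  unfolding cls_eq_set by simp

lemma carrier_Q: "carrier Q = cls ` carrier M"
  by (auto simp: quotient_module_def FactRing_def A_RCOSETS_def RCOSETS_def a_r_coset_def)

lemma zero_Q: "\<zero>\<^bsub>Q\<^esub> = cls 0"
  by (simp add: quotient_module_def FactRing_def cls_0)

lemma add_Q: "cls x \<oplus>\<^bsub>Q\<^esub> cls y = cls (x + y)"
proof -
  have "cls x \<oplus>\<^bsub>Q\<^esub> cls y = {a + b |a b. a - x \<in> N \<and> b - y \<in> N}"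
    unfolding quotient_module_def FactRing_def
    by (auto simp: set_add_def set_mult_def add_M cls_eq_set)
  also have "\<dots> = {z. z - (x + y) \<in> N}"
  proof safe
    fix a b assume "a - x \<in> N" "b - y \<in> N"
    from N_closed(1)[OF this] show "a + b - (x + y) \<in> N" by (simp add: algebra_simps)
  next
    fix z assume "z - (x + y) \<in> N"
    then show "\<exists>a b. z = a + b \<and> a - x \<in> N \<and> b - y \<in> N"
      using N_closed(3) by (intro exI[of _ "z - y"] exI[of _ y]) (simp add: algebra_simps)
  qed
  finally show ?thesis unfolding cls_eq_set .
qed

lemma smult_Q: "c \<odot>\<^bsub>Q\<^esub> cls x = cls (c *\<^sub>s x)"
proof -
  have "cls (c *\<^sub>s y) = cls (c *\<^sub>s x)" if "y \<in> cls x" for y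
    using that N_closed(2)[of "y - x" c] unfolding cls_eq_iff unfolding cls_eq_set
    by (simp add: pm.scale_right_diff_distrib)
  moreover have "x \<in> cls x"
    unfolding cls_eq_set using N_closed(3) by simp
  ultimately have "(\<Union>y\<in>cls x. cls (c *\<^sub>s y)) = cls (c *\<^sub>s x)"
    by blast
  then show ?thesis
    by (simp add: quotient_module_def smult_M)
qed

lemma abelian_group_Q: "abelian_group Q"
proof (rule abelian_groupI)
  fix x assume "x \<in> carrier Q"
  then obtain a where a: "a \<in> carrier M" "x = cls a" by (auto simp: carrier_Q)
  then show "\<exists>y\<in>carrier Q. y \<oplus>\<^bsub>Q\<^esub> x = \<zero>\<^bsub>Q\<^esub>"
    by (intro bexI[of _ "cls (- a)"]) (auto simp: add_Q zero_Q carrier_Q)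
qed (auto simp: carrier_Q add_Q zero_Q ac_simps)

lemma module_Q: "module scalars Q"
proof (rule moduleI)
  show "abelian_group Q" by (rule abelian_group_Q)
qed (auto simp: carrier_Q add_Q smult_Q pm.scale_left_distrib pm.scale_right_distrib
    comm_ring_1_class.cring_from_type_algebra)

text \<open>The quotient is multiplicative at \<open>x\<close>, \<open>y\<close> as soon as the product respects \<open>N\<close> there; in the application it
  does so only on the carrier.\<close>

lemma cls_mult:
  assumes "\<And>x y. x \<otimes>\<^bsub>M\<^esub> y = f x y"
    and "\<And>a b. a - x \<in> N \<Longrightarrow> b - y \<in> N \<Longrightarrow> f a b - f x y \<in> N"
  shows "cls x \<otimes>\<^bsub>Q\<^esub> cls y = cls (f x y)"
proof -
  have "cls (f a b) = cls (f x y)" if "a \<in> cls x" "b \<in> cls y" for a b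
    using that assms(2) unfolding cls_eq_iff unfolding cls_eq_set by simp
  moreover have "x \<in> cls x" "y \<in> cls y"
    unfolding cls_eq_set using N_closed(3) by auto
  ultimately have "(\<Union>a\<in>cls x. \<Union>b\<in>cls y. cls (f a b)) = cls (f x y)"
    by blast
  then show ?thesis
    by (simp add: quotient_module_def FactRing_def rcoset_mult_def assms(1))
qed

end

section \<open>Tensor products\<close>

lemma free_module_simps [simp]:
  "carrier (free_module G) = {f. Poly_Mapping.keys f \<subseteq> G}" "add (free_module G) = (+)"
  "\<zero>\<^bsub>free_module G\<^esub> = 0" "module.smult (free_module G) = (*\<^sub>s)"
  by (simp_all add: free_module_def)

lemma keys_pscale: "Poly_Mapping.keys (c *\<^sub>s x) \<subseteq> Poly_Mapping.keys x"
  by (auto simp: in_keys_iff)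

lemma subspace_free_module: "pm.subspace {f :: 'x \<Rightarrow>\<^sub>0 'k::comm_ring_1. Poly_Mapping.keys f \<subseteq> G}"
proof -
  have "Poly_Mapping.keys (x + y) \<subseteq> G" if "Poly_Mapping.keys x \<subseteq> G" "Poly_Mapping.keys y \<subseteq> G"
    for x y :: "'x \<Rightarrow>\<^sub>0 'k"
    using Poly_Mapping.keys_add[of x y] that by blast
  moreover have "Poly_Mapping.keys (c *\<^sub>s x) \<subseteq> G" if "Poly_Mapping.keys x \<subseteq> G" for c and x :: "'x \<Rightarrow>\<^sub>0 'k"
    using that keys_pscale[of c x] by blast
  ultimately show ?thesis
    by (simp add: pm.subspace_def)
qed

lemma abelian_group_free_module: "abelian_group (free_module G :: ('k::comm_ring_1, 'x \<Rightarrow>\<^sub>0 'k) module)"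
proof (rule abelian_groupI)
  fix x assume "x \<in> carrier (free_module G :: ('k, 'x \<Rightarrow>\<^sub>0 'k) module)"
  then show "\<exists>y\<in>carrier (free_module G). y \<oplus>\<^bsub>free_module G\<^esub> x = \<zero>\<^bsub>free_module G\<^esub>"
    by (intro bexI[of _ "- x"]) auto
next
  fix x y assume "x \<in> carrier (free_module G :: ('k, 'x \<Rightarrow>\<^sub>0 'k) module)" "y \<in> carrier (free_module G :: ('k, 'x \<Rightarrow>\<^sub>0 'k) module)"
  then show "x \<oplus>\<^bsub>free_module G\<^esub> y \<in> carrier (free_module G)"
    using pm.subspace_add[OF subspace_free_module[of G]] by simp
qed (auto simp: ac_simps)

lemma module_free_module: "module scalars (free_module G :: ('k::comm_ring_1, 'x \<Rightarrow>\<^sub>0 'k) module)"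
proof (rule moduleI)
  show "abelian_group (free_module G :: ('k, 'x \<Rightarrow>\<^sub>0 'k) module)"
    by (rule abelian_group_free_module)
qed (use pm.subspace_scale[OF subspace_free_module[of G]] in \<open>auto simp: pm.scale_left_distrib
    pm.scale_right_distrib comm_ring_1_class.cring_from_type_algebra\<close>)

text \<open>For such modules a submodule in the sense of \<open>submodule\<close> is the same as a subspace contained in the carrier.\<close>

lemma submodule_imp_subspace:
  assumes "submodule S scalars M" "module scalars M" "add M = (+)" "\<zero>\<^bsub>M\<^esub> = 0" "module.smult M = (*\<^sub>s)"
  shows "pm.subspace S"
proof -
  interpret module scalars M by fact
  note E = submoduleE[OF assms(1)]
  obtain x where x: "x \<in> S" using E(2) by auto
  have "0 *\<^sub>s x \<in> S"
    using E(4)[of 0 x] x by (simp add: assms)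
  then show ?thesis
    unfolding pm.subspace_def using E(4,5) by (auto simp: assms)
qed

lemma subspace_imp_submodule:
  assumes "pm.subspace S" "S \<subseteq> carrier M" "module scalars M" "add M = (+)" "\<zero>\<^bsub>M\<^esub> = 0" "module.smult M = (*\<^sub>s)"
  shows "submodule S scalars M"
proof -
  interpret module scalars M by fact
  have inv: "\<ominus>\<^bsub>M\<^esub> a = - a" if "a \<in> S" for a
  proof (rule M.minus_equality)
    have "(- 1) *\<^sub>s a \<in> S" using assms that by (intro pm.subspace_scale)
    then show "- a \<in> carrier M" using assms(2) by auto
  qed (use assms that in auto)
  show ?thesis
    by (rule submoduleI)
       (use assms inv in \<open>auto simp: pm.subspace_add pm.subspace_scale pm.subspace_0 pm.subspace_neg\<close>)
qed

lemma generated_submodule_free_module: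
  assumes "R \<subseteq> carrier (free_module G)"
  shows "generated_submodule (free_module G) R = pm.span R"
proof -
  have "submodule S scalars (free_module G) \<longleftrightarrow> pm.subspace S \<and> S \<subseteq> carrier (free_module G)"
    for S :: "('a \<Rightarrow>\<^sub>0 'b) set"
    using submodule_imp_subspace[of S "free_module G"] subspace_imp_submodule[of S "free_module G"]
      module.submoduleE(1)[OF module_free_module, of S] module_free_module[of G] by auto
  moreover have "pm.span R \<subseteq> carrier (free_module G)"
    using assms subspace_free_module[of G] by (intro pm.span_minimal) auto
  ultimately show ?thesis
    unfolding generated_submodule_def using pm.span_superset[of R] pm.subspace_span[of R] pm.span_minimal[of R]
    by (intro subset_antisym Inter_lower Inter_greatest) auto
qed

locale tensor_product =
  fixes M :: "('k::comm_ring_1, 'a, 'z) module_scheme" and N :: "('k, 'b, 'w) module_scheme"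
  assumes module_M: "module scalars M" and module_N: "module scalars N"
begin

sublocale M: module scalars M by (rule module_M)
sublocale N: module scalars N by (rule module_N)

abbreviation "XX \<equiv> carrier M \<times> carrier N"

lemma relators_subset: "tensor_relators M N \<subseteq> carrier (free_module XX)"
proof
  fix r :: "'a \<times> 'b \<Rightarrow>\<^sub>0 'k"
  let ?F = "{f :: 'a \<times> 'b \<Rightarrow>\<^sub>0 'k. Poly_Mapping.keys f \<subseteq> XX}"
  have single: "Poly_Mapping.single (x, y) c \<in> ?F" if "x \<in> carrier M" "y \<in> carrier N" for x y c
    using that by auto
  assume "r \<in> tensor_relators M N"
  then show "r \<in> carrier (free_module XX)"
    unfolding free_module_simps
    by cases (hypsubst, (intro pm.subspace_diff[OF subspace_free_module] single; simp))+
qed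

lemma tensor_kernel_span: "tensor_kernel M N = pm.span (tensor_relators M N)"
  unfolding tensor_kernel_def by (rule generated_submodule_free_module[OF relators_subset])

sublocale T: fsupp_quotient "free_module XX" "tensor_kernel M N"
proof
  show "tensor_kernel M N \<subseteq> carrier (free_module XX)"
    unfolding tensor_kernel_span using relators_subset subspace_free_module[of XX]
    by (intro pm.span_minimal) auto
qed (auto simp: subspace_free_module tensor_kernel_span)

abbreviation pure :: "'a \<Rightarrow> 'b \<Rightarrow> ('a \<times> 'b \<Rightarrow>\<^sub>0 'k) set" where
  "pure \<equiv> pure_tensor M N"

lemma tensor_Q: "tensor M N = T.Q"
  by (simp add: tensor_def)

lemma pure_cls: "pure x y = T.cls (Poly_Mapping.single (x, y) 1)"
  by (simp add: pure_tensor_def)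

lemma module_tensor: "module scalars (tensor M N)"
  unfolding tensor_Q by (rule T.module_Q)

lemma pure_closed: "x \<in> carrier M \<Longrightarrow> y \<in> carrier N \<Longrightarrow> pure x y \<in> carrier (tensor M N)"
  unfolding tensor_Q T.carrier_Q pure_cls by (intro imageI) auto

lemma relator_cls: "a - b \<in> tensor_relators M N \<Longrightarrow> T.cls a = T.cls b"
  by (simp only: T.cls_eq_iff) (simp only: tensor_kernel_span pm.span_base)

lemma pure_add_left: "\<lbrakk>x \<in> carrier M; x' \<in> carrier M; y \<in> carrier N\<rbrakk> \<Longrightarrow>
    pure (x \<oplus>\<^bsub>M\<^esub> x') y = pure x y \<oplus>\<^bsub>tensor M N\<^esub> pure x' y"
  unfolding pure_cls tensor_Q T.add_Q
  using tensor_relators.add_left by (intro relator_cls) (fastforce simp: diff_diff_eq)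

lemma pure_add_right: "\<lbrakk>x \<in> carrier M; y \<in> carrier N; y' \<in> carrier N\<rbrakk> \<Longrightarrow>
    pure x (y \<oplus>\<^bsub>N\<^esub> y') = pure x y \<oplus>\<^bsub>tensor M N\<^esub> pure x y'"
  unfolding pure_cls tensor_Q T.add_Q
  using tensor_relators.add_right by (intro relator_cls) (fastforce simp: diff_diff_eq)

lemma pure_smult_left: "\<lbrakk>x \<in> carrier M; y \<in> carrier N\<rbrakk> \<Longrightarrow>
    pure (c \<odot>\<^bsub>M\<^esub> x) y = c \<odot>\<^bsub>tensor M N\<^esub> pure x y"
  unfolding pure_cls tensor_Q T.smult_Q
  using tensor_relators.smult_left by (intro relator_cls) fastforce

lemma pure_smult_right: "\<lbrakk>x \<in> carrier M; y \<in> carrier N\<rbrakk> \<Longrightarrow>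
    pure x (c \<odot>\<^bsub>N\<^esub> y) = c \<odot>\<^bsub>tensor M N\<^esub> pure x y"
  unfolding pure_cls tensor_Q T.smult_Q
  using tensor_relators.smult_right by (intro relator_cls) fastforce

lemma tensor_zero: "\<zero>\<^bsub>tensor M N\<^esub> = T.cls 0"
  unfolding tensor_Q by (rule T.zero_Q)

lemma pure_zero_left: "y \<in> carrier N \<Longrightarrow> pure \<zero>\<^bsub>M\<^esub> y = \<zero>\<^bsub>tensor M N\<^esub>"
  using pure_smult_left[of "\<zero>\<^bsub>M\<^esub>" y 0] M.smult_l_null[of "\<zero>\<^bsub>M\<^esub>"]
    module.smult_l_null[OF module_tensor pure_closed[of "\<zero>\<^bsub>M\<^esub>" y]] by simp

lemma pure_zero_right: "x \<in> carrier M \<Longrightarrow> pure x \<zero>\<^bsub>N\<^esub> = \<zero>\<^bsub>tensor M N\<^esub>"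
  using pure_smult_right[of x "\<zero>\<^bsub>N\<^esub>" 0] N.smult_l_null[of "\<zero>\<^bsub>N\<^esub>"]
    module.smult_l_null[OF module_tensor pure_closed[of x "\<zero>\<^bsub>N\<^esub>"]] by simp

lemma tensor_induct [consumes 1, case_names zero step]:
  assumes "t \<in> carrier (tensor M N)" "P \<zero>\<^bsub>tensor M N\<^esub>"
    and step: "\<And>x y t. x \<in> carrier M \<Longrightarrow> y \<in> carrier N \<Longrightarrow> t \<in> carrier (tensor M N) \<Longrightarrow> P t
      \<Longrightarrow> P (pure x y \<oplus>\<^bsub>tensor M N\<^esub> t)"
  shows "P t"
proof -
  obtain f where f: "t = T.cls f" "Poly_Mapping.keys f \<subseteq> XX"
    using assms(1) unfolding tensor_Q T.carrier_Q by auto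
  have "P (T.cls (\<Sum>k\<in>K. lookup f k *\<^sub>s Poly_Mapping.single k 1))
    \<and> T.cls (\<Sum>k\<in>K. lookup f k *\<^sub>s Poly_Mapping.single k 1) \<in> carrier (tensor M N)"
    if "finite K" "K \<subseteq> XX" for K
    using that
  proof (induction K rule: finite_induct)
    case empty
    have "\<zero>\<^bsub>tensor M N\<^esub> \<in> carrier (tensor M N)"
      using abelian_group.axioms(1)[OF module.axioms(2)[OF module_tensor]] abelian_monoid.zero_closed by blast
    then show ?case using assms(2) by (simp add: tensor_zero)
  next
    case (insert k K)
    obtain x y where k: "k = (x, y)" by force
    then have xy: "x \<in> carrier M" "y \<in> carrier N" using insert by auto
    let ?g = "\<Sum>k\<in>K. lookup f k *\<^sub>s Poly_Mapping.single k 1"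
    have IH: "P (T.cls ?g)" "T.cls ?g \<in> carrier (tensor M N)" using insert by auto
    have c: "lookup f k \<odot>\<^bsub>M\<^esub> x \<in> carrier M" using xy by simp
    have "T.cls (\<Sum>k\<in>insert k K. lookup f k *\<^sub>s Poly_Mapping.single k 1) = pure (lookup f k \<odot>\<^bsub>M\<^esub> x) y \<oplus>\<^bsub>tensor M N\<^esub> T.cls ?g"
      using xy
      by (simp only: sum.insert[OF insert.hyps] pure_smult_left) (simp only: pure_cls tensor_Q T.smult_Q T.add_Q k)
    moreover have "pure (lookup f k \<odot>\<^bsub>M\<^esub> x) y \<oplus>\<^bsub>tensor M N\<^esub> T.cls ?g \<in> carrier (tensor M N)"
      using abelian_monoid.a_closed[OF abelian_group.axioms(1)[OF module.axioms(2)[OF module_tensor]]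
          pure_closed[OF c xy(2)] IH(2)] .
    ultimately show ?case
      using step[OF c xy(2) IH(2) IH(1)] by (simp only:)
  qed
  from this[OF finite_keys f(2)] show ?thesis
    unfolding f(1) poly_mapping_expand[symmetric] by simp
qed

text \<open>The universal property.\<close>

lemma tensor_lift:
  assumes "module scalars P"
    and closed: "\<And>x y. x \<in> carrier M \<Longrightarrow> y \<in> carrier N \<Longrightarrow> \<beta> x y \<in> carrier P"
    and bilinear: "\<And>x x' y. \<lbrakk>x \<in> carrier M; x' \<in> carrier M; y \<in> carrier N\<rbrakk> \<Longrightarrow> \<beta> (x \<oplus>\<^bsub>M\<^esub> x') y = \<beta> x y \<oplus>\<^bsub>P\<^esub> \<beta> x' y"
      "\<And>x y y'. \<lbrakk>x \<in> carrier M; y \<in> carrier N; y' \<in> carrier N\<rbrakk> \<Longrightarrow> \<beta> x (y \<oplus>\<^bsub>N\<^esub> y') = \<beta> x y \<oplus>\<^bsub>P\<^esub> \<beta> x y'"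
      "\<And>x y c. \<lbrakk>x \<in> carrier M; y \<in> carrier N\<rbrakk> \<Longrightarrow> \<beta> (c \<odot>\<^bsub>M\<^esub> x) y = c \<odot>\<^bsub>P\<^esub> \<beta> x y"
      "\<And>x y c. \<lbrakk>x \<in> carrier M; y \<in> carrier N\<rbrakk> \<Longrightarrow> \<beta> x (c \<odot>\<^bsub>N\<^esub> y) = c \<odot>\<^bsub>P\<^esub> \<beta> x y"
  obtains \<phi> where "\<And>t. t \<in> carrier (tensor M N) \<Longrightarrow> \<phi> t \<in> carrier P"
    "\<And>t t'. \<lbrakk>t \<in> carrier (tensor M N); t' \<in> carrier (tensor M N)\<rbrakk> \<Longrightarrow> \<phi> (t \<oplus>\<^bsub>tensor M N\<^esub> t') = \<phi> t \<oplus>\<^bsub>P\<^esub> \<phi> t'"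
    "\<And>t c. t \<in> carrier (tensor M N) \<Longrightarrow> \<phi> (c \<odot>\<^bsub>tensor M N\<^esub> t) = c \<odot>\<^bsub>P\<^esub> \<phi> t"
    "\<And>x y. \<lbrakk>x \<in> carrier M; y \<in> carrier N\<rbrakk> \<Longrightarrow> \<phi> (pure x y) = \<beta> x y"
proof -
  interpret P: module scalars P by fact
  define b where "b = (\<lambda>k. \<beta> (fst k) (snd k))"
  define L where "L f = (\<Oplus>\<^bsub>P\<^esub>k\<in>Poly_Mapping.keys f. lookup f k \<odot>\<^bsub>P\<^esub> b k)" for f :: "'a \<times> 'b \<Rightarrow>\<^sub>0 'k"
  have b: "b k \<in> carrier P" if "k \<in> XX" for k
    using that closed by (auto simp: b_def)
  have L_superset: "L f = (\<Oplus>\<^bsub>P\<^esub>k\<in>K. lookup f k \<odot>\<^bsub>P\<^esub> b k)"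
    if "finite K" "K \<subseteq> XX" "Poly_Mapping.keys f \<subseteq> K" for f K
    unfolding L_def
  proof (rule P.add.finprod_mono_neutral_cong_left)
    fix k assume k: "k \<in> K - Poly_Mapping.keys f"
    then show "lookup f k \<odot>\<^bsub>P\<^esub> b k = \<zero>\<^bsub>P\<^esub>"
      using that P.smult_l_null[OF b[of k]] by (auto simp: in_keys_iff)
  qed (use that b in auto)
  have one: "1 \<odot>\<^bsub>P\<^esub> x = x" if "x \<in> carrier P" for x
    using P.smult_one[OF that] by simp
  have L_closed: "L f \<in> carrier P" if "Poly_Mapping.keys f \<subseteq> XX" for f
    unfolding L_def using that b by (intro P.finsum_closed) auto
  have L_add: "L (f + g) = L f \<oplus>\<^bsub>P\<^esub> L g" if "Poly_Mapping.keys f \<subseteq> XX" "Poly_Mapping.keys g \<subseteq> XX" for f g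
  proof -
    let ?K = "Poly_Mapping.keys f \<union> Poly_Mapping.keys g"
    have K: "?K \<subseteq> XX" "finite ?K" using that by auto
    have "L (f + g) = (\<Oplus>\<^bsub>P\<^esub>k\<in>?K. lookup (f + g) k \<odot>\<^bsub>P\<^esub> b k)"
      using K by (intro L_superset Poly_Mapping.keys_add) auto
    also have "\<dots> = (\<Oplus>\<^bsub>P\<^esub>k\<in>?K. lookup f k \<odot>\<^bsub>P\<^esub> b k \<oplus>\<^bsub>P\<^esub> lookup g k \<odot>\<^bsub>P\<^esub> b k)"
      using K b P.smult_l_distr[of "lookup f _" "lookup g _"]
      by (intro P.finsum_cong') (auto simp: lookup_add)
    also have "\<dots> = (\<Oplus>\<^bsub>P\<^esub>k\<in>?K. lookup f k \<odot>\<^bsub>P\<^esub> b k) \<oplus>\<^bsub>P\<^esub> (\<Oplus>\<^bsub>P\<^esub>k\<in>?K. lookup g k \<odot>\<^bsub>P\<^esub> b k)"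
      using K b by (intro P.finsum_addf) auto
    finally show ?thesis
      using L_superset[of ?K f] L_superset[of ?K g] K by auto
  qed
  have L_single: "L (Poly_Mapping.single k c) = c \<odot>\<^bsub>P\<^esub> b k" if "k \<in> XX" for k c
    using L_superset[of "{k}" "Poly_Mapping.single k c"] that b[OF that] by (simp add: lookup_single)
  have L_smult: "L (c *\<^sub>s f) = c \<odot>\<^bsub>P\<^esub> L f" if "Poly_Mapping.keys f \<subseteq> XX" for c f
  proof -
    have "L (c *\<^sub>s f) = (\<Oplus>\<^bsub>P\<^esub>k\<in>Poly_Mapping.keys f. lookup (c *\<^sub>s f) k \<odot>\<^bsub>P\<^esub> b k)"
      using that by (intro L_superset keys_pscale) auto
    also have "\<dots> = (\<Oplus>\<^bsub>P\<^esub>k\<in>Poly_Mapping.keys f. c \<odot>\<^bsub>P\<^esub> (lookup f k \<odot>\<^bsub>P\<^esub> b k))"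
      using that b P.smult_assoc1[of c "lookup f _"] by (intro P.finsum_cong') auto
    also have "\<dots> = c \<odot>\<^bsub>P\<^esub> L f"
      unfolding L_def using that b by (intro P.finsum_smult_ldistr[symmetric]) auto
    finally show ?thesis .
  qed
  have L_diff_zero: "L (f - g) = \<zero>\<^bsub>P\<^esub>" if "L f = L g" "Poly_Mapping.keys f \<subseteq> XX" "Poly_Mapping.keys g \<subseteq> XX" for f g
  proof -
    have k: "Poly_Mapping.keys (- 1 *\<^sub>s g) \<subseteq> XX"
      using that keys_pscale[of "- 1" g] by blast
    have "L (f - g) = L (f + - 1 *\<^sub>s g)" by simp
    also have "\<dots> = L g \<oplus>\<^bsub>P\<^esub> L (- 1 *\<^sub>s g)"
      using L_add[OF that(2) k] that by simp
    also have "\<dots> = L (g + - 1 *\<^sub>s g)"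
      using L_add[OF that(3) k] by simp
    also have "\<dots> = \<zero>\<^bsub>P\<^esub>"
      by (simp add: L_def)
    finally show ?thesis .
  qed
  have L_relator: "L r = \<zero>\<^bsub>P\<^esub>" if "r \<in> tensor_relators M N" for r
    using that
  proof (induction rule: tensor_relators.induct)
    case (add_left x x' y)
    let ?f = "Poly_Mapping.single (x \<oplus>\<^bsub>M\<^esub> x', y) 1" and ?g = "Poly_Mapping.single (x, y) 1 + Poly_Mapping.single (x', y) 1 :: _ \<Rightarrow>\<^sub>0 'k"
    have "Poly_Mapping.keys ?g \<subseteq> XX"
      using Poly_Mapping.keys_add[of "Poly_Mapping.single (x, y) 1" "Poly_Mapping.single (x', y) (1 :: 'k)"] add_left by fastforce
    moreover have "L ?f = L ?g"
      using add_left by (subst L_add) (auto simp: L_single b_def bilinear closed one)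
    ultimately have "L (?f - ?g) = \<zero>\<^bsub>P\<^esub>"
      using add_left by (intro L_diff_zero) auto
    then show ?case by (simp add: diff_diff_eq)
  next
    case (add_right x y y')
    let ?f = "Poly_Mapping.single (x, y \<oplus>\<^bsub>N\<^esub> y') 1" and ?g = "Poly_Mapping.single (x, y) 1 + Poly_Mapping.single (x, y') 1 :: _ \<Rightarrow>\<^sub>0 'k"
    have "Poly_Mapping.keys ?g \<subseteq> XX"
      using Poly_Mapping.keys_add[of "Poly_Mapping.single (x, y) 1" "Poly_Mapping.single (x, y') (1 :: 'k)"] add_right by fastforce
    moreover have "L ?f = L ?g"
      using add_right by (subst L_add) (auto simp: L_single b_def bilinear closed one)
    ultimately have "L (?f - ?g) = \<zero>\<^bsub>P\<^esub>"
      using add_right by (intro L_diff_zero) auto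
    then show ?case by (simp add: diff_diff_eq)
  next
    case (smult_left x y c)
    then show ?case
      by (intro L_diff_zero) (auto simp: L_single b_def bilinear closed one)
  next
    case (smult_right x y c)
    then show ?case
      by (intro L_diff_zero) (auto simp: L_single b_def bilinear closed one)
  qed
  have L_kernel: "L f = \<zero>\<^bsub>P\<^esub>" if "f \<in> tensor_kernel M N" for f
  proof -
    have "Poly_Mapping.keys f \<subseteq> XX \<and> L f = \<zero>\<^bsub>P\<^esub>"
      using that unfolding tensor_kernel_span
    proof (induction rule: pm.span_induct_alt)
      case base
      then show ?case by (simp add: L_def)
    next
      case (step c x y)
      have x: "Poly_Mapping.keys x \<subseteq> XX" using relators_subset step(1) by auto
      then have cx: "Poly_Mapping.keys (c *\<^sub>s x) \<subseteq> XX" using keys_pscale[of c x] by blast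
      have "Poly_Mapping.keys (c *\<^sub>s x + y) \<subseteq> XX"
        using Poly_Mapping.keys_add[of "c *\<^sub>s x" y] cx step by blast
      then show ?case
        using L_add[OF cx] L_smult[OF x] L_relator[OF step(1)] step P.smult_r_null[of c] by simp
    qed
    then show ?thesis by simp
  qed
  define \<phi> where "\<phi> C = L (SOME f. f \<in> C \<and> Poly_Mapping.keys f \<subseteq> XX)" for C
  have \<phi>_cls: "\<phi> (T.cls f) = L f" if f: "Poly_Mapping.keys f \<subseteq> XX" for f
  proof -
    have "f \<in> T.cls f \<and> Poly_Mapping.keys f \<subseteq> XX"
      unfolding T.cls_eq_set using f T.N_closed(3) by simp
    then have "(SOME g. g \<in> T.cls f \<and> Poly_Mapping.keys g \<subseteq> XX) \<in> T.cls f
        \<and> Poly_Mapping.keys (SOME g. g \<in> T.cls f \<and> Poly_Mapping.keys g \<subseteq> XX) \<subseteq> XX"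
      by (rule someI)
    then obtain g where g: "\<phi> (T.cls f) = L g" "g - f \<in> tensor_kernel M N" "Poly_Mapping.keys g \<subseteq> XX"
      unfolding \<phi>_def T.cls_eq_set by blast
    have "Poly_Mapping.keys (g - f) \<subseteq> XX"
      using g(2) T.N_subset by auto
    then have "L ((g - f) + f) = L (g - f) \<oplus>\<^bsub>P\<^esub> L f"
      using f by (rule L_add)
    then show ?thesis
      using g L_kernel L_closed[OF f] by simp
  qed
  have keys: "Poly_Mapping.keys (f + g) \<subseteq> XX" if "Poly_Mapping.keys f \<subseteq> XX" "Poly_Mapping.keys g \<subseteq> XX"
    for f g :: "'a \<times> 'b \<Rightarrow>\<^sub>0 'k"
    using Poly_Mapping.keys_add[of f g] that by blast
  show ?thesis
  proof (rule that[of \<phi>])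
    fix t assume "t \<in> carrier (tensor M N)"
    then obtain f where "t = T.cls f" "Poly_Mapping.keys f \<subseteq> XX"
      unfolding tensor_Q T.carrier_Q by auto
    then show "\<phi> t \<in> carrier P" by (simp add: \<phi>_cls L_closed)
  next
    fix t t' assume "t \<in> carrier (tensor M N)" "t' \<in> carrier (tensor M N)"
    then obtain f g where "t = T.cls f" "Poly_Mapping.keys f \<subseteq> XX" "t' = T.cls g" "Poly_Mapping.keys g \<subseteq> XX"
      unfolding tensor_Q T.carrier_Q by auto
    then show "\<phi> (t \<oplus>\<^bsub>tensor M N\<^esub> t') = \<phi> t \<oplus>\<^bsub>P\<^esub> \<phi> t'"
      unfolding tensor_Q by (simp only: T.add_Q) (simp add: \<phi>_cls L_add keys)
  next
    fix t c assume "t \<in> carrier (tensor M N)"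
    then obtain f where f: "t = T.cls f" "Poly_Mapping.keys f \<subseteq> XX"
      unfolding tensor_Q T.carrier_Q by auto
    then have "Poly_Mapping.keys (c *\<^sub>s f) \<subseteq> XX" using keys_pscale[of c f] by blast
    then show "\<phi> (c \<odot>\<^bsub>tensor M N\<^esub> t) = c \<odot>\<^bsub>P\<^esub> \<phi> t"
      using f unfolding tensor_Q by (simp only: T.smult_Q) (simp add: \<phi>_cls L_smult)
  next
    fix x y assume xy: "x \<in> carrier M" "y \<in> carrier N"
    then have "\<phi> (pure x y) = L (Poly_Mapping.single (x, y) 1)"
      unfolding pure_cls by (intro \<phi>_cls) auto
    also have "\<dots> = \<beta> x y"
      using xy P.smult_one[OF closed[OF xy]] by (subst L_single) (auto simp: b_def)
    finally show "\<phi> (pure x y) = \<beta> x y" .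
  qed
qed

end

section \<open>The free algebra as a ring and its ideals\<close>

lemma free_algebra_simps [simp]:
  "carrier (free_algebra G) = word_span G" "add (free_algebra G) = (+)" "monoid.mult (free_algebra G) = (*)"
  "\<zero>\<^bsub>free_algebra G\<^esub> = 0" "\<one>\<^bsub>free_algebra G\<^esub> = 1" "module.smult (free_algebra G) = (*\<^sub>s)"
  by (simp_all add: carrier_free_algebra) (simp_all add: free_algebra_def)

lemma abelian_group_free_algebra: "abelian_group (free_algebra G :: ('k::comm_ring_1, 'g free_mon \<Rightarrow>\<^sub>0 'k) module)"
proof (rule abelian_groupI)
  fix x assume x: "x \<in> carrier (free_algebra G :: ('k, 'g free_mon \<Rightarrow>\<^sub>0 'k) module)"
  then have "- x \<in> word_span G"
    using pm.subspace_neg[OF subspace_word_span, of x] by simp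
  then show "\<exists>y\<in>carrier (free_algebra G). y \<oplus>\<^bsub>free_algebra G\<^esub> x = \<zero>\<^bsub>free_algebra G\<^esub>"
    by (intro bexI[of _ "- x"]) auto
qed (auto simp: ac_simps)

lemma module_free_algebra: "module scalars (free_algebra G :: ('k::comm_ring_1, 'g free_mon \<Rightarrow>\<^sub>0 'k) module)"
proof (rule moduleI)
  show "abelian_group (free_algebra G :: ('k, 'g free_mon \<Rightarrow>\<^sub>0 'k) module)"
    by (rule abelian_group_free_algebra)
qed (auto simp: pm.scale_left_distrib pm.scale_right_distrib comm_ring_1_class.cring_from_type_algebra)

lemma ring_free_algebra: "ring (free_algebra G :: ('k::comm_ring_1, 'g free_mon \<Rightarrow>\<^sub>0 'k) module)"
proof (rule ringI)
  show "abelian_group (free_algebra G :: ('k, 'g free_mon \<Rightarrow>\<^sub>0 'k) module)"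
    by (rule abelian_group_free_algebra)
  show "Group.monoid (free_algebra G :: ('k, 'g free_mon \<Rightarrow>\<^sub>0 'k) module)"
    by (rule monoidI) (auto simp: mult.assoc)
qed (auto simp: distrib_left distrib_right)

lemma ideal_span_subset_word_span:
  assumes "S \<subseteq> word_span G" "x \<in> ideal_span G G S" shows "x \<in> word_span G"
  by (rule plinear_ideal_span[of "\<lambda>x. x", OF _ _ _ assms(2)])
     (use assms(1) in \<open>auto intro!: word_span_mult\<close>)

lemma genideal_free_algebra:
  fixes S :: "('g free_mon \<Rightarrow>\<^sub>0 'k::comm_ring_1) set"
  assumes S: "S \<subseteq> word_span G"
  shows "Idl\<^bsub>free_algebra G\<^esub> S = ideal_span G G S"
proof
  let ?A = "free_algebra G :: ('k, 'g free_mon \<Rightarrow>\<^sub>0 'k) module"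
  have "submodule (ideal_span G G S) scalars ?A"
    using ideal_span_subset_word_span[OF S]
    by (intro subspace_imp_submodule module_free_algebra) auto
  then have "subgroup (ideal_span G G S) (add_monoid ?A)"
    by (rule submodule.axioms(1))
  then have "ideal (ideal_span G G S) ?A"
    by (intro idealI ring_free_algebra) (auto intro: ideal_span_mult_left ideal_span_mult_right)
  then show "Idl\<^bsub>?A\<^esub> S \<subseteq> ideal_span G G S"
    unfolding genideal_def using ideal_span_base by blast
  show "ideal_span G G S \<subseteq> Idl\<^bsub>?A\<^esub> S"
    unfolding genideal_def
  proof (intro Inter_greatest subsetI)
    fix I' x assume I': "I' \<in> {I. ideal I ?A \<and> S \<subseteq> I}" and x: "x \<in> ideal_span G G S"
    then interpret ideal I' ?A by auto
    have l: "y * a \<in> I'" if "a \<in> I'" "y \<in> word_span G" for a y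
      using I_l_closed[of a y] that by simp
    have r: "a * y \<in> I'" if "a \<in> I'" "y \<in> word_span G" for a y
      using I_r_closed[of a y] that by simp
    have "c *\<^sub>s a \<in> I'" if "a \<in> I'" for c a
    proof -
      have "c *\<^sub>s a = (c *\<^sub>s 1) * a" by simp
      moreover have "(c *\<^sub>s 1) * a \<in> I'" using that by (intro l) auto
      ultimately show ?thesis by (simp only:)
    qed
    moreover have "0 \<in> I'" using additive_subgroup.zero_closed[OF is_additive_subgroup] by simp
    moreover have "a + b \<in> I'" if "a \<in> I'" "b \<in> I'" for a b
      using additive_subgroup.a_closed[OF is_additive_subgroup that] by simp
    ultimately have "pm.subspace I'"
      by (simp add: pm.subspace_def)
    moreover have "mon u * s * mon v \<in> I'" if "set u \<subseteq> G" "s \<in> S" "set v \<subseteq> G" for u s v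
      using that I' by (intro r[OF l]) auto
    ultimately show "x \<in> I'"
      using x by (intro plinear_ideal_span[of "\<lambda>x. x" G S G I' x]) auto
  qed
qed

section \<open>Powers of \<open>q\<close> and Gaussian binomial coefficients\<close>

text \<open>\<open>qq n\<close> is \<open>q\<^sup>n\<close>. All powers of \<open>q\<^sub>i\<close> and \<open>q\<^sub>(\<^sub>i\<^sub>)\<close> are written in this form, so that identities between coefficients
  become identities between integers.\<close>

definition qq :: "int \<Rightarrow> qfield" where "qq n = q_var powi n"

lemma q_var_power: "q_var ^ n = Fraction_Field.Fract (Polynomial.monom 1 n) 1"
proof (induction n)
  case 0
  then show ?case by (simp add: One_fract_def one_poly_eq_simps)
next
  case (Suc n)
  then show ?case by (simp add: q_var_def Polynomial.monom_Suc)
qed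

lemma q_var_nonzero [simp]: "q_var \<noteq> 0"
  by (simp add: q_var_def Zero_fract_def eq_fract)

lemma qq_0 [simp]: "qq 0 = 1"
  and qq_nonzero [simp]: "qq n \<noteq> 0"
  and qq_add: "qq (m + n) = qq m * qq n"
  by (simp_all add: qq_def power_int_add)

lemma qq_minus: "qq (- n) = inverse (qq n)"
  by (simp add: qq_def power_int_minus)

lemma qq_power: "qq m ^ n = qq (m * int n)"
  by (simp add: qq_def power_int_power')

lemma qq_powi: "qq m powi n = qq (m * n)"
  by (simp add: qq_def power_int_mult)

lemma qq_eq_1_iff [simp]: "qq n = 1 \<longleftrightarrow> n = 0"
proof -
  have pos: "q_var ^ k \<noteq> 1" if "k > 0" for k
    using that by (auto simp: q_var_power One_fract_def eq_fract monom_eq_1_iff)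
  consider "n = 0" | k where "k > 0" "n = int k" | k where "k > 0" "n = - int k"
    by (metis int_cases2 linorder_not_less nat_less_le of_nat_0 neg_0_equal_iff_equal gr0I)
  then show ?thesis
    by cases (auto simp: qq_def power_int_minus dest: pos)
qed

lemma q_sub_qq: "q_sub D i = qq (symm D i)"
  by (simp add: q_sub_def qq_def)

lemma q_sub_powi: "q_sub D i powi n = qq (symm D i * n)"
  by (simp add: q_sub_qq qq_powi)

lemma qint_0 [simp]: "qint D i 0 = 0"
  by (simp add: qint_def)

lemma qint_nonzero:
  assumes "symm D i > 0" "n > 0" shows "qint D i n \<noteq> 0"
proof -
  have *: "qq m - inverse (qq m) \<noteq> 0" if "m \<noteq> 0" for m
  proof
    assume "qq m - inverse (qq m) = 0"
    then have "qq m * qq m = 1" by (simp add: field_simps)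
    then show False using that by (simp add: qq_add[symmetric])
  qed
  show ?thesis
    using *[of "symm D i"] *[of "symm D i * int n"] assms
    unfolding qint_def q_sub_powi unfolding q_sub_qq mult_minus_right qq_minus by simp
qed

lemma qint_pascal:
  assumes "k \<le> Suc N"
  shows "qint D i (Suc N) * qq (symm D i * int k)
    = qint D i (Suc N - k) + qq (symm D i * int (Suc N)) * qint D i k"
proof -
  let ?s = "symm D i"
  have *: "(qq m - qq (- m)) * qq n = (qq (m - n) - qq (- (m - n))) + qq m * (qq n - qq (- n))" for m n
    by (simp only: left_diff_distrib right_diff_distrib qq_add[symmetric]) (simp add: add.commute)
  have "(qq (?s * int (Suc N)) - qq (- (?s * int (Suc N)))) * qq (?s * int k)
    = (qq (?s * int (Suc N - k)) - qq (- (?s * int (Suc N - k))))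
      + qq (?s * int (Suc N)) * (qq (?s * int k) - qq (- (?s * int k)))"
    using *[of "?s * int (Suc N)" "?s * int k"] assms by (simp only: of_nat_diff right_diff_distrib)
  then show ?thesis
    by (simp only: qint_def q_sub_powi mult_minus_right times_divide_eq_left times_divide_eq_right
        add_divide_distrib[symmetric])
qed

lemma qfact_Suc: "qfact D i (Suc n) = qint D i (Suc n) * qfact D i n"
  by (simp add: qfact_def)

lemma qfact_nonzero: "symm D i > 0 \<Longrightarrow> qfact D i n \<noteq> 0"
  by (auto simp: qfact_def qint_nonzero)

lemma qfact_pos: "n > 0 \<Longrightarrow> qfact D i n = qint D i n * qfact D i (n - 1)"
  by (cases n) (auto simp: qfact_Suc)

lemma qbinom_0 [simp]: "symm D i > 0 \<Longrightarrow> qbinom D i n 0 = 1"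
  and qbinom_self [simp]: "symm D i > 0 \<Longrightarrow> qbinom D i n n = 1"
  by (auto simp: qbinom_def qfact_nonzero) (auto simp: qfact_def)

lemma qbinom_pascal:
  assumes "symm D i > 0" "0 < k" "k \<le> N"
  shows "qbinom D i (Suc N) k * qq (symm D i * int k)
    = qbinom D i N k + qq (symm D i * int (Suc N)) * qbinom D i N (k - 1)"
proof -
  note nz = qfact_nonzero[OF assms(1)] qint_nonzero[OF assms(1)]
  have 1: "qfact D i (Suc N - k) = qint D i (Suc N - k) * qfact D i (N - k)"
    using assms qfact_Suc[of D i "N - k"] by (simp add: Suc_diff_le)
  have 2: "qfact D i k = qint D i k * qfact D i (k - 1)"
    using assms by (simp add: qfact_pos)
  have 3: "N - (k - 1) = Suc N - k" using assms by simp
  have nz': "qint D i (Suc N - k) \<noteq> 0" "qint D i k \<noteq> 0" "qint D i (Suc N) \<noteq> 0"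
    using assms nz by auto
  have "qbinom D i (Suc N) k * qq (symm D i * int k)
    = (qint D i (Suc N) * qq (symm D i * int k)) * (qfact D i N / (qfact D i k * qfact D i (Suc N - k)))"
    by (simp add: qbinom_def qfact_Suc)
  also have "\<dots> = (qint D i (Suc N - k) + qq (symm D i * int (Suc N)) * qint D i k)
      * (qfact D i N / (qfact D i k * qfact D i (Suc N - k)))"
    using assms by (subst qint_pascal) auto
  also have "\<dots> = qbinom D i N k + qq (symm D i * int (Suc N)) * qbinom D i N (k - 1)"
    unfolding qbinom_def 3 1 2 using nz nz'(1,2) by (simp add: field_simps)
  finally show ?thesis .
qed

lemma qbinom_step:
  assumes "symm D i > 0" "k < N"
  shows "qbinom D i N k * qint D i (N - k) = qbinom D i N (Suc k) * qint D i (Suc k)"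
proof -
  note nz = qfact_nonzero[OF assms(1)] qint_nonzero[OF assms(1)]
  have 1: "qfact D i (N - k) = qint D i (N - k) * qfact D i (N - Suc k)"
    using assms by (simp add: qfact_pos)
  have "qint D i (N - k) \<noteq> 0" "qint D i (Suc k) \<noteq> 0"
    using assms nz by auto
  then show ?thesis
    unfolding qbinom_def qfact_Suc 1 using nz by (simp add: field_simps)
qed

text \<open>\<open>serre_sum D i N d x y = \<Sum>\<^sub>k (-1)\<^sup>k [N, k]\<^sub>i q\<^sub>i\<^bsup>d k\<^esup> x\<^bsup>N-k\<^esup> y x\<^sup>k\<close>: the quantum Serre expression for
  \<open>d = 0\<close>. In the commuting operators \<open>X\<close>, \<open>Y\<close> of left and right multiplication by \<open>x\<close> it is the
  product of the \<open>X - q\<^sub>i\<^sup>c Y\<close> with \<open>c\<close> running through \<open>d+N-1, d+N-3, \<dots>, d-N+1\<close>.\<close>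

definition serre_sum ::
    "('i, 'p) bc_datum \<Rightarrow> 'i \<Rightarrow> nat \<Rightarrow> int \<Rightarrow> ('g free_mon \<Rightarrow>\<^sub>0 qfield) \<Rightarrow> ('g free_mon \<Rightarrow>\<^sub>0 qfield)
      \<Rightarrow> ('g free_mon \<Rightarrow>\<^sub>0 qfield)" where
  "serre_sum D i N d x y =
    (\<Sum>k\<le>N. ((-1) ^ k * qbinom D i N k * qq (symm D i * d * int k)) *\<^sub>s (x ^ (N - k) * y * x ^ k))"

text \<open>The step from \<open>(N, d)\<close> to \<open>(N+1, d+1)\<close> adds the linear factor for \<open>c = d+N+1\<close>; this is the \<open>q\<close>-Pascal rule.\<close>

lemma serre_sum_Suc:
  assumes "symm D i > 0"
  shows "serre_sum D i (Suc N) (d + 1) x y = x * serre_sum D i N d x y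
    - qq (symm D i * (d + int N + 1)) *\<^sub>s (serre_sum D i N d x y * x)"
proof -
  let ?s = "symm D i"
  define t where "t k = x ^ (Suc N - k) * y * x ^ k" for k
  define b where "b k = (if k \<le> N then (-1) ^ k * qbinom D i N k * qq (?s * d * int k) else 0)" for k
  define b' where "b' k = (if k = 0 then 0 else (-1) ^ (k - 1) * qbinom D i N (k - 1) * qq (?s * d * int (k - 1)))" for k
  have A: "x * serre_sum D i N d x y = (\<Sum>k\<le>Suc N. b k *\<^sub>s t k)"
    by (simp add: serre_sum_def sum_distrib_left b_def t_def Suc_diff_le mult.assoc[symmetric]
        power_commutes cong: sum.cong)
       (auto intro!: sum.cong simp: Suc_diff_le mult.assoc)
  have B: "serre_sum D i N d x y * x = (\<Sum>k\<le>Suc N. b' k *\<^sub>s t k)"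
    by (subst sum.atMost_Suc_shift)
       (simp add: serre_sum_def sum_distrib_right b'_def t_def mult.assoc power_commutes)
  have "(-1) ^ k * qbinom D i (Suc N) k * qq (?s * (d + 1) * int k)
      = b k - qq (?s * (d + int N + 1)) * b' k" if k: "k \<le> Suc N" for k
  proof -
    consider "k = 0" | "0 < k" "k \<le> N" | "k = Suc N" "k > 0"
      using k by (cases "k = 0"; cases "k \<le> N") (auto simp: le_Suc_eq)
    then show ?thesis
    proof cases
      case 1
      then show ?thesis using assms by (simp add: b_def b'_def)
    next
      case 2
      have e1: "qq (?s * (d + 1) * int k) = qq (?s * int k) * qq (?s * d * int k)"
        by (simp add: qq_add[symmetric] algebra_simps)
      have e2: "qq (?s * (d + int N + 1)) * qq (?s * d * int (k - 1))
          = qq (?s * int (Suc N)) * qq (?s * d * int k)"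
        using 2 by (simp add: qq_add[symmetric] algebra_simps of_nat_diff)
      have e3: "(-1) ^ k = - ((-1) ^ (k - 1) :: qfield)"
        using 2 by (cases k) auto
      have "(-1) ^ k * qbinom D i (Suc N) k * qq (?s * (d + 1) * int k)
        = (-1) ^ k * (qbinom D i (Suc N) k * qq (?s * int k)) * qq (?s * d * int k)"
        by (simp add: e1)
      also have "\<dots> = (-1) ^ k * qbinom D i N k * qq (?s * d * int k)
          + (-1) ^ k * qbinom D i N (k - 1) * (qq (?s * int (Suc N)) * qq (?s * d * int k))"
        by (simp only: qbinom_pascal[OF assms 2]) (simp only: algebra_simps)
      also have "\<dots> = b k - qq (?s * (d + int N + 1)) * b' k"
        using 2 by (simp only: e2[symmetric]) (simp add: b_def b'_def e3)
      finally show ?thesis .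
    next
      case 3
      have "qq (?s * (d + int N + 1)) * qq (?s * d * int N) = qq (?s * (d + 1) * int (Suc N))"
        by (simp add: qq_add[symmetric] algebra_simps)
      then show ?thesis using 3 assms by (simp add: b_def b'_def)
    qed
  qed
  then have "serre_sum D i (Suc N) (d + 1) x y
      = (\<Sum>k\<le>Suc N. (b k - qq (?s * (d + int N + 1)) * b' k) *\<^sub>s t k)"
    unfolding serre_sum_def t_def by (intro sum.cong) auto
  then show ?thesis
    unfolding A B by (simp only: pm.scale_left_diff_distrib sum_subtractf pm.scale_sum_right pm.scale_scale)
qed

text \<open>Hence the expression for \<open>(N+d, d)\<close> is a multiple of the Serre expression for \<open>N\<close>.\<close>

lemma serre_sum_shift_in_ideal:
  assumes "symm D i > 0" "x \<in> word_span G" "serre_sum D i N 0 x y \<in> ideal_span G G S"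
  shows "serre_sum D i (N + d) (int d) x y \<in> ideal_span G G S"
proof (induction d)
  case 0
  then show ?case using assms by simp
next
  case (Suc d)
  have "serre_sum D i (Suc (N + d)) (int d + 1) x y \<in> ideal_span G G S"
    unfolding serre_sum_Suc[OF assms(1)]
    using Suc assms by (intro ideal_span_closed ideal_span_mult_left ideal_span_mult_right)
  then show ?case by (simp add: add.commute)
qed

section \<open>Skew derivations of the free algebra\<close>

text \<open>Of the parameters \<open>\<tau>\<close> only the normalization \<open>\<tau>\<^sub>i\<^sub>0 = 1\<close> matters.\<close>

locale bozec_datum = borcherds_cartan_datum D for D :: "('i, 'p::ab_group_add) bc_datum" +
  fixes \<tau> :: "'i \<Rightarrow> nat \<Rightarrow> qfield"
  assumes tau_0: "i \<in> index_set D \<Longrightarrow> \<tau> i 0 = 1"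
begin

lemma I_infty_index: "(i, l) \<in> I_infty D \<Longrightarrow> i \<in> index_set D"
  and I_infty_pos: "(i, l) \<in> I_infty D \<Longrightarrow> l > 0"
  by (auto simp: I_infty_def real_indices_def imaginary_indices_def)

lemma I_infty_mono: "(i, l) \<in> I_infty D \<Longrightarrow> 0 < l' \<Longrightarrow> l' \<le> l \<Longrightarrow> (i, l') \<in> I_infty D"
  by (auto simp: I_infty_def)

lemma real_I_infty: "i \<in> real_indices D \<Longrightarrow> (i, l) \<in> I_infty D \<longleftrightarrow> l = 1"
  by (auto simp: I_infty_def real_indices_def imaginary_indices_def)

lemma real_index: "i \<in> real_indices D \<Longrightarrow> i \<in> index_set D"
  by (simp add: real_indices_def)

text \<open>The weight of a word, evaluated at a coweight.\<close>

definition wt :: "('p \<Rightarrow> int) \<Rightarrow> ('i \<times> nat) list \<Rightarrow> int" where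
  "wt h u = (\<Sum>(i, l)\<leftarrow>u. int l * h (simple_root D i))"

lemma wt_simps [simp]:
  "wt h [] = 0"
  "wt h ((i, l) # u) = int l * h (simple_root D i) + wt h u"
  "wt h (u @ v) = wt h u + wt h v"
  by (simp_all add: wt_def)

lemma wt_scale: "wt (\<lambda>x. c * h x) u = c * wt h u"
  by (induction u) (auto simp: algebra_simps)

lemma wt_plus: "wt (\<lambda>x. h x + h' x) u = wt h u + wt h' u"
  by (induction u) (auto simp: algebra_simps)

text \<open>\<open>K\<^sub>i = q\<^bsup>\<kappa> i\<^esup>\<close> and \<open>q\<^sub>(\<^sub>i\<^sub>) = q\<^bsup>dd i\<^esup>\<close>.\<close>

definition \<kappa> :: "'i \<Rightarrow> 'p \<Rightarrow> int" where
  "\<kappa> i = (\<lambda>x. symm D i * simple_coroot D i x)"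

definition dd :: "'i \<Rightarrow> int" where
  "dd i = symm D i * (cartan D i i div 2)"

lemma q_paren_powi: "q_paren D i powi n = qq (dd i * n)"
  by (simp add: q_paren_def q_sub_powi qq_powi dd_def)

lemma \<kappa>_root: "\<lbrakk>i \<in> index_set D; j \<in> index_set D\<rbrakk> \<Longrightarrow> \<kappa> i (simple_root D j) = symm D i * cartan D i j"
  by (simp add: \<kappa>_def pairing)

lemma \<kappa>_sym: "\<lbrakk>i \<in> index_set D; j \<in> index_set D\<rbrakk> \<Longrightarrow> \<kappa> i (simple_root D j) = \<kappa> j (simple_root D i)"
  by (simp add: \<kappa>_root symmetrizable)

lemma \<kappa>_self: "i \<in> index_set D \<Longrightarrow> \<kappa> i (simple_root D i) = 2 * dd i"
  using diagonal by (auto simp: \<kappa>_root dd_def)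

type_synonym (in -) 'a free_alg = "('a \<times> nat) free_mon \<Rightarrow>\<^sub>0 qfield"

text \<open>The letter with index \<open>(i, l)\<close>, where \<open>l = 0\<close> stands for the unit as in the convention \<open>e\<^sub>i\<^sub>0 = f\<^sub>i\<^sub>0 = 1\<close>.\<close>

definition gen :: "'i \<Rightarrow> nat \<Rightarrow> 'i free_alg" where
  "gen i l = (if l = 0 then 1 else mon [(i, l)])"

lemma gen_0 [simp]: "gen i 0 = 1" by (simp add: gen_def)

text \<open>The automorphism of the free algebra that multiplies a word of weight \<open>\<alpha>\<close> by \<open>q\<close> to the power \<open>h(\<alpha>)\<close>; it is conjugation
  with \<open>q\<^sup>h\<close>.\<close>

definition twist :: "('p \<Rightarrow> int) \<Rightarrow> 'i free_alg \<Rightarrow> 'i free_alg" where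
  "twist h = lin_ext (\<lambda>w. qq (wt h (letters w)) *\<^sub>s mon (letters w))"

lemma twist_mon [simp]: "twist h (mon u) = qq (wt h u) *\<^sub>s mon u"
  by (simp add: twist_def)

lemma plinear_twist [simp, intro]: "plinear (twist h)"
  and plinear_twist' [simp, intro]: "plinear f \<Longrightarrow> plinear (\<lambda>x. twist h (f x))"
  by (auto simp: twist_def)

lemmas twist_simps [simp] = plinear_simps[OF plinear_twist]

lemma twist_one [simp]: "twist h 1 = 1"
  using twist_mon[of h "[]"] by (simp del: twist_mon)

lemma twist_mult [simp]: "twist h (x * y) = twist h x * twist h y"
  by (rule free_bilinear_eqI) (auto simp: mon_append[symmetric] qq_add mult.commute)

lemma twist_power [simp]: "twist h (x ^ n) = twist h x ^ n"
  by (induction n) auto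

lemma twist_gen [simp]: "twist h (gen i l) = qq (int l * h (simple_root D i)) *\<^sub>s gen i l"
  by (simp add: gen_def)

lemma power_pscale: "(c *\<^sub>s x) ^ n = c ^ n *\<^sub>s (x ^ n :: 'g free_mon \<Rightarrow>\<^sub>0 'k::comm_ring_1)"
  by (induction n) (auto simp: mult.commute)

lemma twist_0: "(\<And>x. h x = 0) \<Longrightarrow> twist h y = y"
proof (rule plinear_eq_on[of "twist h" "\<lambda>y. y"])
  assume h: "\<And>x. h x = 0"
  have "wt h u = 0" for u by (induction u) (auto simp: h)
  then show "twist h (Poly_Mapping.single k 1) = Poly_Mapping.single k 1" for k
    by (simp add: single_free_mon)
qed auto

text \<open>\<open>skew j n\<close> is the part of degree \<open>n\<close> of the higher skew derivation that describes how the \<open>f\<^sub>j\<^sub>k\<close> move across words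
  in the \<open>e\<^sub>i\<^sub>l\<close>. It sends \<open>e\<^sub>j\<^sub>l\<close> to \<open>\<tau>\<^sub>j\<^sub>n q\<^sub>(\<^sub>j\<^sub>)\<^bsup>-n(l-n)\<^esup> e\<^bsub>j,l-n\<^esub>\<close> if \<open>l \<ge> n\<close>; in degree
  \<open>n > 0\<close> it annihilates the other generators. It is
  extended to words by a product rule whose twist comes from moving \<open>K\<^sub>j\<^sup>-\<^sup>a\<close> across the rest of the word.\<close>

definition skew_gen :: "'i \<Rightarrow> nat \<Rightarrow> 'i \<times> nat \<Rightarrow> 'i free_alg" where
  "skew_gen j a g = (case g of (i, l) \<Rightarrow>
     if a = 0 then mon [(i, l)]
     else if i = j \<and> a \<le> l then (\<tau> j a * qq (- dd j * int a * (int l - int a))) *\<^sub>s gen j (l - a)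
     else 0)"

fun skew_word :: "'i \<Rightarrow> nat \<Rightarrow> ('i \<times> nat) list \<Rightarrow> 'i free_alg" where
  "skew_word j n [] = (if n = 0 then 1 else 0)"
| "skew_word j n (g # w) = (\<Sum>a\<le>n. qq (dd j * int a * (int n - int a) - int a * wt (\<kappa> j) w)
      *\<^sub>s (skew_gen j a g * skew_word j (n - a) w))"

definition skew :: "'i \<Rightarrow> nat \<Rightarrow> 'i free_alg \<Rightarrow> 'i free_alg" where
  "skew j n = lin_ext (\<lambda>w. skew_word j n (letters w))"

lemma skew_mon [simp]: "skew j n (mon u) = skew_word j n u"
  by (simp add: skew_def)

lemma plinear_skew [simp, intro]: "plinear (skew j n)"
  and plinear_skew' [simp, intro]: "plinear f \<Longrightarrow> plinear (\<lambda>x. skew j n (f x))"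
  by (auto simp: skew_def)

lemmas skew_simps [simp] = plinear_simps[OF plinear_skew]

lemma skew_word_append:
  "skew_word j n (u @ v) = (\<Sum>a\<le>n. qq (dd j * int a * (int n - int a) - int a * wt (\<kappa> j) v)
      *\<^sub>s (skew_word j a u * skew_word j (n - a) v))"
proof (induction u arbitrary: n)
  case Nil
  have "(\<Sum>a\<le>n. qq (dd j * int a * (int n - int a) - int a * wt (\<kappa> j) v)
      *\<^sub>s (skew_word j a [] * skew_word j (n - a) v))
    = (\<Sum>a\<le>n. if a = 0 then skew_word j n v else 0)"
    by (intro sum.cong) auto
  then show ?case by simp
next
  case (Cons g u)
  let ?w = "wt (\<kappa> j)"
  define f where "f a b c = qq (dd j * (int a * int b + int a * int c + int b * int c)
      - int a * ?w u - (int a + int b) * ?w v)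
      *\<^sub>s (skew_gen j a g * skew_word j b u * skew_word j c v)" for a b c
  have "skew_word j n ((g # u) @ v) = (\<Sum>a\<le>n. \<Sum>b\<le>n - a. f a b (n - a - b))"
    unfolding f_def append_Cons skew_word.simps
    by (intro sum.cong refl, simp add: Cons.IH sum_distrib_left pm.scale_sum_right,
        intro sum.cong refl) 
       (simp add: qq_add[symmetric] of_nat_diff algebra_simps mult.assoc)
  also have "\<dots> = (\<Sum>m\<le>n. \<Sum>a\<le>m. f a (m - a) (n - m))"
    using fps_mult_assoc_lemma[of f n n] by (simp add: atLeast0AtMost)
  also have "\<dots> = (\<Sum>m\<le>n. qq (dd j * int m * (int n - int m) - int m * ?w v)
      *\<^sub>s (skew_word j m (g # u) * skew_word j (n - m) v))"
    unfolding f_def skew_word.simps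
    by (intro sum.cong refl, simp add: sum_distrib_right pm.scale_sum_right,
        intro sum.cong refl) 
       (simp add: qq_add[symmetric] of_nat_diff algebra_simps mult.assoc)
  finally show ?case .
qed

text \<open>The twisted product rule.\<close>

lemma skew_mult:
  "skew j n (x * y) = (\<Sum>a\<le>n. qq (dd j * int a * (int n - int a))
      *\<^sub>s (skew j a x * skew j (n - a) (twist (\<lambda>z. - int a * \<kappa> j z) y)))"
proof (rule free_bilinear_eqI[where x = x and y = y and f = "\<lambda>x y. skew j n (x * y)"
      and g = "\<lambda>x y. \<Sum>a\<le>n. qq (dd j * int a * (int n - int a))
        *\<^sub>s (skew j a x * skew j (n - a) (twist (\<lambda>z. - int a * \<kappa> j z) y))"])
  fix u v :: "('i \<times> nat) list"
  show "skew j n (mon u * mon v) = (\<Sum>a\<le>n. qq (dd j * int a * (int n - int a))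
      *\<^sub>s (skew j a (mon u) * skew j (n - a) (twist (\<lambda>z. - int a * \<kappa> j z) (mon v))))"
    by (simp only: mon_append[symmetric] skew_mon skew_word_append twist_mon skew_simps wt_scale
        mult_pscale_right pm.scale_scale qq_add[symmetric])
       (simp add: algebra_simps)
qed (intro plinear_intros plinear_mult plinear_skew plinear_skew' plinear_twist')+

lemma skew_word_0 [simp]: "skew_word j 0 u = mon u"
  by (induction u) (auto simp: skew_gen_def mon_Cons[of _ "_ # _"] mon_append[symmetric] split: prod.splits)

lemma skew_0 [simp]: "skew j 0 x = x"
  by (rule plinear_eq_on[of "skew j 0" "\<lambda>x. x"]) (auto simp: single_free_mon)

lemma skew_one: "skew j n 1 = (if n = 0 then 1 else 0)"
  using skew_mon[of j n "[]"] by (simp del: skew_mon)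

lemma skew_gen_eq:
  assumes "n > 0"
  shows "skew j n (gen i l) = (if i = j \<and> n \<le> l
    then (\<tau> j n * qq (- dd j * int n * (int l - int n))) *\<^sub>s gen j (l - n) else 0)"
proof (cases "l = 0")
  case False
  have "skew_word j n [(i, l)] = (\<Sum>a\<le>n. if a = n then skew_gen j n (i, l) else 0)"
    unfolding skew_word.simps by (intro sum.cong) auto
  then show ?thesis using False assms by (simp add: gen_def skew_gen_def)
qed (use assms in \<open>auto simp: skew_one\<close>)

text \<open>The defining relations of one half. The order \<open>N = 1 - l a\<^sub>i\<^sub>j\<close> of the Serre relation is positive.\<close>

definition serre_relators :: "'i free_alg set" where
  "serre_relators =
    {serre_sum D i (nat (1 - int l * cartan D i j)) 0 (gen i 1) (gen j l) |i j l.
       i \<in> real_indices D \<and> (j, l) \<in> I_infty D \<and> (j, l) \<noteq> (i, 1)}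
    \<union> {gen i k * gen j l - gen j l * gen i k |i k j l.
       (i, k) \<in> I_infty D \<and> (j, l) \<in> I_infty D \<and> cartan D i j = 0}"

text \<open>The ideal \<open>J\<close> of the free algebra whose quotient is the positive (and negative) half.\<close>

definition J :: "'i free_alg set" where
  "J = ideal_span (I_infty D) (I_infty D) serre_relators"

lemmas J_mult = ideal_span_mult_left[where S = serre_relators and G = "I_infty D" and H = "I_infty D", folded J_def]
  ideal_span_mult_right[where S = serre_relators and G = "I_infty D" and H = "I_infty D", folded J_def]

lemmas J_closed [simp, intro] = 
  ideal_span_closed[where S = serre_relators and G = "I_infty D" and H = "I_infty D", folded J_def]

lemma gen_word_span [simp, intro]: "l = 0 \<or> (i, l) \<in> I_infty D \<Longrightarrow> gen i l \<in> word_span (I_infty D)"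
  by (auto simp: gen_def)

lemma skew_word_span:
  assumes "x \<in> word_span (I_infty D)"
  shows "skew j n x \<in> word_span (I_infty D)"
proof (rule plinear_word_span[OF _ _ _ assms])
  have *: "skew_gen j a g \<in> word_span (I_infty D)" if "g \<in> I_infty D" for a g
    using that by (auto simp: skew_gen_def gen_def split: prod.splits intro!: mon_in_word_span
        word_span_closed intro: I_infty_mono)
  have "skew_word j n u \<in> word_span (I_infty D)" if "set u \<subseteq> I_infty D" for u
    using that by (induction u arbitrary: n) (auto intro!: word_span_closed word_span_mult *)
  then show "skew j n (mon u) \<in> word_span (I_infty D)" if "set u \<subseteq> I_infty D" for u
    using that by simp
qed auto

lemma skew_1_mult: "skew j 1 (x * y) = x * skew j 1 y + skew j 1 x * twist (\<lambda>z. - \<kappa> j z) y"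
  by (simp add: skew_mult twist_0)

text \<open>A factor that all \<open>skew j a\<close> with \<open>a > 0\<close> annihilate can be pulled out.\<close>

lemma skew_mult_inert_left:
  assumes "\<And>a. a > 0 \<Longrightarrow> skew j a z = 0"
  shows "skew j n (z * y) = z * skew j n y"
proof -
  have "skew j n (z * y) = (\<Sum>a\<le>n. if a = 0 then z * skew j n y else 0)"
    unfolding skew_mult by (intro sum.cong) (auto simp: assms twist_0)
  then show ?thesis by simp
qed

lemma skew_mult_inert_right:
  assumes "\<And>a. a > 0 \<Longrightarrow> skew j a z = 0" "twist (\<lambda>x. - int n * \<kappa> j x) z = c *\<^sub>s z"
    and "\<And>h. \<exists>c. twist h z = c *\<^sub>s z"
  shows "skew j n (y * z) = c *\<^sub>s (skew j n y * z)"
proof -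
  have *: "skew j (n - a) (twist h z) = 0" if "a < n" for a h
    using assms(3)[of h] assms(1)[of "n - a"] that by auto
  have "skew j n (y * z) = (\<Sum>a\<le>n. if a = n then c *\<^sub>s (skew j n y * z) else 0)"
    unfolding skew_mult by (intro sum.cong) (use assms(2) in \<open>auto simp: *\<close>)
  then show ?thesis by simp
qed

lemma skew_power_inert: "i \<noteq> j \<Longrightarrow> a > 0 \<Longrightarrow> skew j a (gen i l ^ p) = 0"
proof (induction p)
  case (Suc p)
  then show ?case
    by (simp add: skew_mult_inert_left skew_gen_eq)
qed (simp add: skew_one)

lemma serre_sum_scale: "serre_sum D i N d x (c *\<^sub>s y) = c *\<^sub>s serre_sum D i N d x y"
  by (simp add: serre_sum_def pm.scale_sum_right mult.commute)

text \<open>For \<open>j \<noteq> i\<close> the derivation acts on the middle factor only, and the twist produces the parameter \<open>d = -n a\<^sub>i\<^sub>j\<close>.\<close>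

lemma skew_serre_sum_off:
  assumes "i \<in> index_set D" "j \<in> index_set D" "i \<noteq> j"
  shows "skew j n (serre_sum D i N 0 (gen i 1) y)
    = serre_sum D i N (- int n * cartan D i j) (gen i 1) (skew j n y)"
proof -
  have "skew j n (gen i 1 ^ (N - k) * y * gen i 1 ^ k)
    = qq (symm D i * (- int n * cartan D i j) * int k) *\<^sub>s (gen i 1 ^ (N - k) * skew j n y * gen i 1 ^ k)"
    for k
  proof -
    have "twist (\<lambda>x. - int n * \<kappa> j x) (gen i 1 ^ k)
      = qq (symm D i * (- int n * cartan D i j) * int k) *\<^sub>s gen i 1 ^ k"
      using assms \<kappa>_sym[of j i] by (simp add: power_pscale qq_power \<kappa>_root algebra_simps)
    moreover have "\<exists>c. twist h (gen i 1 ^ k) = c *\<^sub>s gen i 1 ^ k" for h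
      by (simp add: power_pscale) blast
    ultimately have "skew j n (gen i 1 ^ (N - k) * y * gen i 1 ^ k)
      = qq (symm D i * (- int n * cartan D i j) * int k)
        *\<^sub>s (skew j n (gen i 1 ^ (N - k) * y) * gen i 1 ^ k)"
      using assms by (intro skew_mult_inert_right skew_power_inert) auto
    then show ?thesis
      using assms by (simp add: skew_mult_inert_left skew_power_inert)
  qed
  then show ?thesis
    by (simp add: serre_sum_def)
qed

lemma serre_sum_1:
  assumes "i \<in> index_set D" shows "serre_sum D i 1 0 x 1 = 0"
  using assms symm_pos by (simp add: serre_sum_def)

lemma serre_sum_in_J:
  assumes "i \<in> real_indices D" "j \<in> index_set D" "i \<noteq> j" "l = 0 \<or> (j, l) \<in> I_infty D"
  shows "serre_sum D i (nat (1 - int l * cartan D i j)) 0 (gen i 1) (gen j l) \<in> J"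
proof (cases "l = 0")
  case True
  then show ?thesis using assms serre_sum_1[of i "gen i 1"] by (simp add: real_index)
next
  case False
  then show ?thesis
    using assms unfolding J_def serre_relators_def by (intro ideal_span_base) blast
qed

lemma qint_Suc: "symm D i > 0 \<Longrightarrow>
  qint D i (Suc p) = qq (symm D i) * qint D i p + qq (- (symm D i * int p))"
proof -
  assume s: "symm D i > 0"
  let ?s = "symm D i"
  have nz: "qq ?s - qq (- ?s) \<noteq> 0"
    using qint_nonzero[of D i 1] s unfolding qint_def q_sub_powi by auto
  have "qq (?s * int (Suc p)) - qq (- (?s * int (Suc p)))
    = qq ?s * (qq (?s * int p) - qq (- (?s * int p))) + qq (- (?s * int p)) * (qq ?s - qq (- ?s))"
    by (simp only: right_diff_distrib qq_add[symmetric]) (simp add: algebra_simps)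
  then show ?thesis
    using nz unfolding qint_def q_sub_powi unfolding q_sub_qq mult_minus_right qq_minus[symmetric]
    by (simp add: add_divide_distrib)
qed

lemma skew_1_power:
  assumes "i \<in> real_indices D"
  shows "skew i 1 (gen i 1 ^ p)
    = (\<tau> i 1 * qq (- (symm D i * (int p - 1))) * qint D i p) *\<^sub>s gen i 1 ^ (p - 1)"
proof (induction p)
  case 0
  then show ?case by (simp add: skew_one)
next
  case (Suc p)
  let ?s = "symm D i"
  have i: "i \<in> index_set D" "?s > 0" "cartan D i i = 2"
    using assms symm_pos by (auto simp: real_indices_def)
  have tw: "twist (\<lambda>z. - \<kappa> i z) (gen i 1 ^ p) = qq (- (2 * ?s * int p)) *\<^sub>s gen i 1 ^ p"
    using i by (simp add: power_pscale qq_power \<kappa>_root algebra_simps)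
  have 1: "skew i 1 (gen i 1) = \<tau> i 1 *\<^sub>s 1"
    by (simp add: skew_gen_eq)
  have 2: "gen i 1 * (c * qint D i p) *\<^sub>s gen i 1 ^ (p - 1) = (c * qint D i p) *\<^sub>s gen i 1 ^ p" for c
    by (cases p) auto
  have 3: "qq (- (?s * (int p - 1))) * qint D i p + qq (- (2 * ?s * int p))
      = qq (- (?s * int p)) * qint D i (Suc p)"
    unfolding qint_Suc[OF i(2)] distrib_left mult.assoc[symmetric] qq_add[symmetric]
    by (simp add: algebra_simps)
  have "skew i 1 (gen i 1 ^ Suc p)
    = (\<tau> i 1 * (qq (- (?s * (int p - 1))) * qint D i p + qq (- (2 * ?s * int p)))) *\<^sub>s gen i 1 ^ p"
    unfolding power_Suc skew_1_mult Suc.IH tw 1 2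
    by (simp add: pm.scale_left_distrib distrib_left mult_ac)
  then show ?case
    unfolding 3 by (simp add: mult.assoc)
qed

text \<open>For \<open>j = i\<close> the two terms that yield \<open>x\<^sup>M\<^sup>-\<^sup>k y x\<^sup>k\<close> cancel.\<close>

lemma skew_serre_sum_diag:
  assumes i: "i \<in> real_indices D" and j: "j \<in> index_set D" "i \<noteq> j"
  shows "skew i 1 (serre_sum D i (nat (1 - int l * cartan D i j)) 0 (gen i 1) (gen j l)) = 0"
proof -
  let ?s = "symm D i" and ?X = "gen i 1" and ?Y = "gen j l"
  have s: "?s > 0" and idx: "i \<in> index_set D" and aii: "cartan D i i = 2"
    using i symm_pos by (auto simp: real_indices_def)
  define M where "M = nat (- (int l * cartan D i j))"
  have a: "cartan D i j \<le> 0"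
    using off_diagonal idx j by auto
  have M: "int l * cartan D i j = - int M"
    using a by (simp add: M_def mult_nonneg_nonpos)
  have N: "nat (1 - int l * cartan D i j) = Suc M"
    by (simp add: M)
  define T where "T k = (\<tau> i 1 * qq (- (?s * int k))) *\<^sub>s (?X ^ (M - k) * ?Y * ?X ^ k)" for k
  let ?b = "\<lambda>k. (-1) ^ k * qbinom D i (Suc M) k"
  have Y: "skew i a ?Y = 0" if "a > 0" for a
    using j that by (simp add: skew_gen_eq)
  have twY: "twist (\<lambda>z. - \<kappa> i z) ?Y = qq (?s * int M) *\<^sub>s ?Y"
    using M idx j by (simp add: \<kappa>_root mult.left_commute[of "int l"])
  have tw: "twist (\<lambda>z. - \<kappa> i z) (?X ^ k) = qq (- (2 * ?s * int k)) *\<^sub>s ?X ^ k" for k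
    using idx aii by (simp add: power_pscale qq_power \<kappa>_root algebra_simps)
  have summand: "skew i 1 (?X ^ (Suc M - k) * ?Y * ?X ^ k)
      = (if k = 0 then 0 else qint D i k *\<^sub>s T (k - 1))
        + (if k = Suc M then 0 else qint D i (Suc M - k) *\<^sub>s T k)" if k: "k \<le> Suc M" for k
  proof -
    have A: "?X ^ (Suc M - k) * ?Y * skew i 1 (?X ^ k) = (if k = 0 then 0 else qint D i k *\<^sub>s T (k - 1))"
      unfolding skew_1_power[OF i] T_def using k by (cases k) (auto simp: mult.commute)
    have B: "skew i 1 (?X ^ (Suc M - k)) * twist (\<lambda>z. - \<kappa> i z) ?Y * twist (\<lambda>z. - \<kappa> i z) (?X ^ k)
      = (if k = Suc M then 0 else qint D i (Suc M - k) *\<^sub>s T k)"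
    proof (cases "k = Suc M")
      case False
      then have "int (Suc M - k) - 1 = int M - int k" "Suc M - k - 1 = M - k"
        using k by auto
      moreover have "qq (- (?s * (int M - int k))) * qq (?s * int M) * qq (- (2 * ?s * int k))
        = qq (- (?s * int k))"
        by (simp add: qq_add[symmetric] algebra_simps)
      ultimately show ?thesis
        unfolding skew_1_power[OF i] twY tw T_def using False
        by (simp add: mult_ac)
    qed (simp add: skew_one)
    show ?thesis
      unfolding skew_1_mult[of i "?X ^ (Suc M - k) * ?Y"] skew_1_mult[of i "?X ^ (Suc M - k)" ?Y] Y[OF zero_less_one]
      using A B by simp
  qed
  have "skew i 1 (serre_sum D i (Suc M) 0 ?X ?Y)
      = (\<Sum>k\<le>Suc M. ?b k *\<^sub>s (if k = 0 then 0 else qint D i k *\<^sub>s T (k - 1)))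
      + (\<Sum>k\<le>Suc M. ?b k *\<^sub>s (if k = Suc M then 0 else qint D i (Suc M - k) *\<^sub>s T k))"
    unfolding serre_sum_def sum.distrib[symmetric] pm.scale_right_distrib[symmetric]
    unfolding skew_simps by (intro sum.cong refl) (simp add: summand del: One_nat_def)
  also have "(\<Sum>k\<le>Suc M. ?b k *\<^sub>s (if k = 0 then 0 else qint D i k *\<^sub>s T (k - 1)))
      = (\<Sum>k\<le>M. (?b (Suc k) * qint D i (Suc k)) *\<^sub>s T k)"
    by (subst sum.atMost_Suc_shift) simp
  also have "(\<Sum>k\<le>Suc M. ?b k *\<^sub>s (if k = Suc M then 0 else qint D i (Suc M - k) *\<^sub>s T k))
      = (\<Sum>k\<le>M. (?b k * qint D i (Suc M - k)) *\<^sub>s T k)"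
    by simp
  also have "(\<Sum>k\<le>M. (?b (Suc k) * qint D i (Suc k)) *\<^sub>s T k) + (\<Sum>k\<le>M. (?b k * qint D i (Suc M - k)) *\<^sub>s T k)
      = (\<Sum>k\<le>M. (?b (Suc k) * qint D i (Suc k) + ?b k * qint D i (Suc M - k)) *\<^sub>s T k)"
    by (simp only: sum.distrib pm.scale_left_distrib)
  also have "\<dots> = 0"
    using qbinom_step[OF s] by (intro sum.neutral) (auto simp: mult.assoc)
  finally show ?thesis by (simp only: N)
qed

lemma commutator_in_J:
  assumes "i \<in> index_set D" "j \<in> index_set D" "cartan D i j = 0"
    and "k = 0 \<or> (i, k) \<in> I_infty D" "l = 0 \<or> (j, l) \<in> I_infty D"
  shows "gen i k * gen j l - gen j l * gen i k \<in> J"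
proof (cases "k = 0 \<or> l = 0")
  case False
  then show ?thesis
    using assms unfolding J_def serre_relators_def by (intro ideal_span_base) blast
qed auto

lemma skew_gen_cases:
  assumes "(i, k) \<in> I_infty D"
  obtains c m where "skew j n (gen i k) = c *\<^sub>s gen i m" "m = 0 \<or> (i, m) \<in> I_infty D"
    "n > 0 \<Longrightarrow> i \<noteq> j \<Longrightarrow> c = 0"
proof (cases "n = 0")
  case True
  then show ?thesis using assms that[of 1 k] by simp
next
  case n: False
  show ?thesis
  proof (cases "i = j \<and> n \<le> k")
    case True
    then show ?thesis
      using n assms by (intro that) (auto simp: skew_gen_eq intro: I_infty_mono)
  next
    case False
    then show ?thesis
      using n by (intro that[of 0 0]) (auto simp: skew_gen_eq)
  qed
qed

text \<open>When \<open>a\<^sub>i\<^sub>j\<^sub>' = 0\<close> all coefficients in the product rule are 1: a term with \<open>0 < a < n\<close> is nonzero only if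
  \<open>i = j = j'\<close>, and then \<open>q\<^sub>(\<^sub>j\<^sub>) = 1\<close>; in the terms with \<open>a = 0\<close> or \<open>a = n\<close> the exponent is zero or a multiple of \<open>a\<^sub>i\<^sub>j\<^sub>'\<close>.\<close>

lemma skew_commuting_gens:
  assumes "(i, k) \<in> I_infty D" "(j', l) \<in> I_infty D" "cartan D i j' = 0" "j \<in> index_set D"
  shows "skew j n (gen i k * gen j' l) = (\<Sum>a\<le>n. skew j a (gen i k) * skew j (n - a) (gen j' l))"
  unfolding skew_mult
proof (rule sum.cong)
  fix a assume a: "a \<in> {..n}"
  have idx: "i \<in> index_set D" "j' \<in> index_set D"
    using assms I_infty_index by auto
  have E: "qq (dd j * int a * (int n - int a)) *\<^sub>s (skew j a (gen i k) * skew j (n - a) (twist (\<lambda>z. - int a * \<kappa> j z) (gen j' l)))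
    = qq (dd j * int a * (int n - int a) - int l * int a * (symm D j * cartan D j j')) *\<^sub>s
      (skew j a (gen i k) * skew j (n - a) (gen j' l))"
    using assms idx by (simp add: \<kappa>_root qq_add[symmetric] algebra_simps)
  show "qq (dd j * int a * (int n - int a)) *\<^sub>s (skew j a (gen i k) * skew j (n - a) (twist (\<lambda>z. - int a * \<kappa> j z) (gen j' l)))
    = skew j a (gen i k) * skew j (n - a) (gen j' l)"
  proof (cases "skew j a (gen i k) = 0 \<or> skew j (n - a) (gen j' l) = 0")
    case True
    then show ?thesis unfolding E by auto
  next
    case False
    then have 1: "a = 0 \<or> i = j" and 2: "n = a \<or> j' = j"
      using a by (auto simp: skew_gen_eq split: if_splits) (metis a atMost_iff diff_is_0_eq le_antisym neq0_conv skew_gen_eq)+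
    have "dd j = 0" if "i = j" "j' = j"
      using assms(3) that by (simp add: dd_def)
    then have e0: "dd j * int a * (int n - int a) - int l * int a * (symm D j * cartan D j j') = 0"
      using 1 2 assms(3) by auto
    show ?thesis by (simp only: E e0 qq_0 pm.scale_one)
  qed
qed simp

lemma cartan_zero_sym: "\<lbrakk>i \<in> index_set D; j \<in> index_set D; cartan D i j = 0\<rbrakk> \<Longrightarrow> cartan D j i = 0"
  using symmetrizable[of i j] symm_pos[of j] by auto

text \<open>The hypothesis excludes the degrees \<open>n > 1\<close> for a real index \<open>j\<close>; they are not needed, because \<open>f\<^sub>j\<^sub>1\<close> is then the
  only generator with index \<open>j\<close>.\<close>

lemma skew_relator_in_J:
  assumes r: "r \<in> serre_relators" and jn: "(j, n) \<in> I_infty D"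
  shows "skew j n r \<in> J"
proof -
  have n: "n > 0" and j: "j \<in> index_set D"
    using jn I_infty_pos I_infty_index by auto
  consider (serre) i j' l where "i \<in> real_indices D" "(j', l) \<in> I_infty D" "(j', l) \<noteq> (i, 1)"
      "r = serre_sum D i (nat (1 - int l * cartan D i j')) 0 (gen i 1) (gen j' l)"
    | (comm) i k j' l where "(i, k) \<in> I_infty D" "(j', l) \<in> I_infty D" "cartan D i j' = 0"
      "r = gen i k * gen j' l - gen j' l * gen i k"
    using r unfolding serre_relators_def by blast
  then show ?thesis
  proof cases
    case serre
    have ne: "i \<noteq> j'"
      using serre real_I_infty by auto
    have idx: "i \<in> index_set D" "j' \<in> index_set D"
      using serre I_infty_index real_index by auto
    show ?thesis
    proof (cases "i = j")
      case True
      \<comment> \<open>\<open>j\<close> is real\<close>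
      then have "n = 1"
        using serre jn real_I_infty by auto
      then show ?thesis
        using True serre ne idx by (simp add: skew_serre_sum_diag del: One_nat_def)
    next
      case ij: False
      have E: "skew j n r = serre_sum D i (nat (1 - int l * cartan D i j')) (- int n * cartan D i j)
          (gen i 1) (skew j n (gen j' l))"
        using skew_serre_sum_off[OF idx(1) j ij] serre by simp
      show ?thesis
      proof (cases "j' = j \<and> n \<le> l")
        case False
        then have "skew j n r = 0"
          unfolding E using n by (auto simp: skew_gen_eq serre_sum_def)
        then show ?thesis by simp
      next
        case True
        define N where "N = nat (1 - int (l - n) * cartan D i j)"
        define d where "d = nat (- int n * cartan D i j)"
        have a: "cartan D i j \<le> 0"
          using off_diagonal idx j ij by auto
        have d: "int d = - int n * cartan D i j"
          using a by (simp add: d_def mult_nonneg_nonpos)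
        have "1 - int (l - n) * cartan D i j \<ge> 0"
          using a mult_nonneg_nonpos[of "int (l - n)" "cartan D i j"] by auto
        then have "int (N + d) = 1 - int l * cartan D i j"
          using True by (simp add: N_def d of_nat_diff algebra_simps)
        then have Nd: "nat (1 - int l * cartan D i j) = N + d"
          by simp
        have l: "l - n = 0 \<or> (j, l - n) \<in> I_infty D"
          using serre(2) True by (auto intro: I_infty_mono)
        have "serre_sum D i N 0 (gen i 1) (gen j (l - n)) \<in> J"
          unfolding N_def using serre ij j l by (intro serre_sum_in_J) auto
        then have "serre_sum D i (N + d) (int d) (gen i 1) (gen j (l - n)) \<in> J"
          unfolding J_def using idx symm_pos serre(1)
          by (intro serre_sum_shift_in_ideal) (auto simp: real_I_infty)
        moreover have "skew j n (gen j' l)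
            = (\<tau> j n * qq (- dd j * int n * (int l - int n))) *\<^sub>s gen j (l - n)"
          using True n by (simp add: skew_gen_eq)
        ultimately show ?thesis
          using True by (simp only: E Nd d[symmetric] serre_sum_scale) (rule J_closed)
      qed
    qed
  next
    case comm
    have idx: "i \<in> index_set D" "j' \<in> index_set D"
      using comm I_infty_index by auto
    have c': "cartan D j' i = 0"
      using cartan_zero_sym idx comm by auto
    have "skew j n r = (\<Sum>a\<le>n. skew j a (gen i k) * skew j (n - a) (gen j' l))
        - (\<Sum>a\<le>n. skew j a (gen j' l) * skew j (n - a) (gen i k))"
      using comm c' j by (simp add: skew_commuting_gens)
    also have "(\<Sum>a\<le>n. skew j a (gen j' l) * skew j (n - a) (gen i k))
        = (\<Sum>a\<le>n. skew j (n - a) (gen j' l) * skew j a (gen i k))"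
      by (rule sum.reindex_bij_witness[of _ "\<lambda>a. n - a" "\<lambda>a. n - a"]) auto
    also have "(\<Sum>a\<le>n. skew j a (gen i k) * skew j (n - a) (gen j' l)) - \<dots>
        = (\<Sum>a\<le>n. skew j a (gen i k) * skew j (n - a) (gen j' l) - skew j (n - a) (gen j' l) * skew j a (gen i k))"
      by (simp add: sum_subtractf)
    also have "\<dots> \<in> J"
    proof (rule J_closed)
      fix a
      obtain c m where 1: "skew j a (gen i k) = c *\<^sub>s gen i m" "m = 0 \<or> (i, m) \<in> I_infty D"
        using comm by (elim skew_gen_cases)
      obtain c' m' where 2: "skew j (n - a) (gen j' l) = c' *\<^sub>s gen j' m'" "m' = 0 \<or> (j', m') \<in> I_infty D"
        using comm by (elim skew_gen_cases)
      have "(c * c') *\<^sub>s (gen i m * gen j' m' - gen j' m' * gen i m) \<in> J"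
        using commutator_in_J idx comm(3) 1(2) 2(2) by (intro J_closed(3)) auto
      then show "skew j a (gen i k) * skew j (n - a) (gen j' l) - skew j (n - a) (gen j' l) * skew j a (gen i k) \<in> J"
        by (simp add: 1 2 pm.scale_right_diff_distrib mult.commute)
    qed
    finally show ?thesis .
  qed
qed

lemma relator_homogeneous:
  assumes "r \<in> serre_relators"
  obtains c where "twist h r = qq c *\<^sub>s r"
proof -
  consider (serre) i j' l where 
      "r = serre_sum D i (nat (1 - int l * cartan D i j')) 0 (gen i 1) (gen j' l)"
    | (comm) i k j' l where 
      "r = gen i k * gen j' l - gen j' l * gen i k"
    using assms unfolding serre_relators_def by blast
  then show ?thesis
  proof cases
    case serre
    have "twist h (serre_sum D i N 0 (gen i 1) (gen j' l))
      = qq (int N * h (simple_root D i) + int l * h (simple_root D j')) *\<^sub>s serre_sum D i N 0 (gen i 1) (gen j' l)"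
      for N
    proof -
      have "twist h (gen i 1 ^ (N - k) * gen j' l * gen i 1 ^ k)
        = qq (int N * h (simple_root D i) + int l * h (simple_root D j')) *\<^sub>s (gen i 1 ^ (N - k) * gen j' l * gen i 1 ^ k)"
        if "k \<le> N" for k
        using that by (simp add: power_pscale qq_power qq_add[symmetric] of_nat_diff algebra_simps)
      then show ?thesis
        by (simp add: serre_sum_def pm.scale_sum_right mult.commute)
    qed
    then show ?thesis using that serre by blast
  next
    case comm
    show ?thesis
      by (rule that[of "int k * h (simple_root D i) + int l * h (simple_root D j')"])
         (simp add: comm qq_add pm.scale_right_diff_distrib mult.commute)
  qed
qed

lemma skew_J:
  assumes "x \<in> J" "n = 0 \<or> (j, n) \<in> I_infty D"
  shows "skew j n x \<in> J"
  unfolding J_def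
proof (rule plinear_ideal_span[OF _ _ _ assms(1)[unfolded J_def]], goal_cases)
  case (2 u r v)
  have sub: "m = 0 \<or> (j, m) \<in> I_infty D" if "m \<le> n" for m
    using assms(2) that by (auto intro: I_infty_mono)
  have r: "r \<in> J" using 2 unfolding J_def by (intro ideal_span_base)
  have tr: "skew j m (twist h r) \<in> J" if "m \<le> n" for m h
  proof -
    obtain c where "twist h r = qq c *\<^sub>s r" using relator_homogeneous 2 by blast
    then show ?thesis
      using sub[OF that] skew_relator_in_J 2 r by (cases "m = 0") auto
  qed
  have "skew j m (mon u * r) \<in> J" if "m \<le> n" for m
    unfolding skew_mult using that 2 
    by (intro J_closed J_mult tr skew_word_span mon_in_word_span) auto
  then have "skew j n (mon u * r * mon v) \<in> J"
    unfolding skew_mult[of j n "mon u * r"] using 2 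
    by (intro J_closed J_mult skew_word_span) (auto intro!: skew_word_span)
  then show ?case by (simp add: J_def)
qed auto

subsection \<open>The mirror images\<close>

text \<open>The reversal of words.\<close>

definition flip :: "'i free_alg \<Rightarrow> 'i free_alg" where
  "flip = anti_map (\<lambda>g. g)"

lemma flip_mon [simp]: "flip (mon u) = mon (rev u)"
  by (simp add: flip_def)

lemma plinear_flip [simp, intro]: "plinear flip"
  and plinear_flip' [simp, intro]: "plinear f \<Longrightarrow> plinear (\<lambda>x. flip (f x))"
  by (auto simp: flip_def)

lemmas flip_simps [simp] = plinear_simps[OF plinear_flip]

lemma flip_mult [simp]: "flip (x * y) = flip y * flip x"
  and flip_one [simp]: "flip 1 = 1"
  and flip_power [simp]: "flip (x ^ n) = flip x ^ n"
  by (simp_all add: flip_def)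

lemma flip_gen [simp]: "flip (gen i l) = gen i l"
  by (simp add: gen_def)

lemma flip_flip [simp]: "flip (flip x) = x"
  by (rule plinear_eq_on[of "\<lambda>x. flip (flip x)" "\<lambda>x. x"]) (auto simp: single_free_mon)

lemma flip_word_span [simp, intro]: "x \<in> word_span G \<Longrightarrow> flip x \<in> word_span G"
  unfolding flip_def by (rule anti_map_word_span) auto

lemma qbinom_sym: "k \<le> n \<Longrightarrow> qbinom D i (n) (n - k) = qbinom D i n k"
  by (simp add: qbinom_def mult.commute)

lemma anti_map_serre_sum:
  "anti_map \<phi> (serre_sum D i N 0 x y) = (-1) ^ N *\<^sub>s serre_sum D i N 0 (anti_map \<phi> x) (anti_map \<phi> y)"
proof -
  have sgn: "(-1) ^ (N - k) = (-1 :: qfield) ^ N * (-1) ^ k" if "k \<le> N" for k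
    using that by (simp add: power_add[symmetric] minus_one_power_iff)
  have "anti_map \<phi> (serre_sum D i N 0 x y)
      = (\<Sum>k\<le>N. ((-1) ^ k * qbinom D i N k) *\<^sub>s (anti_map \<phi> x ^ k * anti_map \<phi> y * anti_map \<phi> x ^ (N - k)))"
    by (simp add: serre_sum_def mult.assoc)
  also have "\<dots> = (\<Sum>k\<le>N. ((-1) ^ (N - k) * qbinom D i N (N - k))
      *\<^sub>s (anti_map \<phi> x ^ (N - k) * anti_map \<phi> y * anti_map \<phi> x ^ k))"
    by (rule sum.reindex_bij_witness[of _ "\<lambda>k. N - k" "\<lambda>k. N - k"]) auto
  also have "\<dots> = (-1) ^ N *\<^sub>s serre_sum D i N 0 (anti_map \<phi> x) (anti_map \<phi> y)"
    unfolding serre_sum_def pm.scale_sum_right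
    by (intro sum.cong) (auto simp: sgn qbinom_sym mult.assoc)
  finally show ?thesis .
qed

lemma flip_J: "x \<in> J \<Longrightarrow> flip x \<in> J"
  unfolding flip_def J_def
proof (erule anti_map_ideal_span[rotated -1])
  fix r assume "r \<in> serre_relators"
  then consider (serre) i j' l where "i \<in> real_indices D" "(j', l) \<in> I_infty D" "(j', l) \<noteq> (i, 1)"
      "r = serre_sum D i (nat (1 - int l * cartan D i j')) 0 (gen i 1) (gen j' l)"
    | (comm) i k j' l where "(i, k) \<in> I_infty D" "(j', l) \<in> I_infty D" "cartan D i j' = 0"
      "r = gen i k * gen j' l - gen j' l * gen i k"
    unfolding serre_relators_def by blast
  then have "flip r \<in> J"
  proof cases
    case serre
    have "i \<noteq> j'" using serre real_I_infty by auto
    then show ?thesis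
      unfolding serre(4) flip_def anti_map_serre_sum unfolding flip_def[symmetric] flip_gen
      using serre I_infty_index by (intro J_closed(3) serre_sum_in_J) auto
  next
    case comm
    have "- 1 *\<^sub>s (gen i k * gen j' l - gen j' l * gen i k) \<in> J"
      using comm I_infty_index by (intro J_closed(3) commutator_in_J) auto
    then show ?thesis unfolding comm(4) by simp
  qed
  then show "anti_map (\<lambda>g. g) r \<in> ideal_span (I_infty D) (I_infty D) serre_relators"
    unfolding flip_def J_def .
qed auto

text \<open>The mirror image of \<open>skew\<close>, which arises when \<open>f\<^sub>j\<^sub>k\<close> is moved across from the other side.\<close>

definition coskew :: "'i \<Rightarrow> nat \<Rightarrow> 'i free_alg \<Rightarrow> 'i free_alg" where
  "coskew j n x = flip (skew j n (flip x))"

lemma plinear_coskew [simp, intro]: "plinear (coskew j n)"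
  and plinear_coskew' [simp, intro]: "plinear f \<Longrightarrow> plinear (\<lambda>x. coskew j n (f x))"
  unfolding coskew_def[abs_def] by auto

lemma coskew_J: "x \<in> J \<Longrightarrow> n = 0 \<or> (j, n) \<in> I_infty D \<Longrightarrow> coskew j n x \<in> J"
  unfolding coskew_def by (intro flip_J skew_J)

lemma coskew_0 [simp]: "coskew j 0 x = x"
  by (simp add: coskew_def)

lemma coskew_one: "coskew j n 1 = (if n = 0 then 1 else 0)"
  by (simp add: coskew_def skew_one)

lemma coskew_word_span: "x \<in> word_span (I_infty D) \<Longrightarrow> coskew j n x \<in> word_span (I_infty D)"
  unfolding coskew_def by (intro flip_word_span skew_word_span)

lemma skew_word_single: "skew_word j n [g] = skew_gen j n g"
proof -
  have "skew_word j n [g] = (\<Sum>a\<le>n. if a = n then skew_gen j n g else 0)"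
    unfolding skew_word.simps by (intro sum.cong) auto
  then show ?thesis by simp
qed

lemma coskew_Cons:
  "coskew j n (mon (g # w)) = (\<Sum>a\<le>n. qq (dd j * int a * (int n - int a) - int a * wt (\<kappa> j) [g])
      *\<^sub>s (skew_gen j (n - a) g * coskew j a (mon w)))"
proof -
  have "flip (skew_gen j m g) = skew_gen j m g" for m
    by (auto simp: skew_gen_def split: prod.splits)
  then show ?thesis
    unfolding coskew_def by (simp add: skew_word_append skew_word_single del: skew_word.simps)
qed

section \<open>The two halves inside the free algebra on all generators\<close>

text \<open>The free algebra on \<open>I\<^sup>\<infinity>\<close> as the algebra of the words in the \<open>e\<^sub>i\<^sub>l\<close> and as that of the words in the \<open>f\<^sub>i\<^sub>l\<close>.\<close>

definition eE :: "'i free_alg \<Rightarrow> ('i, 'p) falg" where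
  "eE = alg_map (\<lambda>(i, l). Ge i l)"

definition fE :: "'i free_alg \<Rightarrow> ('i, 'p) falg" where
  "fE = alg_map (\<lambda>(i, l). Gf i l)"

lemma plinear_eE [simp, intro]: "plinear f \<Longrightarrow> plinear (\<lambda>x. eE (f x))"
  and plinear_fE [simp, intro]: "plinear f \<Longrightarrow> plinear (\<lambda>x. fE (f x))"
  and plinear_eE' [simp, intro]: "plinear eE"
  and plinear_fE' [simp, intro]: "plinear fE"
  by (auto simp: eE_def fE_def)

lemmas eE_simps [simp] = plinear_simps[OF plinear_eE']
lemmas fE_simps [simp] = plinear_simps[OF plinear_fE']

lemma eE_mult [simp]: "eE (x * y) = eE x * eE y" "eE 1 = 1" "eE (x ^ n) = eE x ^ n"
  and fE_mult [simp]: "fE (x * y) = fE x * fE y" "fE 1 = 1" "fE (x ^ n) = fE x ^ n"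
  by (simp_all add: eE_def fE_def)

lemma eE_gen [simp]: "eE (gen i l) = e_gen i l"
  and fE_gen [simp]: "fE (gen i l) = f_gen i l"
  by (auto simp: gen_def e_gen_def f_gen_def letter_mon eE_def fE_def)

lemma e_gen_0 [simp]: "e_gen i 0 = 1" and f_gen_0 [simp]: "f_gen i 0 = 1"
  by (simp_all add: e_gen_def f_gen_def)

text \<open>The free algebra that contains the relators.\<close>

abbreviation W :: "('i, 'p) falg set" where "W \<equiv> word_span (gens D)"

lemma eE_W [simp, intro]: "x \<in> word_span (I_infty D) \<Longrightarrow> eE x \<in> W"
  and fE_W [simp, intro]: "x \<in> word_span (I_infty D) \<Longrightarrow> fE x \<in> W"
  unfolding eE_def fE_def by (auto intro!: alg_map_word_span simp: gens_def)

lemma e_gen_W [simp, intro]: "l = 0 \<or> (i, l) \<in> I_infty D \<Longrightarrow> e_gen i l \<in> W"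
  and f_gen_W [simp, intro]: "l = 0 \<or> (i, l) \<in> I_infty D \<Longrightarrow> f_gen i l \<in> W"
  using eE_W[of "gen i l"] fE_W[of "gen i l"] by (simp_all del: eE_W fE_W)

lemma qexp_W [simp, intro]: "h \<in> coweights \<Longrightarrow> qexp h \<in> W"
  by (auto simp: qexp_def letter_mon gens_def)

lemma coweights_0 [simp, intro]: "(\<lambda>_. 0) \<in> coweights"
  and coweights_plus [simp, intro]: "h \<in> coweights \<Longrightarrow> h' \<in> coweights \<Longrightarrow> (\<lambda>x. h x + h' x) \<in> coweights"
  and coweights_scale [simp, intro]: "h \<in> coweights \<Longrightarrow> (\<lambda>x. c * h x) \<in> coweights"
  and coweights_minus [simp, intro]: "h \<in> coweights \<Longrightarrow> (\<lambda>x. - h x) \<in> coweights"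
  by (auto simp: coweights_def Modules.additive_def algebra_simps)

lemma coweights_\<kappa> [simp, intro]: "i \<in> index_set D \<Longrightarrow> \<kappa> i \<in> coweights"
  unfolding \<kappa>_def using coroots by auto

text \<open>\<open>K\<^sub>i\<^sup>n\<close>.\<close>

abbreviation KK :: "'i \<Rightarrow> int \<Rightarrow> ('i, 'p) falg" where
  "KK i n \<equiv> qexp (\<lambda>x. n * \<kappa> i x)"

lemma K_pow_eq: "K_pow D i n = KK i n"
  by (simp add: K_pow_def \<kappa>_def mult.assoc)

text \<open>Congruence modulo the ideal generated by a set of relators.\<close>

definition ideq :: "('i, 'p) falg set \<Rightarrow> ('i, 'p) falg \<Rightarrow> ('i, 'p) falg \<Rightarrow> bool" where
  "ideq S x y \<longleftrightarrow> x - y \<in> ideal_span (gens D) (gens D) S"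

lemma ideq_refl [simp, intro]: "ideq S x x"
  by (simp add: ideq_def)

lemma ideq_sym: "ideq S x y \<Longrightarrow> ideq S y x"
  unfolding ideq_def using pm.subspace_neg[OF subspace_ideal_span, of "x - y"] by force

lemma ideq_trans [trans]: "ideq S x y \<Longrightarrow> ideq S y z \<Longrightarrow> ideq S x z"
  unfolding ideq_def using ideal_span_closed(1)[of "x - y" _ _ S "y - z"] by force

lemma ideq_add: "ideq S x y \<Longrightarrow> ideq S x' y' \<Longrightarrow> ideq S (x + x') (y + y')"
  unfolding ideq_def using ideal_span_closed(1)[of "x - y" _ _ S "x' - y'"]
  by (simp add: algebra_simps)

lemma ideq_scale: "ideq S x y \<Longrightarrow> ideq S (c *\<^sub>s x) (c *\<^sub>s y)"
  unfolding ideq_def by (simp add: pm.scale_right_diff_distrib[symmetric])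

lemma ideq_sum: "(\<And>i. i \<in> A \<Longrightarrow> ideq S (f i) (g i)) \<Longrightarrow> ideq S (\<Sum>i\<in>A. f i) (\<Sum>i\<in>A. g i)"
  unfolding ideq_def by (auto simp: sum_subtractf[symmetric])

lemma ideq_mult_left: "ideq S x y \<Longrightarrow> z \<in> W \<Longrightarrow> ideq S (z * x) (z * y)"
  unfolding ideq_def by (simp add: right_diff_distrib[symmetric] ideal_span_mult_left)

lemma ideq_mult_right: "ideq S x y \<Longrightarrow> z \<in> W \<Longrightarrow> ideq S (x * z) (y * z)"
  unfolding ideq_def by (simp add: left_diff_distrib[symmetric] ideal_span_mult_right)

lemma ideq_mono: "ideq S x y \<Longrightarrow> S \<subseteq> S' \<Longrightarrow> ideq S' x y"
  unfolding ideq_def using ideal_span_mono by blast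

lemma ideq_relator: "x - y \<in> S \<Longrightarrow> ideq S x y"
  unfolding ideq_def by (rule ideal_span_base)

text \<open>The relations that involve the torus.\<close>

inductive_set torus_relators :: "('i, 'p) falg set" where
  q_zero: "qexp (\<lambda>_. 0) - 1 \<in> torus_relators"
| q_add: "\<lbrakk>h \<in> coweights; h' \<in> coweights\<rbrakk> \<Longrightarrow>
    qexp h * qexp h' - qexp (\<lambda>x. h x + h' x) \<in> torus_relators"
| q_e: "\<lbrakk>h \<in> coweights; (j, l) \<in> I_infty D\<rbrakk> \<Longrightarrow>
    qexp h * e_gen j l * qexp (\<lambda>x. - h x) - qq (int l * h (simple_root D j)) *\<^sub>s e_gen j l
      \<in> torus_relators"
| q_f: "\<lbrakk>h \<in> coweights; (j, l) \<in> I_infty D\<rbrakk> \<Longrightarrow>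
    qexp h * f_gen j l * qexp (\<lambda>x. - h x) - qq (- (int l * h (simple_root D j))) *\<^sub>s f_gen j l
      \<in> torus_relators"

text \<open>The symmetric form of the relation between \<open>e\<^sub>i\<^sub>l\<close> and \<open>f\<^sub>i\<^sub>k\<close>, with the power of \<open>K\<^sub>i\<close> in the middle. The exponent
  of \<open>q\<^sub>(\<^sub>i\<^sub>)\<close> is \<open>-n(m+s)\<close> with \<open>m = k - n\<close> and \<open>s = l - n\<close>.\<close>

definition sym_drinfeld :: "'i \<Rightarrow> nat \<Rightarrow> nat \<Rightarrow> ('i, 'p) falg" where
  "sym_drinfeld i k l = (\<Sum>n\<le>min k l. (\<tau> i n * qq (- dd i * int n * (int k + int l - 2 * int n)))
     *\<^sub>s (e_gen i (l - n) * KK i (- int n) * f_gen i (k - n) - f_gen i (k - n) * KK i (int n) * e_gen i (l - n)))"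

text \<open>The relations of the torus and those between the \<open>e\<close> and the \<open>f\<close>.\<close>

inductive_set cross_relators :: "('i, 'p) falg set" where
  torus: "r \<in> torus_relators \<Longrightarrow> r \<in> cross_relators"
| comm_e_f: "\<lbrakk>(i, k) \<in> I_infty D; (j, l) \<in> I_infty D; i \<noteq> j\<rbrakk> \<Longrightarrow>
    e_gen j l * f_gen i k - f_gen i k * e_gen j l \<in> cross_relators"
| drinfeld: "\<lbrakk>(i, k) \<in> I_infty D; (i, l) \<in> I_infty D\<rbrakk> \<Longrightarrow> sym_drinfeld i k l \<in> cross_relators"

lemma torus_subset_cross: "torus_relators \<subseteq> cross_relators"
  by (auto intro: cross_relators.torus)

subsection \<open>Commuting with the torus\<close>

lemma qexp_0: "ideq torus_relators (qexp (\<lambda>_. 0)) 1"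
  by (intro ideq_relator torus_relators.q_zero)

lemma qexp_add: "h \<in> coweights \<Longrightarrow> h' \<in> coweights \<Longrightarrow>
    ideq torus_relators (qexp h * qexp h') (qexp (\<lambda>x. h x + h' x))"
  by (intro ideq_relator torus_relators.q_add)

lemma qexp_inverse: "h \<in> coweights \<Longrightarrow> ideq torus_relators (qexp (\<lambda>x. - h x) * qexp h) 1"
  using ideq_trans[OF qexp_add[of "\<lambda>x. - h x" h]] qexp_0 by simp

lemma conj_imp_comm:
  assumes "ideq torus_relators (qexp h * x * qexp (\<lambda>x. - h x)) (c *\<^sub>s x)" "h \<in> coweights" "x \<in> W"
  shows "ideq torus_relators (qexp h * x) (c *\<^sub>s (x * qexp h))"
proof -
  have "ideq torus_relators (qexp h * x * (qexp (\<lambda>x. - h x) * qexp h)) (qexp h * x * 1)"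
    using assms by (intro ideq_mult_left qexp_inverse) auto
  from ideq_sym[OF this] have "ideq torus_relators (qexp h * x) (qexp h * x * qexp (\<lambda>x. - h x) * qexp h)"
    by (simp add: mult.assoc)
  also have "ideq torus_relators \<dots> (c *\<^sub>s x * qexp h)"
    using assms by (intro ideq_mult_right) auto
  finally show ?thesis by simp
qed

lemma qexp_e: "\<lbrakk>h \<in> coweights; l = 0 \<or> (j, l) \<in> I_infty D\<rbrakk> \<Longrightarrow>
    ideq torus_relators (qexp h * e_gen j l) (qq (int l * h (simple_root D j)) *\<^sub>s (e_gen j l * qexp h))"
  using conj_imp_comm[OF ideq_relator[OF torus_relators.q_e]] by (cases "l = 0") auto

lemma qexp_f: "\<lbrakk>h \<in> coweights; l = 0 \<or> (j, l) \<in> I_infty D\<rbrakk> \<Longrightarrow>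
    ideq torus_relators (qexp h * f_gen j l) (qq (- (int l * h (simple_root D j))) *\<^sub>s (f_gen j l * qexp h))"
  using conj_imp_comm[OF ideq_relator[OF torus_relators.q_f]] by (cases "l = 0") auto

lemma mon_Cons_gen: "l > 0 \<Longrightarrow> mon ((i, l) # u) = gen i l * mon u"
  using mon_Cons[of "(i, l)" u] by (simp add: gen_def)

lemma qexp_eE_word:
  assumes "h \<in> coweights" "set u \<subseteq> I_infty D"
  shows "ideq torus_relators (qexp h * eE (mon u)) (eE (twist h (mon u)) * qexp h)"
  using assms(2)
proof (induction u)
  case (Cons g u)
  obtain i l where g: "g = (i, l)" by force
  then have il: "(i, l) \<in> I_infty D" using Cons by auto
  let ?c = "qq (int l * h (simple_root D i))"
  have E: "mon (g # u) = gen i l * mon u"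
    using g I_infty_pos[OF il] by (simp add: mon_Cons_gen)
  have "ideq torus_relators (qexp h * e_gen i l * eE (mon u)) (?c *\<^sub>s (e_gen i l * qexp h) * eE (mon u))"
    using assms il Cons by (intro ideq_mult_right qexp_e) auto
  also have "?c *\<^sub>s (e_gen i l * qexp h) * eE (mon u) = (?c *\<^sub>s e_gen i l) * (qexp h * eE (mon u))"
    by (simp add: mult.assoc)
  also have "ideq torus_relators \<dots> ((?c *\<^sub>s e_gen i l) * (eE (twist h (mon u)) * qexp h))"
    using assms il Cons by (intro ideq_mult_left Cons.IH) auto
  finally show ?case
    unfolding E by (simp add: mult.assoc)
qed simp

lemma qexp_fE_word:
  assumes "h \<in> coweights" "set u \<subseteq> I_infty D"
  shows "ideq torus_relators (qexp h * fE (mon u)) (fE (twist (\<lambda>x. - h x) (mon u)) * qexp h)"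
  using assms(2)
proof (induction u)
  case (Cons g u)
  obtain i l where g: "g = (i, l)" by force
  then have il: "(i, l) \<in> I_infty D" using Cons by auto
  let ?c = "qq (- (int l * h (simple_root D i)))"
  have E: "mon (g # u) = gen i l * mon u"
    using g I_infty_pos[OF il] by (simp add: mon_Cons_gen)
  have "ideq torus_relators (qexp h * f_gen i l * fE (mon u)) (?c *\<^sub>s (f_gen i l * qexp h) * fE (mon u))"
    using assms il Cons by (intro ideq_mult_right qexp_f) auto
  also have "?c *\<^sub>s (f_gen i l * qexp h) * fE (mon u) = (?c *\<^sub>s f_gen i l) * (qexp h * fE (mon u))"
    by (simp add: mult.assoc)
  also have "ideq torus_relators \<dots> ((?c *\<^sub>s f_gen i l) * (fE (twist (\<lambda>x. - h x) (mon u)) * qexp h))"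
    using assms il Cons by (intro ideq_mult_left Cons.IH) auto
  finally show ?case
    unfolding E by (simp add: mult.assoc)
qed simp

lemma qexp_eE:
  assumes "h \<in> coweights" "x \<in> word_span (I_infty D)"
  shows "ideq torus_relators (qexp h * eE x) (eE (twist h x) * qexp h)"
  unfolding ideq_def
  by (rule plinear_word_span[of "\<lambda>x. qexp h * eE x - eE (twist h x) * qexp h", OF _ _ _ assms(2)])
     (use qexp_eE_word[OF assms(1)] in \<open>auto simp: ideq_def\<close>)

lemma qexp_fE:
  assumes "h \<in> coweights" "x \<in> word_span (I_infty D)"
  shows "ideq torus_relators (qexp h * fE x) (fE (twist (\<lambda>x. - h x) x) * qexp h)"
  unfolding ideq_def
  by (rule plinear_word_span[of "\<lambda>x. qexp h * fE x - fE (twist (\<lambda>x. - h x) x) * qexp h", OF _ _ _ assms(2)])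
     (use qexp_fE_word[OF assms(1)] in \<open>auto simp: ideq_def\<close>)

lemma KK_add:
  assumes "i \<in> index_set D" shows "ideq torus_relators (KK i m * KK i n) (KK i (m + n))"
  using qexp_add[of "\<lambda>x. m * \<kappa> i x" "\<lambda>x. n * \<kappa> i x"] assms by (simp add: distrib_right)

lemma KK_0: "ideq torus_relators (KK i 0) 1"
  using qexp_0 by simp

text \<open>The symmetric relation differs from the given one by moving powers of \<open>K\<^sub>i\<close>.\<close>

lemma sym_drinfeld_equiv:
  assumes "(i, k) \<in> I_infty D" "(i, l) \<in> I_infty D"
  shows "ideq torus_relators
    ((\<Sum>(m, n, s) \<in> {(m, n, s). m + n = k \<and> n + s = l}.
       (q_paren D i powi (int n * (int m - int s)) * \<tau> i n) *\<^sub>s (e_gen i s * f_gen i m * K_pow D i (- int n)))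
    - (\<Sum>(m, n, s) \<in> {(m, n, s). m + n = k \<and> n + s = l}.
       (q_paren D i powi (- (int n * (int m - int s))) * \<tau> i n) *\<^sub>s (f_gen i m * e_gen i s * K_pow D i (int n))))
    (sym_drinfeld i k l)"
proof -
  have i: "i \<in> index_set D" using assms I_infty_index by auto
  have reindex: "(\<Sum>(m, n, s) \<in> {(m, n, s). m + n = k \<and> n + s = l}. F m n s)
      = (\<Sum>n\<le>min k l. F (k - n) n (l - n))" for F :: "nat \<Rightarrow> nat \<Rightarrow> nat \<Rightarrow> ('i, 'p) falg"
    by (rule sum.reindex_bij_witness[of _ "\<lambda>n. (k - n, n, l - n)" "\<lambda>(m, n, s). n"]) auto
  have summand: "ideq torus_relators
      ((q_paren D i powi (int n * (int (k - n) - int (l - n))) * \<tau> i n) *\<^sub>s (e_gen i (l - n) * f_gen i (k - n) * KK i (- int n))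
       - (q_paren D i powi (- (int n * (int (k - n) - int (l - n)))) * \<tau> i n) *\<^sub>s (f_gen i (k - n) * e_gen i (l - n) * KK i (int n)))
      ((\<tau> i n * qq (- dd i * int n * (int k + int l - 2 * int n)))
        *\<^sub>s (e_gen i (l - n) * KK i (- int n) * f_gen i (k - n) - f_gen i (k - n) * KK i (int n) * e_gen i (l - n)))"
    (is "ideq _ (?a *\<^sub>s ?x - ?b *\<^sub>s ?y) (?c *\<^sub>s (?x' - ?y'))") if n: "n \<le> min k l" for n
  proof -
    have "k - n = 0 \<or> (i, k - n) \<in> I_infty D" "l - n = 0 \<or> (i, l - n) \<in> I_infty D"
      using assms n by (auto intro: I_infty_mono)
    then have f: "f_gen i (k - n) \<in> W" "k - n = 0 \<or> (i, k - n) \<in> I_infty D"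
      and e: "e_gen i (l - n) \<in> W" "l - n = 0 \<or> (i, l - n) \<in> I_infty D"
      by blast+
    have 1: "ideq torus_relators (KK i (- int n) * f_gen i (k - n))
        (qq (2 * dd i * int n * (int k - int n)) *\<^sub>s (f_gen i (k - n) * KK i (- int n)))"
      using qexp_f[of "\<lambda>x. - int n * \<kappa> i x" "k - n" i] f i n
      by (simp add: \<kappa>_self of_nat_diff algebra_simps)
    have 2: "ideq torus_relators (KK i (int n) * e_gen i (l - n))
        (qq (2 * dd i * int n * (int l - int n)) *\<^sub>s (e_gen i (l - n) * KK i (int n)))"
      using qexp_e[of "\<lambda>x. int n * \<kappa> i x" "l - n" i] e i n
      by (simp add: \<kappa>_self of_nat_diff algebra_simps)
    have "ideq torus_relators (?c *\<^sub>s ?x') (?c *\<^sub>s (qq (2 * dd i * int n * (int k - int n)) *\<^sub>s ?x))"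
      using ideq_mult_left[OF 1 e(1)] by (intro ideq_scale) (simp add: mult.assoc)
    moreover have "?c *\<^sub>s (qq (2 * dd i * int n * (int k - int n)) *\<^sub>s ?x) = ?a *\<^sub>s ?x"
      using n by (simp add: q_paren_powi mult.assoc qq_add[symmetric] of_nat_diff mult.commute[of _ "\<tau> i n"])
        (simp add: algebra_simps)
    moreover have "ideq torus_relators (?c *\<^sub>s ?y') (?c *\<^sub>s (qq (2 * dd i * int n * (int l - int n)) *\<^sub>s ?y))"
      using ideq_mult_left[OF 2 f(1)] by (intro ideq_scale) (simp add: mult.assoc)
    moreover have "?c *\<^sub>s (qq (2 * dd i * int n * (int l - int n)) *\<^sub>s ?y) = ?b *\<^sub>s ?y"
      using n by (simp add: q_paren_powi mult.assoc qq_add[symmetric] of_nat_diff mult.commute[of _ "\<tau> i n"])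
        (simp add: algebra_simps)
    ultimately have "ideq torus_relators (?c *\<^sub>s ?x') (?a *\<^sub>s ?x)" "ideq torus_relators (?c *\<^sub>s ?y') (?b *\<^sub>s ?y)"
      by simp_all
    then have "ideq torus_relators (?c *\<^sub>s ?x' - ?c *\<^sub>s ?y') (?a *\<^sub>s ?x - ?b *\<^sub>s ?y)"
      using ideq_add[OF _ ideq_scale[of _ _ _ "-1"]] by force
    then show ?thesis
      by (simp add: pm.scale_right_diff_distrib ideq_sym)
  qed
  show ?thesis
    unfolding reindex sum_subtractf[symmetric] sym_drinfeld_def K_pow_eq
    using summand by (intro ideq_sum) auto
qed

lemma wt_minus: "wt (\<lambda>x. - h x) u = - wt h u"
  using wt_scale[of "-1" h u] by simp

section \<open>Moving a generator across a half\<close>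

lemma twist_skew_word: "twist h (skew_word j n u) = qq (wt h u - int n * h (simple_root D j)) *\<^sub>s skew_word j n u"
proof (induction u arbitrary: n)
  case (Cons g u)
  have g: "twist h (skew_gen j a g) = qq (wt h [g] - int a * h (simple_root D j)) *\<^sub>s skew_gen j a g" for a
    by (auto simp: skew_gen_def of_nat_diff algebra_simps split: prod.splits)
  have "twist h (skew_gen j a g * skew_word j (n - a) u)
    = qq (wt h (g # u) - int n * h (simple_root D j)) *\<^sub>s (skew_gen j a g * skew_word j (n - a) u)"
    if "a \<le> n" for a
    using that by (simp add: g Cons.IH qq_add[symmetric])
      (cases g, simp add: of_nat_diff algebra_simps)
  then show ?case
    by (simp add: pm.scale_sum_right mult.commute del: wt_simps)
qed (auto simp: twist_def)

lemma twist_skew_gen: "twist h (skew_gen j n g) = qq (wt h [g] - int n * h (simple_root D j)) *\<^sub>s skew_gen j n g"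
  using twist_skew_word[of h j n "[g]"] by (simp only: skew_word_single)

lemma skew_gen_word_span: "g \<in> I_infty D \<Longrightarrow> skew_gen j a g \<in> word_span (I_infty D)"
  using skew_word_span[of "mon [g]" j a] by (simp add: skew_word_single del: skew_word.simps)

lemma ideq_trans_sym: "ideq S x z \<Longrightarrow> ideq S y z \<Longrightarrow> ideq S x y"
  by (blast intro: ideq_trans ideq_sym)

abbreviation eqv :: "('i, 'p) falg \<Rightarrow> ('i, 'p) falg \<Rightarrow> bool"  (infix \<open>\<cong>\<^sub>0\<close> 50) where
  "x \<cong>\<^sub>0 y \<equiv> ideq cross_relators x y"

lemma torus_eqv: "ideq torus_relators x y \<Longrightarrow> x \<cong>\<^sub>0 y"
  by (rule ideq_mono[OF _ torus_subset_cross])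

text \<open>The two sides of the commutation of \<open>x\<close> with the family \<open>f\<^sub>j\<^sub>0, \<dots>, f\<^sub>j\<^sub>k\<close>.\<close>

definition cross_lhs :: "'i \<Rightarrow> nat \<Rightarrow> 'i free_alg \<Rightarrow> ('i, 'p) falg" where
  "cross_lhs j k x = (\<Sum>n\<le>k. qq (- dd j * int n * int (k - n))
     *\<^sub>s (eE (skew j n x) * KK j (- int n) * f_gen j (k - n)))"

definition cross_rhs :: "'i \<Rightarrow> nat \<Rightarrow> 'i free_alg \<Rightarrow> ('i, 'p) falg" where
  "cross_rhs j k x = (\<Sum>n\<le>k. qq (- dd j * int n * int (k - n))
     *\<^sub>s (f_gen j (k - n) * KK j (int n) * eE (coskew j n x)))"

lemma coskew_letter: "coskew j n (mon [g]) = skew_gen j n g"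
proof -
  have "flip (skew_gen j n g) = skew_gen j n g"
    by (auto simp: skew_gen_def split: prod.splits)
  then show ?thesis
    by (simp add: coskew_def skew_word_single del: skew_word.simps)
qed

lemma skew_letter: "skew j n (mon [g]) = skew_gen j n g"
  by (simp add: skew_word_single del: skew_word.simps)

lemma cross_lhs_letter_eqv_rhs:
  assumes g: "g \<in> I_infty D" and j: "j \<in> index_set D" and k: "k = 0 \<or> (j, k) \<in> I_infty D"
  shows "cross_lhs j k (mon [g]) \<cong>\<^sub>0 cross_rhs j k (mon [g])"
proof -
  obtain i l where gil: "g = (i, l)" and il: "(i, l) \<in> I_infty D" and l: "l > 0"
    using g I_infty_pos by (cases g) auto
  have eg: "eE (skew_gen j 0 g) = e_gen i l"
    using l unfolding eE_gen[symmetric] by (simp add: skew_gen_def gil gen_def del: eE_gen)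
  have f: "f_gen j k \<in> W" and e: "e_gen i l \<in> W"
    using k il by auto
  consider "k = 0" | "k > 0" "i \<noteq> j" | "k > 0" "i = j" by blast
  then show ?thesis
  proof cases
    case 1
    have "e_gen i l * KK j 0 \<cong>\<^sub>0 KK j 0 * e_gen i l"
      using ideq_mult_left[OF torus_eqv[OF KK_0[of j]] e] ideq_mult_right[OF torus_eqv[OF KK_0[of j]] e]
      unfolding mult_1_left mult_1_right by (rule ideq_trans_sym)
    then show ?thesis
      using 1 unfolding cross_lhs_def cross_rhs_def coskew_letter skew_letter by (simp add: eg)
  next
    case 2
    have z: "skew_gen j n g = 0" if "n > 0" for n
      using that 2 by (simp add: skew_gen_def gil)
    have A: "cross_lhs j k (mon [g]) = (\<Sum>n\<le>k. if n = 0 then e_gen i l * KK j 0 * f_gen j k else 0)"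
      unfolding cross_lhs_def skew_letter using z eg by (intro sum.cong) auto
    have B: "cross_rhs j k (mon [g]) = (\<Sum>n\<le>k. if n = 0 then f_gen j k * KK j 0 * e_gen i l else 0)"
      unfolding cross_rhs_def coskew_letter using z eg by (intro sum.cong) auto
    have "e_gen i l * KK j 0 * f_gen j k \<cong>\<^sub>0 e_gen i l * 1 * f_gen j k"
      using e f by (intro ideq_mult_left ideq_mult_right torus_eqv KK_0) auto
    also have "e_gen i l * 1 * f_gen j k \<cong>\<^sub>0 f_gen j k * 1 * e_gen i l"
      using 2 k il by (simp add: ideq_relator cross_relators.comm_e_f)
    also have "f_gen j k * 1 * e_gen i l \<cong>\<^sub>0 f_gen j k * KK j 0 * e_gen i l"
      using e f by (intro ideq_mult_left ideq_mult_right ideq_sym[OF torus_eqv[OF KK_0]]) auto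
    finally show ?thesis
      unfolding A B by simp
  next
    case 3
    let ?c = "\<lambda>n. \<tau> j n * qq (- dd j * int n * (int k + int l - 2 * int n))"
    have co: "(qq (- dd j * int n * int (k - n))) *\<^sub>s eE (skew_gen j n g)
        = ?c n *\<^sub>s e_gen j (l - n)" if "n \<le> min k l" for n
    proof (cases "n = 0")
      case True
      then show ?thesis using 3 eg tau_0[OF j] by simp
    next
      case False
      then show ?thesis
        using that 3 by (simp add: skew_gen_def gil mult.left_commute[of _ "\<tau> j n"] qq_add[symmetric] of_nat_diff)
          (simp add: algebra_simps)
    qed
    have z: "skew_gen j n g = 0" if "n \<in> {..k} - {..min k l}" for n
      using that by (auto simp: skew_gen_def gil)
    have "cross_lhs j k (mon [g]) = (\<Sum>n\<le>k. qq (- dd j * int n * int (k - n)) *\<^sub>s eE (skew_gen j n g) * KK j (- int n) * f_gen j (k - n))"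
      unfolding cross_lhs_def skew_letter by simp
    also have "\<dots> = (\<Sum>n\<le>min k l. qq (- dd j * int n * int (k - n)) *\<^sub>s eE (skew_gen j n g) * KK j (- int n) * f_gen j (k - n))"
      by (intro sum.mono_neutral_right ballI) (simp_all add: z del: Diff_iff)
    also have "\<dots> = (\<Sum>n\<le>min k l. ?c n *\<^sub>s (e_gen j (l - n) * KK j (- int n) * f_gen j (k - n)))"
      by (intro sum.cong refl, subst co) simp_all
    finally have A: "cross_lhs j k (mon [g]) = \<dots>" .
    have "cross_rhs j k (mon [g]) = (\<Sum>n\<le>k. f_gen j (k - n) * KK j (int n) * (qq (- dd j * int n * int (k - n)) *\<^sub>s eE (skew_gen j n g)))"
      unfolding cross_rhs_def coskew_letter by simp
    also have "\<dots> = (\<Sum>n\<le>min k l. f_gen j (k - n) * KK j (int n) * (qq (- dd j * int n * int (k - n)) *\<^sub>s eE (skew_gen j n g)))"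
      by (intro sum.mono_neutral_right ballI) (simp_all add: z del: Diff_iff)
    also have "\<dots> = (\<Sum>n\<le>min k l. ?c n *\<^sub>s (f_gen j (k - n) * KK j (int n) * e_gen j (l - n)))"
      by (intro sum.cong refl, subst co) simp_all
    finally have B: "cross_rhs j k (mon [g]) = \<dots>" .
    have "cross_lhs j k (mon [g]) - cross_rhs j k (mon [g]) = sym_drinfeld j k l"
      unfolding A B sym_drinfeld_def by (simp add: sum_subtractf pm.scale_right_diff_distrib)
    then show ?thesis
      using 3 il k by (simp add: ideq_relator cross_relators.drinfeld)
  qed
qed

text \<open>The induction step: both sides for the word \<open>g w\<close> are sums over triples \<open>a + b + m = k\<close>. Applying the
  statement for \<open>w\<close> and then the one for \<open>g\<close> to subsums carries one into the other; the remaining steps only move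
  powers of \<open>K\<^sub>j\<close>.\<close>

lemma cross_lhs_Cons_eqv_rhs_Cons:
  assumes g: "g \<in> I_infty D" and w: "set w \<subseteq> I_infty D" and j: "j \<in> index_set D"
    and k: "k = 0 \<or> (j, k) \<in> I_infty D"
    and IH: "\<And>m. m = 0 \<or> (j, m) \<in> I_infty D \<Longrightarrow> cross_lhs j m (mon w) \<cong>\<^sub>0 cross_rhs j m (mon w)"
  shows "cross_lhs j k (mon (g # w)) \<cong>\<^sub>0 cross_rhs j k (mon (g # w))"
proof -
  have m: "m = 0 \<or> (j, m) \<in> I_infty D" if "m \<le> k" for m
    using k that by (auto intro: I_infty_mono)
  define G where "G a = eE (skew_gen j a g)" for a
  define R where "R b = eE (skew_word j b w)" for b
  define L where "L b = eE (coskew j b (mon w))" for b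
  have [simp]: "G a \<in> W" "R a \<in> W" "L a \<in> W" "KK j n \<in> W" for a n
    using g w j by (auto simp: G_def R_def L_def skew_gen_word_span coskew_word_span
        intro: skew_word_span[of "mon w", simplified])
  have fW: "f_gen j m \<in> W" if "m \<le> k" for m
    using m[OF that] by blast
  define F1 where "F1 a b m = qq (- dd j * ((int a + int b) * int m) + dd j * (int a * int b) - int a * wt (\<kappa> j) w)
      *\<^sub>s (G a * R b * KK j (- int a - int b) * f_gen j m)" for a b m
  define F2 where "F2 a b m = qq (- dd j * (int a * int b + int a * int m + int b * int m))
      *\<^sub>s (G a * KK j (- int a) * R b * KK j (- int b) * f_gen j m)" for a b m
  define F3 where "F3 a b m = qq (- dd j * (int a * int b + int a * int m + int b * int m))
      *\<^sub>s (G a * KK j (- int a) * f_gen j m * KK j (int b) * L b)" for a b m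
  define F4 where "F4 a b m = qq (- dd j * (int a * int b + int a * int m + int b * int m))
      *\<^sub>s (f_gen j m * KK j (int a) * G a * KK j (int b) * L b)" for a b m
  define F5 where "F5 a b m = qq (- dd j * ((int a + int b) * int m) + dd j * (int a * int b) - int b * wt (\<kappa> j) [g])
      *\<^sub>s (f_gen j m * KK j (int a + int b) * G a * L b)" for a b m
  have "cross_lhs j k (mon (g # w)) = (\<Sum>n\<le>k. \<Sum>a\<le>n. F1 a (n - a) (k - n))"
    unfolding cross_lhs_def skew_mon skew_word.simps
    by (intro sum.cong refl, simp add: sum_distrib_right pm.scale_sum_right F1_def G_def R_def,
        intro sum.cong refl)
       (simp add: of_nat_diff qq_add[symmetric] algebra_simps)
  also have "\<dots> = (\<Sum>a\<le>k. \<Sum>b\<le>k - a. F1 a b (k - a - b))"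
    by (rule sum_triangle_assoc)
  also have "\<dots> \<cong>\<^sub>0 (\<Sum>a\<le>k. \<Sum>b\<le>k - a. F2 a b (k - a - b))"
  proof (intro ideq_sum)
    fix a b assume ab: "a \<in> {..k}" "b \<in> {..k - a}"
    let ?m = "k - a - b"
    have "KK j (- int a) * R b \<cong>\<^sub>0 eE (twist (\<lambda>x. - int a * \<kappa> j x) (skew_word j b w)) * KK j (- int a)"
      unfolding R_def using j skew_word_span[of "mon w" j b] w by (intro torus_eqv qexp_eE) auto
    then have 1: "KK j (- int a) * R b \<cong>\<^sub>0 qq (- int a * wt (\<kappa> j) w + 2 * dd j * (int a * int b)) *\<^sub>s (R b * KK j (- int a))"
      using j by (simp add: twist_skew_word wt_scale wt_minus R_def \<kappa>_self algebra_simps)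
    have "KK j (- int a) * KK j (- int b) \<cong>\<^sub>0 KK j (- int a + - int b)"
      using j by (intro torus_eqv KK_add)
    then have 2: "KK j (- int a) * KK j (- int b) \<cong>\<^sub>0 KK j (- int a - int b)"
      by simp
    have "G a * (KK j (- int a) * R b) * (KK j (- int b) * f_gen j ?m)
      \<cong>\<^sub>0 G a * (qq (- int a * wt (\<kappa> j) w + 2 * dd j * (int a * int b)) *\<^sub>s (R b * KK j (- int a))) * (KK j (- int b) * f_gen j ?m)"
      using ab fW j by (intro ideq_mult_left ideq_mult_right 1) auto
    also have "\<dots> = qq (- int a * wt (\<kappa> j) w + 2 * dd j * (int a * int b))
        *\<^sub>s (G a * R b * (KK j (- int a) * KK j (- int b)) * f_gen j ?m)"
      by (simp add: mult.assoc)
    also have "\<dots> \<cong>\<^sub>0 qq (- int a * wt (\<kappa> j) w + 2 * dd j * (int a * int b))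
        *\<^sub>s (G a * R b * KK j (- int a - int b) * f_gen j ?m)"
      using ab fW j by (intro ideq_scale ideq_mult_left ideq_mult_right 2) auto
    finally have "F2 a b ?m \<cong>\<^sub>0 qq (- dd j * (int a * int b + int a * int ?m + int b * int ?m))
      *\<^sub>s (qq (- int a * wt (\<kappa> j) w + 2 * dd j * (int a * int b))
        *\<^sub>s (G a * R b * KK j (- int a - int b) * f_gen j ?m))"
      unfolding F2_def by (intro ideq_scale) (simp add: mult.assoc)
    also have "\<dots> = F1 a b ?m"
      unfolding F1_def pm.scale_scale qq_add[symmetric] by (simp add: algebra_simps)
    finally show "F1 a b ?m \<cong>\<^sub>0 F2 a b ?m" by (rule ideq_sym)
  qed
  also have "(\<Sum>a\<le>k. \<Sum>b\<le>k - a. F2 a b (k - a - b))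
      = (\<Sum>a\<le>k. qq (- dd j * int a * int (k - a)) *\<^sub>s (G a * KK j (- int a) * cross_lhs j (k - a) (mon w)))"
    unfolding F2_def cross_lhs_def skew_mon R_def[symmetric]
    by (intro sum.cong refl, simp add: sum_distrib_left pm.scale_sum_right, intro sum.cong refl)
       (simp add: of_nat_diff qq_add[symmetric] algebra_simps)
  also have "\<dots> \<cong>\<^sub>0 (\<Sum>a\<le>k. qq (- dd j * int a * int (k - a)) *\<^sub>s (G a * KK j (- int a) * cross_rhs j (k - a) (mon w)))"
    using j by (intro ideq_sum ideq_scale ideq_mult_left IH m) auto
  also have "\<dots> = (\<Sum>a\<le>k. \<Sum>b\<le>k - a. F3 a b (k - a - b))"
    unfolding F3_def cross_rhs_def L_def[symmetric]
    by (intro sum.cong refl, simp add: sum_distrib_left pm.scale_sum_right, intro sum.cong refl)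
       (simp add: of_nat_diff qq_add[symmetric] algebra_simps)
  also have "\<dots> = (\<Sum>b\<le>k. \<Sum>a\<le>k - b. F3 a b (k - b - a))"
    by (rule sum_triangle_swap)
  also have "\<dots> = (\<Sum>b\<le>k. qq (- dd j * int b * int (k - b)) *\<^sub>s (cross_lhs j (k - b) (mon [g]) * (KK j (int b) * L b)))"
    unfolding F3_def cross_lhs_def skew_letter G_def[symmetric]
    by (intro sum.cong refl, simp add: sum_distrib_right pm.scale_sum_right, intro sum.cong refl)
       (simp add: of_nat_diff qq_add[symmetric] algebra_simps)
  also have "\<dots> \<cong>\<^sub>0 (\<Sum>b\<le>k. qq (- dd j * int b * int (k - b)) *\<^sub>s (cross_rhs j (k - b) (mon [g]) * (KK j (int b) * L b)))"
    using j g by (intro ideq_sum ideq_scale ideq_mult_right cross_lhs_letter_eqv_rhs m) auto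
  also have "\<dots> = (\<Sum>b\<le>k. \<Sum>a\<le>k - b. F4 a b (k - b - a))"
    unfolding F4_def cross_rhs_def coskew_letter G_def[symmetric]
    by (intro sum.cong refl, simp add: sum_distrib_right pm.scale_sum_right, intro sum.cong refl)
       (simp add: of_nat_diff qq_add[symmetric] algebra_simps)
  also have "\<dots> \<cong>\<^sub>0 (\<Sum>b\<le>k. \<Sum>a\<le>k - b. F5 a b (k - b - a))"
  proof (intro ideq_sum)
    fix a b assume ab: "b \<in> {..k}" "a \<in> {..k - b}"
    let ?m = "k - b - a"
    have "KK j (int b) * G a \<cong>\<^sub>0 eE (twist (\<lambda>x. int b * \<kappa> j x) (skew_word j a [g])) * KK j (int b)"
      unfolding G_def skew_word_single using j g by (intro torus_eqv qexp_eE skew_gen_word_span) auto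
    then have 1: "KK j (int b) * G a \<cong>\<^sub>0 qq (int b * wt (\<kappa> j) [g] - 2 * dd j * (int a * int b)) *\<^sub>s (G a * KK j (int b))"
      using j by (simp add: twist_skew_gen wt_scale skew_word_single G_def \<kappa>_self algebra_simps del: skew_word.simps wt_simps)
    have "KK j (int a) * KK j (int b) \<cong>\<^sub>0 KK j (int a + int b)"
      using j by (intro torus_eqv KK_add)
    then have "f_gen j ?m * (KK j (int a) * KK j (int b)) * G a * L b \<cong>\<^sub>0 f_gen j ?m * KK j (int a + int b) * G a * L b"
      using ab fW j by (intro ideq_mult_left ideq_mult_right) auto
    moreover have "f_gen j ?m * KK j (int a) * (KK j (int b) * G a) * L b
      \<cong>\<^sub>0 f_gen j ?m * KK j (int a) * (qq (int b * wt (\<kappa> j) [g] - 2 * dd j * (int a * int b)) *\<^sub>s (G a * KK j (int b))) * L b"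
      using ab fW j by (intro ideq_mult_left ideq_mult_right 1) auto
    ultimately have "f_gen j ?m * KK j (int a) * KK j (int b) * G a * L b
        \<cong>\<^sub>0 f_gen j ?m * KK j (int a + int b) * G a * L b"
      and "f_gen j ?m * KK j (int a) * KK j (int b) * G a * L b
        \<cong>\<^sub>0 qq (int b * wt (\<kappa> j) [g] - 2 * dd j * (int a * int b)) *\<^sub>s (f_gen j ?m * KK j (int a) * G a * KK j (int b) * L b)"
      by (simp_all only: mult.assoc mult_pscale_left mult_pscale_right)
    then have "f_gen j ?m * KK j (int a + int b) * G a * L b
      \<cong>\<^sub>0 qq (int b * wt (\<kappa> j) [g] - 2 * dd j * (int a * int b)) *\<^sub>s (f_gen j ?m * KK j (int a) * G a * KK j (int b) * L b)"
      by (rule ideq_trans[OF ideq_sym])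
    then have "F5 a b ?m \<cong>\<^sub>0 qq (- dd j * ((int a + int b) * int ?m) + dd j * (int a * int b) - int b * wt (\<kappa> j) [g])
        *\<^sub>s (qq (int b * wt (\<kappa> j) [g] - 2 * dd j * (int a * int b)) *\<^sub>s (f_gen j ?m * KK j (int a) * G a * KK j (int b) * L b))"
      unfolding F5_def by (rule ideq_scale)
    also have "\<dots> = F4 a b ?m"
      unfolding F4_def pm.scale_scale qq_add[symmetric] by (simp add: algebra_simps)
    finally show "F4 a b ?m \<cong>\<^sub>0 F5 a b ?m" by (rule ideq_sym)
  qed
  also have "(\<Sum>b\<le>k. \<Sum>a\<le>k - b. F5 a b (k - b - a)) = (\<Sum>n\<le>k. \<Sum>b\<le>n. F5 (n - b) b (k - n))"
    using sum_triangle_assoc[of "\<lambda>b a m. F5 a b m" k] by simp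
  also have "\<dots> = cross_rhs j k (mon (g # w))"
    unfolding cross_rhs_def coskew_Cons
    by (intro sum.cong refl, simp add: sum_distrib_left pm.scale_sum_right F5_def G_def L_def,
        intro sum.cong refl)
       (simp add: of_nat_diff qq_add[symmetric] algebra_simps)
  finally show ?thesis .
qed

lemma cross_lhs_word_eqv_rhs:
  assumes "set w \<subseteq> I_infty D" "j \<in> index_set D" "k = 0 \<or> (j, k) \<in> I_infty D"
  shows "cross_lhs j k (mon w) \<cong>\<^sub>0 cross_rhs j k (mon w)"
  using assms(1,3)
proof (induction w arbitrary: k)
  case Nil
  have f: "f_gen j k \<in> W" using Nil by blast
  have A: "cross_lhs j k 1 = (\<Sum>n\<le>k. if n = 0 then KK j 0 * f_gen j k else 0)"
    unfolding cross_lhs_def skew_one by (intro sum.cong) auto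
  have B: "cross_rhs j k 1 = (\<Sum>n\<le>k. if n = 0 then f_gen j k * KK j 0 else 0)"
    unfolding cross_rhs_def coskew_one by (intro sum.cong) auto
  have "KK j 0 * f_gen j k \<cong>\<^sub>0 f_gen j k * KK j 0"
    using ideq_mult_right[OF torus_eqv[OF KK_0[of j]] f] ideq_mult_left[OF torus_eqv[OF KK_0[of j]] f]
    unfolding mult_1_left mult_1_right by (rule ideq_trans_sym)
  then show ?case
    by (simp add: A B)
next
  case (Cons g w)
  then show ?case
    using assms(2) by (intro cross_lhs_Cons_eqv_rhs_Cons) auto
qed

text \<open>How an element \<open>x\<close> of the positive half commutes with \<open>f\<^sub>j\<^sub>k\<close>: the terms with \<open>n = 0\<close> are \<open>x f\<^sub>j\<^sub>k\<close> and \<open>f\<^sub>j\<^sub>k x\<close>, up to \<open>K\<^sub>j\<^sup>0\<close>.\<close>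

lemma cross_lhs_eqv_rhs:
  assumes "x \<in> word_span (I_infty D)" "j \<in> index_set D" "k = 0 \<or> (j, k) \<in> I_infty D"
  shows "cross_lhs j k x \<cong>\<^sub>0 cross_rhs j k x"
  unfolding ideq_def
  by (rule plinear_word_span[of "\<lambda>x. cross_lhs j k x - cross_rhs j k x", OF _ _ _ assms(1)])
     (use cross_lhs_word_eqv_rhs[OF _ assms(2,3)] in \<open>auto simp: ideq_def cross_lhs_def cross_rhs_def\<close>)

section \<open>The exchange of the two halves\<close>

primrec (in -) swap_gen :: "('i, 'p) gen \<Rightarrow> ('i, 'p) gen" where
  "swap_gen (Gq h) = Gq h"
| "swap_gen (Ge i l) = Gf i l"
| "swap_gen (Gf i l) = Ge i l"

text \<open>The antiautomorphism that exchanges \<open>e\<^sub>i\<^sub>l\<close> and \<open>f\<^sub>i\<^sub>l\<close> and fixes the torus.\<close>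

definition exch :: "('i, 'p) falg \<Rightarrow> ('i, 'p) falg" where
  "exch = anti_map swap_gen"

lemma plinear_exch [simp, intro]: "plinear exch"
  by (auto simp: exch_def)

lemmas exch_simps [simp] = plinear_simps[OF plinear_exch]

lemma exch_mult [simp]: "exch (x * y) = exch y * exch x" and exch_one [simp]: "exch 1 = 1"
  by (simp_all add: exch_def)

lemma exch_qexp [simp]: "exch (qexp h) = qexp h"
  by (simp add: exch_def qexp_def letter_mon)

lemma exch_e_gen [simp]: "exch (e_gen i l) = f_gen i l"
  and exch_f_gen [simp]: "exch (f_gen i l) = e_gen i l"
  by (simp_all add: exch_def e_gen_def f_gen_def letter_mon)

lemma exch_eE [simp]: "exch (eE x) = fE (flip x)"
proof (rule plinear_eq_on[of "\<lambda>x. exch (eE x)" "\<lambda>x. fE (flip x)"])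
  have "map swap_gen (map (\<lambda>(i, l). Ge i l) u) = map (\<lambda>(i, l). Gf i l) u" for u :: "('i \<times> nat) list"
    by (auto split: prod.splits)
  note * = this
  show "exch (eE (Poly_Mapping.single k 1)) = fE (flip (Poly_Mapping.single k 1))" for k
    by (simp add: single_free_mon exch_def eE_def fE_def rev_map * del: map_map)
qed (auto simp: exch_def)

lemma exch_fE [simp]: "exch (fE x) = eE (flip x)"
proof (rule plinear_eq_on[of "\<lambda>x. exch (fE x)" "\<lambda>x. eE (flip x)"])
  have "map swap_gen (map (\<lambda>(i, l). Gf i l) u) = map (\<lambda>(i, l). Ge i l) u" for u :: "('i \<times> nat) list"
    by (auto split: prod.splits)
  note * = this
  show "exch (fE (Poly_Mapping.single k 1)) = eE (flip (Poly_Mapping.single k 1))" for k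
    by (simp add: single_free_mon exch_def eE_def fE_def rev_map * del: map_map)
qed (auto simp: exch_def)

lemma exch_exch [simp]: "exch (exch x) = x"
proof (rule plinear_eq_on[of "\<lambda>x. exch (exch x)" "\<lambda>x. x"])
  have "swap_gen (swap_gen g) = g" for g :: "('i, 'p) gen"
    by (cases g) auto
  then show "exch (exch (Poly_Mapping.single k 1)) = Poly_Mapping.single k 1" for k
    by (simp add: single_free_mon exch_def rev_map comp_def)
qed (auto simp: exch_def)

lemma swap_gens: "swap_gen ` gens D \<subseteq> gens D"
  by (auto simp: gens_def)

lemma exch_W [simp, intro]: "x \<in> W \<Longrightarrow> exch x \<in> W"
  unfolding exch_def by (rule anti_map_word_span[OF _ swap_gens])

abbreviation I0 :: "('i, 'p) falg set" where
  "I0 \<equiv> ideal_span (gens D) (gens D) cross_relators"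

lemma exch_sym_drinfeld: "exch (sym_drinfeld i k l) = sym_drinfeld i l k"
  unfolding sym_drinfeld_def
  by (simp add: mult.assoc min.commute add.commute)

lemma exch_cross_relator: "r \<in> cross_relators \<Longrightarrow> exch r \<in> cross_relators"
proof (induction rule: cross_relators.induct)
  case (torus r)
  then have "exch r \<in> torus_relators"
  proof (induction rule: torus_relators.induct)
    case q_zero
    show ?case using torus_relators.q_zero by simp
  next
    case (q_add h h')
    then show ?case using torus_relators.q_add[of h' h] by (simp add: add.commute)
  next
    case (q_e h j l)
    then show ?case using torus_relators.q_f[of "\<lambda>x. - h x" j l] by (simp add: mult.assoc)
  next
    case (q_f h j l)
    then show ?case using torus_relators.q_e[of "\<lambda>x. - h x" j l] by (simp add: mult.assoc)
  qed
  then show ?case by (rule cross_relators.torus)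
next
  case (comm_e_f i k j l)
  then show ?case using cross_relators.comm_e_f[of j l i k] by simp
next
  case (drinfeld i k l)
  then show ?case by (simp add: exch_sym_drinfeld cross_relators.drinfeld)
qed

lemma exch_I0: "x \<in> I0 \<Longrightarrow> exch x \<in> I0"
  unfolding exch_def
  by (erule anti_map_ideal_span[OF swap_gens swap_gens, rotated])
     (auto simp: exch_def[symmetric] intro!: ideal_span_base exch_cross_relator)

section \<open>The defining ideal\<close>

lemma serre_relators_word_span:
  assumes "r \<in> serre_relators" shows "r \<in> word_span (I_infty D)"
  using assms unfolding serre_relators_def serre_sum_def
  by (auto intro!: word_span_closed word_span_mult word_span_power simp: real_I_infty)

lemma J_word_span: "x \<in> J \<Longrightarrow> x \<in> word_span (I_infty D)"
  unfolding J_def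
  by (erule plinear_ideal_span[of "\<lambda>x. x", rotated 3])
     (intro word_span_mult mon_in_word_span serre_relators_word_span plinear_intros subspace_word_span; assumption)+

lemma twist_J: "x \<in> J \<Longrightarrow> twist h x \<in> J"
  unfolding J_def
proof (erule plinear_ideal_span[of "twist h", rotated 3])
  fix u r v assume *: "set u \<subseteq> I_infty D" "r \<in> serre_relators" "set v \<subseteq> I_infty D"
  then obtain c where "twist h r = qq c *\<^sub>s r" by (blast elim: relator_homogeneous)
  moreover have "mon u * r * mon v \<in> ideal_span (I_infty D) (I_infty D) serre_relators"
    using * by (intro ideal_span_mult_left ideal_span_mult_right ideal_span_base) auto
  ultimately show "twist h (mon u * r * mon v) \<in> ideal_span (I_infty D) (I_infty D) serre_relators"
    by simp
qed auto

text \<open>The right ideal generated by the Serre elements of the negative half and the left ideal generated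
  by those of the positive half.\<close>

abbreviation JF :: "('i, 'p) falg set" where
  "JF \<equiv> ideal_span {} (gens D) (fE ` J)"

abbreviation JE :: "('i, 'p) falg set" where
  "JE \<equiv> ideal_span (gens D) {} (eE ` J)"

text \<open>The sum of two subspaces.\<close>

definition sum_set :: "('i, 'p) falg set \<Rightarrow> ('i, 'p) falg set \<Rightarrow> ('i, 'p) falg set" where
  "sum_set A B = {x + y |x y. x \<in> A \<and> y \<in> B}"

lemma subspace_sum_set [simp, intro]: "pm.subspace A \<Longrightarrow> pm.subspace B \<Longrightarrow> pm.subspace (sum_set A B)"
proof -
  assume A: "pm.subspace A" and B: "pm.subspace B"
  have "x + y + (x' + y') \<in> sum_set A B" if "x \<in> A" "y \<in> B" "x' \<in> A" "y' \<in> B" for x y x' y'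
  proof -
    have "x + y + (x' + y') = (x + x') + (y + y')"
      by (simp only: ac_simps)
    then show ?thesis
      unfolding sum_set_def
      using pm.subspace_add[OF A that(1,3)] pm.subspace_add[OF B that(2,4)] by blast
  qed
  moreover have "c *\<^sub>s (x + y) \<in> sum_set A B" if "x \<in> A" "y \<in> B" for x y c
    unfolding sum_set_def pm.scale_right_distrib
    using pm.subspace_scale[OF A that(1)] pm.subspace_scale[OF B that(2)] by blast
  moreover have "0 \<in> sum_set A B"
    unfolding sum_set_def using pm.subspace_0[OF A] pm.subspace_0[OF B] by force
  moreover have "\<exists>x y. z = x + y \<and> x \<in> A \<and> y \<in> B" if "z \<in> sum_set A B" for z
    using that by (auto simp: sum_set_def)
  ultimately show ?thesis
    unfolding pm.subspace_def by metis
qed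

lemma sum_setI1: "x \<in> A \<Longrightarrow> pm.subspace B \<Longrightarrow> x \<in> sum_set A B"
  unfolding sum_set_def using pm.subspace_0 by force

lemma sum_setI2: "y \<in> B \<Longrightarrow> pm.subspace A \<Longrightarrow> y \<in> sum_set A B"
  unfolding sum_set_def using pm.subspace_0 by force

abbreviation NF :: "('i, 'p) falg set" where "NF \<equiv> sum_set I0 JF"

lemma NF_I0: "x \<in> I0 \<Longrightarrow> x \<in> NF" and NF_JF: "x \<in> JF \<Longrightarrow> x \<in> NF"
  by (auto intro: sum_setI1 sum_setI2)

lemma subspace_NF: "pm.subspace NF"
  by (intro subspace_sum_set subspace_ideal_span)

lemmas NF_closed = pm.subspace_add[OF subspace_NF] pm.subspace_diff[OF subspace_NF]
  pm.subspace_scale[OF subspace_NF] pm.subspace_sum[OF subspace_NF]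

lemma NF_mult_right: "x \<in> NF \<Longrightarrow> y \<in> W \<Longrightarrow> x * y \<in> NF"
  unfolding sum_set_def using ideal_span_mult_right by (fastforce simp: distrib_right)

lemma NF_eqv: "x \<cong>\<^sub>0 y \<Longrightarrow> y \<in> NF \<Longrightarrow> x \<in> NF"
proof -
  assume "x \<cong>\<^sub>0 y" "y \<in> NF"
  then have "(x - y) + y \<in> NF"
    using pm.subspace_add[of NF "x - y" y] NF_I0 unfolding ideq_def by auto
  then show ?thesis by simp
qed

lemma JF_fE: "r \<in> J \<Longrightarrow> y \<in> W \<Longrightarrow> fE r * y \<in> JF"
  by (intro ideal_span_mult_right ideal_span_base) auto

text \<open>The image of the commutation rule under \<open>exch\<close> expresses \<open>e\<^sub>i\<^sub>l r\<close> through elements of \<open>JF\<close> and through terms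
  \<open>e\<^sub>i\<^sub>m K r'\<close> with \<open>m < l\<close>, where \<open>r'\<close> as \<open>r\<close> comes from \<open>J\<close>.\<close>

lemma e_gen_mult_J:
  assumes "r \<in> J" "l = 0 \<or> (i, l) \<in> I_infty D"
  shows "e_gen i l * fE r \<in> NF"
  using assms
proof (induction l arbitrary: r rule: less_induct)
  case (less l)
  have W1: "fE r \<in> W" if "r \<in> J" for r
    using that J_word_span by blast
  show ?case
  proof (cases "l = 0")
    case True
    then show ?thesis using JF_fE[of r 1] less by (simp add: NF_JF)
  next
    case False
    then have il: "(i, l) \<in> I_infty D" and i: "i \<in> index_set D" using less I_infty_index by auto
    have sub: "m = 0 \<or> (i, m) \<in> I_infty D" if "m \<le> l" for m
      using il that by (auto intro: I_infty_mono)
    define B where "B n = qq (- dd i * int n * int (l - n)) *\<^sub>s (e_gen i (l - n) * KK i (- int n) * fE (coskew i n r))" for n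
    define C where "C n = qq (- dd i * int n * int (l - n)) *\<^sub>s (fE (skew i n r) * KK i (int n) * e_gen i (l - n))" for n
    have "cross_lhs i l (flip r) \<cong>\<^sub>0 cross_rhs i l (flip r)"
      using less i by (intro cross_lhs_eqv_rhs) (auto intro: J_word_span)
    then have "exch (cross_lhs i l (flip r) - cross_rhs i l (flip r)) \<in> I0"
      unfolding ideq_def by (rule exch_I0)
    moreover have "exch (cross_lhs i l (flip r) - cross_rhs i l (flip r)) = (\<Sum>n\<le>l. B n) - (\<Sum>n\<le>l. C n)"
      by (simp add: cross_lhs_def cross_rhs_def B_def C_def mult.assoc coskew_def)
    ultimately have "(\<Sum>n\<le>l. B n) \<cong>\<^sub>0 (\<Sum>n\<le>l. C n)"
      by (simp add: ideq_def)
    moreover have "(\<Sum>n\<le>l. C n) \<in> NF"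
    proof (rule NF_closed(4))
      fix n assume n: "n \<in> {..l}"
      have "fE (skew i n r) * (KK i (int n) * e_gen i (l - n)) \<in> JF"
        using less n i sub[of n] sub[of "l - n"] by (intro JF_fE skew_J) auto
      then show "C n \<in> NF"
        unfolding C_def mult.assoc by (intro NF_closed(3) NF_JF)
    qed
    ultimately have BNF: "(\<Sum>n\<le>l. B n) \<in> NF"
      by (rule NF_eqv)
    have "(\<Sum>n\<in>{..l} - {0}. B n) \<in> NF"
    proof (rule NF_closed(4))
      fix n assume n: "n \<in> {..l} - {0}"
      let ?r = "coskew i n r"
      have r: "?r \<in> J" using less sub[of n] n by (intro coskew_J) auto
      have e: "e_gen i (l - n) \<in> W" "l - n = 0 \<or> (i, l - n) \<in> I_infty D"
        using sub[of "l - n"] by (auto simp del: diff_is_0_eq)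
      have "KK i (- int n) * fE ?r \<cong>\<^sub>0 fE (twist (\<lambda>x. - (- int n * \<kappa> i x)) ?r) * KK i (- int n)"
        using i r J_word_span by (intro torus_eqv qexp_fE) auto
      then have "e_gen i (l - n) * (KK i (- int n) * fE ?r)
        \<cong>\<^sub>0 e_gen i (l - n) * (fE (twist (\<lambda>x. - (- int n * \<kappa> i x)) ?r) * KK i (- int n))"
        using e by (intro ideq_mult_left)
      moreover have "e_gen i (l - n) * (fE (twist (\<lambda>x. - (- int n * \<kappa> i x)) ?r) * KK i (- int n)) \<in> NF"
        unfolding mult.assoc[symmetric] using n e i r by (intro NF_mult_right less.IH twist_J) auto
      ultimately have "e_gen i (l - n) * (KK i (- int n) * fE ?r) \<in> NF"
        by (rule NF_eqv)
      then show "B n \<in> NF"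
        unfolding B_def mult.assoc by (rule NF_closed(3))
    qed
    moreover have "(\<Sum>n\<le>l. B n) = B 0 + (\<Sum>n\<in>{..l} - {0}. B n)"
      by (rule sum.remove) auto
    ultimately have "B 0 \<in> NF"
      using NF_closed(2)[OF BNF, of "\<Sum>n\<in>{..l} - {0}. B n"] by simp
    moreover have "e_gen i l * KK i 0 * fE r \<cong>\<^sub>0 e_gen i l * 1 * fE r"
      using il less W1 by (intro ideq_mult_left ideq_mult_right torus_eqv KK_0) auto
    ultimately show ?thesis
      using NF_eqv[OF ideq_sym] by (simp add: B_def)
  qed
qed

lemma NF_mult_left: 
  assumes "x \<in> NF" "y \<in> W" shows "y * x \<in> NF"
proof -
  have gen: "mon [g] * fE r \<in> NF" if g: "g \<in> gens D" and "r \<in> J" for g r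
  proof -
    consider h where "g = Gq h" "h \<in> coweights" | i l where "g = Ge i l" "(i, l) \<in> I_infty D"
      | i l where "g = Gf i l" "(i, l) \<in> I_infty D"
      using g unfolding gens_def by blast
    then show ?thesis
    proof cases
      case 1
      have "qexp h * fE r \<cong>\<^sub>0 fE (twist (\<lambda>x. - h x) r) * qexp h"
        using 1 that J_word_span by (intro torus_eqv qexp_fE) auto
      moreover have "fE (twist (\<lambda>x. - h x) r) * qexp h \<in> NF"
        using 1 that by (intro NF_JF JF_fE twist_J) auto
      ultimately have "qexp h * fE r \<in> NF" by (rule NF_eqv)
      then show ?thesis using 1 by (simp add: qexp_def letter_mon)
    next
      case 2
      then show ?thesis
        using e_gen_mult_J[OF that(2), of l i] I_infty_pos by (force simp: e_gen_def letter_mon)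
    next
      case 3
      then have "fE (gen i l * r) * 1 \<in> NF"
        using that by (intro NF_JF JF_fE J_mult) auto
      then show ?thesis
        using 3 I_infty_pos by (force simp: f_gen_def letter_mon)
    qed
  qed
  have JF: "mon [g] * z \<in> NF" if g: "g \<in> gens D" and z: "z \<in> JF" for g z
  proof (rule plinear_ideal_span[of "\<lambda>z. mon [g] * z", OF _ _ _ z])
    fix u v :: "('i, 'p) gen list" and r assume *: "set u \<subseteq> {}" "r \<in> fE ` J" "set v \<subseteq> gens D"
    then obtain r' where r': "r = fE r'" "r' \<in> J" by auto
    have "mon [g] * fE r' * mon v \<in> NF"
      using * by (intro NF_mult_right gen[OF g r'(2)]) auto
    then show "mon [g] * (mon u * r * mon v) \<in> NF"
      using * r' by (simp add: mult.assoc)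
  qed auto
  have letter: "mon [g] * z \<in> NF" if g: "g \<in> gens D" and z: "z \<in> NF" for g z
  proof -
    obtain a b where z: "z = a + b" "a \<in> I0" "b \<in> JF"
      using z by (auto simp: sum_set_def)
    have "mon [g] * a \<in> I0"
      using g z by (intro ideal_span_mult_left) auto
    then show ?thesis
      using NF_closed(1)[OF NF_I0 JF[OF g z(3)]] z by (simp add: distrib_left)
  qed
  have word: "mon u * x \<in> NF" if "set u \<subseteq> gens D" for u
    using that
  proof (induction u)
    case (Cons g u)
    then have "mon [g] * (mon u * x) \<in> NF"
      by (intro letter) auto
    then show ?case
      by (simp only: mon_Cons[of g u] mult.assoc)
  qed (simp add: assms(1))
  show ?thesis
    by (rule plinear_word_span[of "\<lambda>y. y * x", OF _ _ _ assms(2)])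
       (auto simp: word subspace_NF)
qed

lemma exch_JE: "x \<in> JE \<Longrightarrow> exch x \<in> JF"
  unfolding exch_def
proof (erule anti_map_ideal_span[rotated 3])
  fix r assume "r \<in> eE ` J"
  then obtain r' where "r = eE r'" "r' \<in> J" by auto
  then have "exch r \<in> fE ` J"
    by (auto intro: flip_J)
  then show "anti_map swap_gen r \<in> JF"
    unfolding exch_def by (intro ideal_span_base)
qed (use swap_gens in auto)

lemma exch_JF: "x \<in> JF \<Longrightarrow> exch x \<in> JE"
  unfolding exch_def
proof (erule anti_map_ideal_span[rotated 3])
  fix r assume "r \<in> fE ` J"
  then obtain r' where "r = fE r'" "r' \<in> J" by auto
  then have "exch r \<in> eE ` J"
    by (auto intro: flip_J)
  then show "anti_map swap_gen r \<in> JE"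
    unfolding exch_def by (intro ideal_span_base)
qed (use swap_gens in auto)

lemma JE_mult_right:
  assumes "x \<in> JE" "y \<in> W" shows "x * y \<in> sum_set I0 JE"
proof -
  have "exch y * exch x \<in> NF"
    using assms by (intro NF_mult_left NF_JF exch_JE exch_W)
  then obtain a b where ab: "exch y * exch x = a + b" "a \<in> I0" "b \<in> JF"
    by (auto simp: sum_set_def)
  have "x * y = exch (exch y * exch x)"
    by simp
  also have "\<dots> = exch a + exch b"
    unfolding ab by simp
  finally show ?thesis
    using ab exch_I0 exch_JF unfolding sum_set_def by blast
qed

text \<open>The sum of the ideal of the cross relations, the right ideal \<open>JF\<close> and the left ideal \<open>JE\<close>. It will turn out to be
  the defining ideal.\<close>

abbreviation NN :: "('i, 'p) falg set" where "NN \<equiv> sum_set NF JE"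

lemma NN_mult_left:
  assumes "x \<in> NN" "y \<in> W" shows "y * x \<in> NN"
  using assms NF_mult_left ideal_span_mult_left[of _ "gens D" "{}" "eE ` J"]
  unfolding sum_set_def[of NF] by (force simp: distrib_left)

lemma NN_mult_right:
  assumes "x \<in> NN" "y \<in> W" shows "x * y \<in> NN"
proof -
  obtain a b where ab: "x = a + b" "a \<in> NF" "b \<in> JE"
    using assms by (auto simp: sum_set_def[of NF])
  obtain c d where cd: "b * y = c + d" "c \<in> I0" "d \<in> JE"
    using JE_mult_right[OF ab(3) assms(2)] by (auto simp: sum_set_def)
  have "a * y + c \<in> NF"
    using NF_mult_right[OF ab(2) assms(2)] NF_I0[OF cd(2)] by (rule NF_closed(1))
  then show ?thesis
    using cd unfolding sum_set_def[of NF] ab by (auto simp: distrib_right add.assoc[symmetric])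
qed

lemma serre_image:
  "eE (serre_sum D i N 0 (gen i 1) (gen j l)) = (\<Sum>k\<le>N. ((-1) ^ k * qbinom D i N k) *\<^sub>s (e_gen i 1 ^ (N - k) * e_gen j l * e_gen i 1 ^ k))"
  "fE (serre_sum D i N 0 (gen i 1) (gen j l)) = (\<Sum>k\<le>N. ((-1) ^ k * qbinom D i N k) *\<^sub>s (f_gen i 1 ^ (N - k) * f_gen j l * f_gen i 1 ^ k))"
  by (simp_all add: serre_sum_def)

lemma relators_split:
  assumes "r \<in> relators D \<tau>"
  shows "r \<in> I0 \<or> r \<in> fE ` serre_relators \<or> r \<in> eE ` serre_relators"
  using assms
proof cases
  case q_zero
  then show ?thesis by (auto intro!: ideal_span_base cross_relators.torus torus_relators.q_zero)
next
  case (q_add h h')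
  then show ?thesis by (auto intro!: ideal_span_base cross_relators.torus torus_relators.q_add)
next
  case (q_e h j l)
  then show ?thesis
    unfolding qq_def[symmetric] by (auto intro!: ideal_span_base cross_relators.torus torus_relators.q_e)
next
  case (q_f h j l)
  then show ?thesis
    unfolding qq_def[symmetric] by (auto intro!: ideal_span_base cross_relators.torus torus_relators.q_f)
next
  case (serre_e i j l n)
  then have "r = eE (serre_sum D i (nat (1 - int l * cartan D i j)) 0 (gen i 1) (gen j l))"
    unfolding serre_image by simp
  then show ?thesis using serre_e unfolding serre_relators_def by blast
next
  case (serre_f i j l n)
  then have "r = fE (serre_sum D i (nat (1 - int l * cartan D i j)) 0 (gen i 1) (gen j l))"
    unfolding serre_image by simp
  then show ?thesis using serre_f unfolding serre_relators_def by blast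
next
  case (comm_e i k j l)
  then have "r = eE (gen i k * gen j l - gen j l * gen i k)" by simp
  then show ?thesis using comm_e unfolding serre_relators_def by blast
next
  case (comm_f i k j l)
  then have "r = fE (gen i k * gen j l - gen j l * gen i k)" by simp
  then show ?thesis using comm_f unfolding serre_relators_def by blast
next
  case (comm_e_f i k j l)
  then show ?thesis by (auto intro!: ideal_span_base cross_relators.comm_e_f)
next
  case (drinfeld i k l)
  have "r \<cong>\<^sub>0 sym_drinfeld i k l"
    unfolding drinfeld using drinfeld by (intro torus_eqv sym_drinfeld_equiv)
  also have "\<dots> \<cong>\<^sub>0 0"
    using drinfeld by (intro ideq_relator) (simp add: cross_relators.drinfeld)
  finally show ?thesis by (simp add: ideq_def)
qed

text \<open>Since \<open>NN\<close> is a two-sided ideal, it follows that the defining ideal is contained in \<open>NN\<close>.\<close>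

lemma relators_subset_NN: "relators D \<tau> \<subseteq> NN"
proof
  fix r assume "r \<in> relators D \<tau>"
  then consider "r \<in> I0" | "r \<in> fE ` serre_relators" | "r \<in> eE ` serre_relators"
    using relators_split by blast
  then show "r \<in> NN"
  proof cases
    case 1
    then show ?thesis by (intro sum_setI1 NF_I0) auto
  next
    case 2
    then have "r \<in> fE ` J" unfolding J_def by (auto intro: ideal_span_base)
    then show ?thesis by (intro sum_setI1 NF_JF ideal_span_base) auto
  next
    case 3
    then have "r \<in> eE ` J" unfolding J_def by (auto intro: ideal_span_base)
    then show ?thesis by (intro sum_setI2 ideal_span_base) auto
  qed
qed

section \<open>The regular representation\<close>

type_synonym (in -) ('i, 'p) triv = "('i \<times> nat) free_mon \<times> ('p \<Rightarrow> int) \<times> ('i \<times> nat) free_mon \<Rightarrow>\<^sub>0 qfield"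

text \<open>The normal word consisting of the word \<open>w\<close> in the \<open>f\<^sub>i\<^sub>l\<close>, of \<open>q\<^sup>h\<close> and of the word \<open>z\<close> in the \<open>e\<^sub>i\<^sub>l\<close>. In the ring
  structure of the ambient type the three components multiply independently of each other; left multiplication by
  words in \<open>f\<close> and right multiplication by words in \<open>e\<close> are thus ring multiplications.\<close>

definition tri :: "('i \<times> nat) list \<Rightarrow> ('p \<Rightarrow> int) \<Rightarrow> ('i \<times> nat) list \<Rightarrow> ('i, 'p) triv" where
  "tri w h z = Poly_Mapping.single (Wd w, h, Wd z) 1"

lemma tri_mult: "tri w h z * tri w' h' z' = tri (w @ w') (\<lambda>x. h x + h' x) (z @ z')"
  by (simp add: tri_def mult_single plus_free_mon_def plus_fun_def)

lemma single_tri: "Poly_Mapping.single k 1 = tri (letters (fst k)) (fst (snd k)) (letters (snd (snd k)))"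
  by (simp add: tri_def)

lemma lin_ext_tri [simp]: "lin_ext f (tri w h z) = f (Wd w, h, Wd z)"
  by (simp add: tri_def)

lemma tri_one: "tri [] (\<lambda>_. 0) [] = 1"
proof -
  have "(Wd [], (\<lambda>_. 0), Wd []) = (0 :: ('i \<times> nat) free_mon \<times> ('p \<Rightarrow> int) \<times> ('i \<times> nat) free_mon)"
    by (simp add: zero_prod_def zero_free_mon_def zero_fun_def)
  then show ?thesis
    by (simp add: tri_def del: zero_fun_apply)
qed

text \<open>The operators by which \<open>q\<^sup>h\<close> and \<open>f\<^sub>i\<^sub>l\<close> act on normal words.\<close>

definition Qop :: "('p \<Rightarrow> int) \<Rightarrow> ('i, 'p) triv \<Rightarrow> ('i, 'p) triv" where
  "Qop h = lin_ext (\<lambda>(w, h', z). qq (- wt h (letters w)) *\<^sub>s Poly_Mapping.single (w, \<lambda>x. h x + h' x, z) 1)"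

definition Fop :: "'i \<Rightarrow> nat \<Rightarrow> ('i, 'p) triv \<Rightarrow> ('i, 'p) triv" where
  "Fop i l t = (if l = 0 then t else tri [(i, l)] (\<lambda>_. 0) [] * t)"

definition fword :: "'i \<Rightarrow> nat \<Rightarrow> ('i \<times> nat) list \<Rightarrow> ('i \<times> nat) list" where
  "fword i l w = (if l = 0 then w else (i, l) # w)"

lemma Qop_tri [simp]: "Qop h (tri w h' z) = qq (- wt h w) *\<^sub>s tri w (\<lambda>x. h x + h' x) z"
  by (simp add: Qop_def) (simp add: tri_def)

lemma plinear_Qop [simp, intro]: "plinear (Qop h)"
  and plinear_Qop' [simp, intro]: "plinear f \<Longrightarrow> plinear (\<lambda>x. Qop h (f x))"
  by (auto simp: Qop_def)

lemma plinear_Fop [simp, intro]: "plinear (Fop i l)"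
  and plinear_Fop' [simp, intro]: "plinear f \<Longrightarrow> plinear (\<lambda>x. Fop i l (f x))"
  unfolding Fop_def[abs_def] by (cases "l = 0"; simp)+

lemmas Qop_simps [simp] = plinear_simps[OF plinear_Qop]
lemmas Fop_simps [simp] = plinear_simps[OF plinear_Fop]

lemma tri_eqI:
  assumes "plinear f" "plinear g" "\<And>w h z. f (tri w h z) = g (tri w h z)"
  shows "f t = g t"
  by (rule plinear_eq_on[OF assms(1,2)]) (simp only: single_tri assms(3))

lemma Fop_tri [simp]: "Fop i l (tri w h z) = tri (fword i l w) h z"
  by (simp add: Fop_def fword_def tri_mult)

lemma Fop_0 [simp]: "Fop i 0 t = t"
  by (simp add: Fop_def)

lemma wt_fword [simp]: "wt h (fword i l w) = int l * h (simple_root D i) + wt h w"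
  by (simp add: fword_def)

lemma Qop_Qop: "Qop h (Qop h' t) = Qop (\<lambda>x. h x + h' x) t"
  by (rule tri_eqI[of "\<lambda>t. Qop h (Qop h' t)"]) (auto simp: wt_plus qq_add[symmetric] algebra_simps)

lemma wt_zero [simp]: "wt (\<lambda>_. 0) w = 0"
  by (induction w) auto

lemma Qop_0 [simp]: "Qop (\<lambda>_. 0) t = t"
  by (rule tri_eqI[of "Qop (\<lambda>_. 0)" "\<lambda>t. t"]) auto

lemma Qop_Fop: "Qop h (Fop i l t) = qq (- (int l * h (simple_root D i))) *\<^sub>s Fop i l (Qop h t)"
  by (rule tri_eqI[of "\<lambda>t. Qop h (Fop i l t)"]) (auto simp: qq_add[symmetric])

lemma Qop_right: "Qop h (t * tri [] (\<lambda>_. 0) z) = Qop h t * tri [] (\<lambda>_. 0) z"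
  by (rule tri_eqI[of "\<lambda>t. Qop h (t * tri [] (\<lambda>_. 0) z)"]) (auto simp: tri_mult)

lemma Fop_right: "Fop i l (t * s) = Fop i l t * s"
  by (simp add: Fop_def mult.assoc)

abbreviation dcoef :: "'i \<Rightarrow> nat \<Rightarrow> nat \<Rightarrow> nat \<Rightarrow> qfield" where
  "dcoef i k l n \<equiv> \<tau> i n * qq (- dd i * int n * (int k + int l - 2 * int n))"

text \<open>The action of \<open>e\<^sub>i\<^sub>l\<close> on a normal word: the relations between \<open>e\<close> and \<open>f\<close> move it past the first letter of the
  word \<open>w\<close>. In the symmetric relation the summand with \<open>n = 0\<close> is \<open>e\<^sub>i\<^sub>l f\<^sub>i\<^sub>k\<close>; the other summands with \<open>e\<close> on the left have
  a smaller \<open>l\<close> and a word that is not longer, which makes the recursion terminate.\<close>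

function Eb :: "'i \<Rightarrow> nat \<Rightarrow> ('i \<times> nat) list \<Rightarrow> ('p \<Rightarrow> int) \<Rightarrow> ('i \<times> nat) list \<Rightarrow> ('i, 'p) triv" where
  "Eb i l [] h z = (if l = 0 then tri [] h z
     else qq (- (int l * h (simple_root D i))) *\<^sub>s tri [] h ((i, l) # z))"
| "Eb i l ((j, k) # w) h z = (if l = 0 then tri ((j, k) # w) h z
     else if i \<noteq> j then Fop j k (Eb i l w h z)
     else (\<Sum>n\<le>min k l. dcoef i k l n *\<^sub>s Fop i (k - n) (Qop (\<lambda>x. int n * \<kappa> i x) (Eb i (l - n) w h z)))
       - (\<Sum>n\<in>{1..min k l}. (dcoef i k l n * qq (int n * wt (\<kappa> i) (fword i (k - n) w)))
           *\<^sub>s Eb i (l - n) (fword i (k - n) w) (\<lambda>x. h x - int n * \<kappa> i x) z))"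
  by pat_completeness auto
termination
  by (relation "measures [\<lambda>(i, l, w, h, z). length w, \<lambda>(i, l, w, h, z). l]")
     (auto simp: fword_def)

declare Eb.simps [simp del]

lemma Eb_0 [simp]: "Eb i 0 w h z = tri w h z"
  by (cases "(i, 0 :: nat, w, h, z)" rule: Eb.cases) (auto simp: Eb.simps)

lemma Eb_right: "Eb i l w h (z @ z') = Eb i l w h z * tri [] (\<lambda>_. 0) z'"
proof (induction i l w h z rule: Eb.induct)
  case (1 i l h z)
  then show ?case by (simp add: Eb.simps tri_mult)
next
  case (2 i l j k w h z)
  show ?case
  proof (cases "l = 0")
    case True
    then show ?thesis by (simp add: tri_mult)
  next
    case l: False
    show ?thesis
    proof (cases "i = j")
      case False
      then show ?thesis using 2(1) l by (simp add: Eb.simps Fop_right)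
    next
      case True
      have A: "Eb i (l - n) w h (z @ z') = Eb i (l - n) w h z * tri [] (\<lambda>_. 0) z'" if "n \<le> min k l" for n
        using 2(2)[of n] l True that by simp
      have B: "Eb i (l - n) (fword i (k - n) w) (\<lambda>x. h x - int n * \<kappa> i x) (z @ z')
         = Eb i (l - n) (fword i (k - n) w) (\<lambda>x. h x - int n * \<kappa> i x) z * tri [] (\<lambda>_. 0) z'"
        if "n \<in> {1..min k l}" for n
        using 2(3)[of n] l True that by simp
      have S1: "(\<Sum>n\<le>min k l. dcoef i k l n *\<^sub>s Fop i (k - n) (Qop (\<lambda>x. int n * \<kappa> i x) (Eb i (l - n) w h (z @ z'))))
        = (\<Sum>n\<le>min k l. dcoef i k l n *\<^sub>s Fop i (k - n) (Qop (\<lambda>x. int n * \<kappa> i x) (Eb i (l - n) w h z))) * tri [] (\<lambda>_. 0) z'"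
        unfolding sum_distrib_right
        by (rule sum.cong[OF refl], subst A) (simp_all add: Fop_right Qop_right)
      have S2: "(\<Sum>n\<in>{1..min k l}. (dcoef i k l n * qq (int n * wt (\<kappa> i) (fword i (k - n) w)))
           *\<^sub>s Eb i (l - n) (fword i (k - n) w) (\<lambda>x. h x - int n * \<kappa> i x) (z @ z'))
        = (\<Sum>n\<in>{1..min k l}. (dcoef i k l n * qq (int n * wt (\<kappa> i) (fword i (k - n) w)))
           *\<^sub>s Eb i (l - n) (fword i (k - n) w) (\<lambda>x. h x - int n * \<kappa> i x) z) * tri [] (\<lambda>_. 0) z'"
        unfolding sum_distrib_right
        by (rule sum.cong[OF refl], subst B) simp_all
      show ?thesis
        using l by (simp only: Eb.simps True[symmetric] S1 S2 left_diff_distrib if_False not_True_eq_False simp_thms)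
    qed
  qed
qed

text \<open>The operators satisfy the relation between \<open>q\<^sup>h\<close> and \<open>e\<^sub>i\<^sub>l\<close>.\<close>

lemma Qop_Eb: "Qop h' (Eb i l w h z)
  = qq (int l * h' (simple_root D i) - wt h' w) *\<^sub>s Eb i l w (\<lambda>x. h' x + h x) z"
proof (induction i l w h z rule: Eb.induct)
  case (1 i l h z)
  then show ?case by (simp add: Eb.simps qq_add[symmetric] algebra_simps wt_def)
next
  case (2 i l j k w h z)
  show ?case
  proof (cases "l = 0")
    case True
    then show ?thesis by simp
  next
    case l: False
    show ?thesis
    proof (cases "i = j")
      case False
      then show ?thesis using 2(1) l
        by (simp add: Eb.simps Qop_Fop qq_add[symmetric] algebra_simps)
    next
      case True
      let ?e = "int l * h' (simple_root D i) - wt h' ((j, k) # w)"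
      have S1: "Qop h' (dcoef i k l n *\<^sub>s Fop i (k - n) (Qop (\<lambda>x. int n * \<kappa> i x) (Eb i (l - n) w h z)))
        = qq ?e *\<^sub>s (dcoef i k l n *\<^sub>s Fop i (k - n) (Qop (\<lambda>x. int n * \<kappa> i x) (Eb i (l - n) w (\<lambda>x. h' x + h x) z)))"
        if n: "n \<le> min k l" for n
      proof -
        have A: "Qop h' (Eb i (l - n) w h z)
            = qq (int (l - n) * h' (simple_root D i) - wt h' w) *\<^sub>s Eb i (l - n) w (\<lambda>x. h' x + h x) z"
          using 2(2)[of n] l True n by simp
        have B: "Qop h' (Qop (\<lambda>x. int n * \<kappa> i x) t) = Qop (\<lambda>x. int n * \<kappa> i x) (Qop h' t)" for t
          by (simp add: Qop_Qop add.commute)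
        have C: "qq (- (int (k - n) * h' (simple_root D i))) * qq (int (l - n) * h' (simple_root D i) - wt h' w) = qq ?e"
          using n True by (simp add: qq_add[symmetric] of_nat_diff algebra_simps)
        show ?thesis
          unfolding Qop_simps Qop_Fop B A Fop_simps pm.scale_scale C[symmetric] by (simp add: mult_ac)
      qed
      have S2: "Qop h' (c *\<^sub>s Eb i (l - n) (fword i (k - n) w) (\<lambda>x. h x - int n * \<kappa> i x) z)
        = qq ?e *\<^sub>s (c *\<^sub>s Eb i (l - n) (fword i (k - n) w) (\<lambda>x. (h' x + h x) - int n * \<kappa> i x) z)"
        if n: "n \<in> {1..min k l}" for n c
      proof -
        have A: "Qop h' (Eb i (l - n) (fword i (k - n) w) (\<lambda>x. h x - int n * \<kappa> i x) z)
            = qq (int (l - n) * h' (simple_root D i) - wt h' (fword i (k - n) w))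
              *\<^sub>s Eb i (l - n) (fword i (k - n) w) (\<lambda>x. (h' x + h x) - int n * \<kappa> i x) z"
          using 2(3)[of n] l True n by (simp add: add_diff_eq)
        have C: "int (l - n) * h' (simple_root D i) - wt h' (fword i (k - n) w) = ?e"
          using n True by (simp add: of_nat_diff algebra_simps)
        show ?thesis
          unfolding Qop_simps A C by (simp add: mult_ac)
      qed
      have T1: "Qop h' (\<Sum>n\<le>min k l. dcoef i k l n *\<^sub>s Fop i (k - n) (Qop (\<lambda>x. int n * \<kappa> i x) (Eb i (l - n) w h z)))
        = qq ?e *\<^sub>s (\<Sum>n\<le>min k l. dcoef i k l n *\<^sub>s Fop i (k - n) (Qop (\<lambda>x. int n * \<kappa> i x) (Eb i (l - n) w (\<lambda>x. h' x + h x) z)))"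
        unfolding plinear_simps(4)[OF plinear_Qop] pm.scale_sum_right
        by (rule sum.cong[OF refl], rule S1) simp
      have T2: "Qop h' (\<Sum>n\<in>{1..min k l}. (dcoef i k l n * qq (int n * wt (\<kappa> i) (fword i (k - n) w)))
           *\<^sub>s Eb i (l - n) (fword i (k - n) w) (\<lambda>x. h x - int n * \<kappa> i x) z)
        = qq ?e *\<^sub>s (\<Sum>n\<in>{1..min k l}. (dcoef i k l n * qq (int n * wt (\<kappa> i) (fword i (k - n) w)))
           *\<^sub>s Eb i (l - n) (fword i (k - n) w) (\<lambda>x. (h' x + h x) - int n * \<kappa> i x) z)"
        unfolding plinear_simps(4)[OF plinear_Qop] pm.scale_sum_right
        by (rule sum.cong[OF refl], rule S2) simp
      have L: "Eb i l ((j, k) # w) g z = (\<Sum>n\<le>min k l. dcoef i k l n *\<^sub>s Fop i (k - n) (Qop (\<lambda>x. int n * \<kappa> i x) (Eb i (l - n) w g z)))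
       - (\<Sum>n\<in>{1..min k l}. (dcoef i k l n * qq (int n * wt (\<kappa> i) (fword i (k - n) w)))
           *\<^sub>s Eb i (l - n) (fword i (k - n) w) (\<lambda>x. g x - int n * \<kappa> i x) z)" for g
        using l True by (simp only: Eb.simps if_False not_True_eq_False simp_thms)
      show ?thesis
        unfolding L plinear_simps(3)[OF plinear_Qop] T1 T2 pm.scale_right_diff_distrib ..
    qed
  qed
qed

definition Eop :: "'i \<Rightarrow> nat \<Rightarrow> ('i, 'p) triv \<Rightarrow> ('i, 'p) triv" where
  "Eop i l = lin_ext (\<lambda>(w, h, z). Eb i l (letters w) h (letters z))"

lemma Eop_tri [simp]: "Eop i l (tri w h z) = Eb i l w h z"
  by (simp add: Eop_def)

lemma plinear_Eop [simp, intro]: "plinear (Eop i l)"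
  and plinear_Eop' [simp, intro]: "plinear f \<Longrightarrow> plinear (\<lambda>x. Eop i l (f x))"
  by (auto simp: Eop_def)

lemmas Eop_simps [simp] = plinear_simps[OF plinear_Eop]

lemma Eop_0 [simp]: "Eop i 0 t = t"
  by (rule tri_eqI[of "Eop i 0" "\<lambda>t. t"]) auto

lemma Eop_right: "Eop i l (t * tri [] (\<lambda>_. 0) z) = Eop i l t * tri [] (\<lambda>_. 0) z"
  by (rule tri_eqI[of "\<lambda>t. Eop i l (t * tri [] (\<lambda>_. 0) z)"]) (auto simp: tri_mult Eb_right)

lemma Qop_Eop: "Qop h (Eop i l t) = qq (int l * h (simple_root D i)) *\<^sub>s Eop i l (Qop h t)"
  by (rule tri_eqI[of "\<lambda>t. Qop h (Eop i l t)"]) (auto simp: Qop_Eb qq_add[symmetric])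

lemma Eop_Fop_comm: "i \<noteq> j \<Longrightarrow> Eop i l (Fop j k t) = Fop j k (Eop i l t)"
  by (rule tri_eqI[of "\<lambda>t. Eop i l (Fop j k t)"]) (auto simp: fword_def Eb.simps)

lemma Eop_Fop_drinfeld:
  assumes "i \<in> index_set D" "k > 0" "l > 0"
  shows "(\<Sum>n\<le>min k l. dcoef i k l n *\<^sub>s Eop i (l - n) (Qop (\<lambda>x. - int n * \<kappa> i x) (Fop i (k - n) t)))
    = (\<Sum>n\<le>min k l. dcoef i k l n *\<^sub>s Fop i (k - n) (Qop (\<lambda>x. int n * \<kappa> i x) (Eop i (l - n) t)))"
proof (rule tri_eqI[where t = t])
  fix w h z
  let ?s = "\<lambda>n. dcoef i k l n *\<^sub>s Eop i (l - n) (Qop (\<lambda>x. - int n * \<kappa> i x) (Fop i (k - n) (tri w h z)))"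
  have s: "?s n = (dcoef i k l n * qq (int n * wt (\<kappa> i) (fword i (k - n) w)))
           *\<^sub>s Eb i (l - n) (fword i (k - n) w) (\<lambda>x. h x - int n * \<kappa> i x) z" for n
  proof -
    have "(\<lambda>x. - int n * \<kappa> i x + h x) = (\<lambda>x. h x - int n * \<kappa> i x)"
      by auto
    moreover have "- wt (\<lambda>x. - int n * \<kappa> i x) (fword i (k - n) w) = int n * wt (\<kappa> i) (fword i (k - n) w)"
      unfolding wt_scale by simp
    ultimately show ?thesis
      by (simp only: Fop_tri Qop_tri Eop_simps Eop_tri pm.scale_scale)
  qed
  have "{..min k l} = insert 0 {1..min k l}"
    by auto
  then have "(\<Sum>n\<le>min k l. ?s n) = ?s 0 + (\<Sum>n\<in>{1..min k l}. ?s n)"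
    by (simp only: sum.insert finite_atLeastAtMost) simp
  also have "?s 0 = Eb i l ((i, k) # w) h z"
    using assms tau_0 by (simp add: fword_def)
  finally show "(\<Sum>n\<le>min k l. ?s n)
    = (\<Sum>n\<le>min k l. dcoef i k l n *\<^sub>s Fop i (k - n) (Qop (\<lambda>x. int n * \<kappa> i x) (Eop i (l - n) (tri w h z))))"
    unfolding s Eop_tri using assms(3) by (simp only: Eb.simps) simp
qed (auto intro!: plinear_intros)

subsection \<open>The action of the free algebra\<close>

primrec letter_op :: "('i, 'p) gen \<Rightarrow> ('i, 'p) triv \<Rightarrow> ('i, 'p) triv" where
  "letter_op (Gq h) = Qop h"
| "letter_op (Ge i l) = Eop i l"
| "letter_op (Gf i l) = Fop i l"

lemma plinear_letter_op [simp, intro]: "plinear (letter_op g)"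
  by (cases g) auto

text \<open>The free algebra acts through the operators assigned to the letters.\<close>

definition act_word :: "('i, 'p) gen list \<Rightarrow> ('i, 'p) triv \<Rightarrow> ('i, 'p) triv" where
  "act_word u t = foldr letter_op u t"

lemma act_word_simps [simp]: "act_word [] t = t" "act_word (g # u) t = letter_op g (act_word u t)"
  "act_word (u @ v) t = act_word u (act_word v t)"
  by (simp_all add: act_word_def)

lemma plinear_act_word [simp, intro]: "plinear (act_word u)"
proof (induction u)
  case (Cons g u)
  have "plinear (\<lambda>t. letter_op g (act_word u t))"
    by (rule plinear_compose) (auto simp: Cons)
  then show ?case by (simp add: act_word_def[abs_def])
qed (simp add: act_word_def[abs_def])

definition act :: "('i, 'p) falg \<Rightarrow> ('i, 'p) triv \<Rightarrow> ('i, 'p) triv" where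
  "act x t = lin_ext (\<lambda>u. act_word (letters u) t) x"

lemma act_mon [simp]: "act (mon u) t = act_word u t"
  by (simp add: act_def)

lemma plinear_act_left [simp, intro]: "plinear (\<lambda>x. act x t)"
  by (simp add: act_def)

lemma plinear_act_right [simp, intro]: "plinear (act x)"
  unfolding act_def[abs_def] lin_ext_def by (intro plinear_intros plinear_act_word)

lemmas act_left_simps [simp] = plinear_simps[OF plinear_act_left]
lemmas act_right_simps [simp] = plinear_simps[OF plinear_act_right]

lemma act_mult [simp]: "act (x * y) t = act x (act y t)"
proof (rule free_bilinear_eqI[where f = "\<lambda>x y. act (x * y) t" and g = "\<lambda>x y. act x (act y t)"])
  show "plinear (\<lambda>y. act x (act y t))" for x
    by (rule plinear_compose) auto
  show "plinear (\<lambda>y. act (x * y) t)" "plinear (\<lambda>x. act (x * y) t)" for x y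
    by (auto simp: act_def)
qed (auto simp: mon_append[symmetric])

lemma act_one [simp]: "act 1 t = t"
  using act_mon[of "[]" t] by (simp del: act_mon)

lemma act_gens [simp]:
  "act (qexp h) t = Qop h t" "act (e_gen i l) t = Eop i l t" "act (f_gen i l) t = Fop i l t"
  by (simp_all add: qexp_def e_gen_def f_gen_def letter_mon)

text \<open>The cross relations hold in the representation; \<open>act\<close> therefore factors through the algebra \<open>U'\<close> of cross relations.\<close>

lemma act_cross_relator: "r \<in> cross_relators \<Longrightarrow> act r t = 0"
proof (induction rule: cross_relators.induct)
  case (torus r)
  then show ?case
  proof (induction rule: torus_relators.induct)
    case (q_e h j l)
    then show ?case by (simp add: Qop_Eop Qop_Qop)
  next
    case (q_f h j l)
    then show ?case by (simp add: Qop_Fop Qop_Qop)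
  qed (simp_all add: Qop_Qop)
next
  case (comm_e_f i k j l)
  then show ?case by (simp add: Eop_Fop_comm)
next
  case (drinfeld i k l)
  have "act (sym_drinfeld i k l) t
    = (\<Sum>n\<le>min k l. dcoef i k l n *\<^sub>s Eop i (l - n) (Qop (\<lambda>x. - int n * \<kappa> i x) (Fop i (k - n) t)))
    - (\<Sum>n\<le>min k l. dcoef i k l n *\<^sub>s Fop i (k - n) (Qop (\<lambda>x. int n * \<kappa> i x) (Eop i (l - n) t)))"
    unfolding sym_drinfeld_def act_left_simps act_mult act_gens pm.scale_right_diff_distrib
    by (simp only: sum_subtractf)
  then show ?case
    using Eop_Fop_drinfeld[of i k l t] drinfeld I_infty_index I_infty_pos by auto
qed

lemma act_I0:
  assumes "x \<in> I0" shows "act x t = 0"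
proof -
  have "act x t \<in> {0}"
    by (rule plinear_ideal_span[OF plinear_act_left _ _ assms]) (auto simp: act_cross_relator)
  then show ?thesis by simp
qed

section \<open>Normal forms\<close>

lemma plinear_act_left' [simp, intro]: "plinear f \<Longrightarrow> plinear (\<lambda>x. act (f x) t)"
  by (rule plinear_compose[OF plinear_act_left])

text \<open>The span of the normal words with letters in \<open>I\<^sup>\<infinity>\<close> and coweights \<open>h\<close>.\<close>

definition TG :: "('i, 'p) triv set" where
  "TG = pm.span {tri w h z |w h z. set w \<subseteq> I_infty D \<and> h \<in> coweights \<and> set z \<subseteq> I_infty D}"

lemma subspace_TG [simp, intro]: "pm.subspace TG"
  by (simp add: TG_def)

lemmas TG_closed = pm.subspace_add[OF subspace_TG] pm.subspace_diff[OF subspace_TG]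
  pm.subspace_scale[OF subspace_TG] pm.subspace_sum[OF subspace_TG]

lemma tri_TG [intro]: "set w \<subseteq> I_infty D \<Longrightarrow> h \<in> coweights \<Longrightarrow> set z \<subseteq> I_infty D \<Longrightarrow> tri w h z \<in> TG"
  unfolding TG_def by (intro pm.span_base) blast

lemma plinear_TG:
  assumes "t \<in> TG" "plinear f" "pm.subspace V"
    and "\<And>w h z. set w \<subseteq> I_infty D \<Longrightarrow> h \<in> coweights \<Longrightarrow> set z \<subseteq> I_infty D \<Longrightarrow> f (tri w h z) \<in> V"
  shows "f t \<in> V"
  by (rule plinear_image_span_subset[OF assms(2) _ assms(3) assms(1)[unfolded TG_def]]) (use assms(4) in auto)

lemma fword_I_infty: "set w \<subseteq> I_infty D \<Longrightarrow> l = 0 \<or> (i, l) \<in> I_infty D \<Longrightarrow> set (fword i l w) \<subseteq> I_infty D"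
  by (auto simp: fword_def)

lemma Fop_TG: "t \<in> TG \<Longrightarrow> l = 0 \<or> (i, l) \<in> I_infty D \<Longrightarrow> Fop i l t \<in> TG"
  by (erule plinear_TG) (auto intro!: tri_TG simp: fword_def)

lemma Qop_TG: "t \<in> TG \<Longrightarrow> h \<in> coweights \<Longrightarrow> Qop h t \<in> TG"
  by (erule plinear_TG) (auto intro!: tri_TG TG_closed)

lemma coweights_diff: "h \<in> coweights \<Longrightarrow> h' \<in> coweights \<Longrightarrow> (\<lambda>x. h x - h' x) \<in> coweights"
  using coweights_plus[OF _ coweights_minus, of h h'] by simp

lemma Eb_TG:
  assumes "l = 0 \<or> (i, l) \<in> I_infty D" "set w \<subseteq> I_infty D" "h \<in> coweights" "set z \<subseteq> I_infty D"
  shows "Eb i l w h z \<in> TG"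
  using assms
proof (induction i l w h z rule: Eb.induct)
  case (1 i l h z)
  then show ?case by (auto simp: Eb.simps intro!: TG_closed tri_TG)
next
  case (2 i l j k w h z)
  show ?case
  proof (cases "l = 0")
    case True
    then show ?thesis using 2 by (auto intro!: tri_TG)
  next
    case l: False
    show ?thesis
    proof (cases "i = j")
      case False
      then show ?thesis using 2 l by (simp add: Eb.simps Fop_TG)
    next
      case True
      have i: "i \<in> index_set D"
        using 2 l I_infty_index by auto
      have sub: "k - n = 0 \<or> (i, k - n) \<in> I_infty D" "l - n = 0 \<or> (i, l - n) \<in> I_infty D" for n
        using 2 l True by (auto intro: I_infty_mono)
      have "Eb i (l - n) w h z \<in> TG" if "n \<le> min k l" for n
        using 2(2)[of n] l True that sub(2)[of n] 2 by simp
      moreover have "Eb i (l - n) (fword i (k - n) w) (\<lambda>x. h x - int n * \<kappa> i x) z \<in> TG"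
        if "n \<in> {1..min k l}" for n
        using 2(3)[of n] l True that sub[of n] 2 i fword_I_infty[of w "k - n" i]
        by (simp add: coweights_diff del: diff_is_0_eq)
      ultimately show ?thesis
        using l i sub unfolding Eb.simps True[symmetric]
        by (auto intro!: TG_closed Fop_TG Qop_TG simp del: diff_is_0_eq)
    qed
  qed
qed

lemma Eop_TG: "t \<in> TG \<Longrightarrow> l = 0 \<or> (i, l) \<in> I_infty D \<Longrightarrow> Eop i l t \<in> TG"
  by (erule plinear_TG) (auto intro!: Eb_TG)

lemma letter_op_TG: "g \<in> gens D \<Longrightarrow> t \<in> TG \<Longrightarrow> letter_op g t \<in> TG"
  by (auto simp: gens_def Qop_TG Fop_TG Eop_TG)

lemma act_word_TG: "set u \<subseteq> gens D \<Longrightarrow> t \<in> TG \<Longrightarrow> act_word u t \<in> TG"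
  by (induction u) (auto intro: letter_op_TG)

lemma act_TG: "x \<in> W \<Longrightarrow> t \<in> TG \<Longrightarrow> act x t \<in> TG"
  by (rule plinear_word_span[OF plinear_act_left]) (auto intro: act_word_TG)

text \<open>The product that a normal word stands for.\<close>

definition realize :: "('i, 'p) triv \<Rightarrow> ('i, 'p) falg" where
  "realize = lin_ext (\<lambda>(w, h, z). fE (mon (letters w)) * qexp h * eE (mon (letters z)))"

lemma realize_tri [simp]: "realize (tri w h z) = fE (mon w) * qexp h * eE (mon z)"
  by (simp add: realize_def)

lemma plinear_realize [simp, intro]: "plinear realize"
  and plinear_realize' [simp, intro]: "plinear f \<Longrightarrow> plinear (\<lambda>x. realize (f x))"
  by (auto simp: realize_def)

lemmas realize_simps [simp] = plinear_simps[OF plinear_realize]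

lemma realize_W: "t \<in> TG \<Longrightarrow> realize t \<in> W"
  by (erule plinear_TG) (auto intro!: word_span_mult)

lemma realize_Fop: "realize (Fop i l t) = f_gen i l * realize t"
proof (rule tri_eqI[of "\<lambda>t. realize (Fop i l t)" "\<lambda>t. f_gen i l * realize t"])
  show "realize (Fop i l (tri w h z)) = f_gen i l * realize (tri w h z)" for w h z
    by (cases "l = 0") (auto simp: fword_def mon_Cons_gen mult.assoc)
qed auto

lemma eqv_TG:
  assumes "t \<in> TG" "plinear f" "plinear g"
    and "\<And>w h z. set w \<subseteq> I_infty D \<Longrightarrow> h \<in> coweights \<Longrightarrow> set z \<subseteq> I_infty D \<Longrightarrow> f (tri w h z) \<cong>\<^sub>0 g (tri w h z)"
  shows "f t \<cong>\<^sub>0 g t"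
  unfolding ideq_def
  by (rule plinear_TG[OF assms(1), of "\<lambda>t. f t - g t"]) (use assms in \<open>auto simp: ideq_def\<close>)

lemma realize_Qop:
  assumes "t \<in> TG" "h \<in> coweights"
  shows "realize (Qop h t) \<cong>\<^sub>0 qexp h * realize t"
proof (rule eqv_TG[OF assms(1), of "\<lambda>t. realize (Qop h t)" "\<lambda>t. qexp h * realize t"])
  fix w z and h' :: "'p \<Rightarrow> int" assume *: "set w \<subseteq> I_infty D" "h' \<in> coweights" "set z \<subseteq> I_infty D"
  have "qexp h * fE (mon w) * (qexp h' * eE (mon z)) \<cong>\<^sub>0 fE (twist (\<lambda>x. - h x) (mon w)) * qexp h * (qexp h' * eE (mon z))"
    using * assms by (intro ideq_mult_right torus_eqv qexp_fE_word) auto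
  also have "\<dots> = qq (- wt h w) *\<^sub>s (fE (mon w) * (qexp h * qexp h') * eE (mon z))"
    by (simp add: wt_minus mult.assoc)
  also have "\<dots> \<cong>\<^sub>0 qq (- wt h w) *\<^sub>s (fE (mon w) * qexp (\<lambda>x. h x + h' x) * eE (mon z))"
    using * assms by (intro ideq_scale ideq_mult_right ideq_mult_left torus_eqv qexp_add) auto
  finally show "realize (Qop h (tri w h' z)) \<cong>\<^sub>0 qexp h * realize (tri w h' z)"
    using ideq_sym by (simp add: mult.assoc)
qed auto

lemma ideq_diff: "ideq S x y \<Longrightarrow> ideq S x' y' \<Longrightarrow> ideq S (x - x') (y - y')"
  using ideq_add[of S x y "- x'" "- y'"] ideq_scale[of S x' y' "- 1"] by simp

text \<open>Modulo the cross relations the operator reproduces left multiplication by \<open>e\<^sub>i\<^sub>l\<close>.\<close>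

lemma realize_Eb:
  assumes "l = 0 \<or> (i, l) \<in> I_infty D" "set w \<subseteq> I_infty D" "h \<in> coweights" "set z \<subseteq> I_infty D"
  shows "realize (Eb i l w h z) \<cong>\<^sub>0 e_gen i l * realize (tri w h z)"
  using assms
proof (induction i l w h z rule: Eb.induct)
  case (1 i l h z)
  show ?case
  proof (cases "l = 0")
    case False
    then have il: "(i, l) \<in> I_infty D" using 1 by auto
    have "qexp h * e_gen i l * eE (mon z) \<cong>\<^sub>0 qq (int l * h (simple_root D i)) *\<^sub>s (e_gen i l * qexp h) * eE (mon z)"
      using 1 by (intro ideq_mult_right torus_eqv qexp_e) auto
    from ideq_scale[OF this, of "qq (- (int l * h (simple_root D i)))"]
    show ?thesis
      using False by (simp add: Eb.simps mon_Cons_gen mult.assoc qq_add[symmetric])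
  qed simp
next
  case (2 i l j k w h z)
  show ?case
  proof (cases "l = 0")
    case True
    then show ?thesis by simp
  next
    case l: False
    have il: "(i, l) \<in> I_infty D" and jk: "(j, k) \<in> I_infty D" and k: "k > 0" and w: "set w \<subseteq> I_infty D"
      using 2 l I_infty_pos by auto
    have triw: "realize (tri w h z) \<in> W"
      using 2 by (intro realize_W tri_TG) auto
    have jkw: "realize (tri ((j, k) # w) h z) = f_gen j k * realize (tri w h z)"
      using k realize_Fop[of j k "tri w h z"] by (simp add: fword_def)
    show ?thesis
    proof (cases "i = j")
      case False
      have IH: "realize (Eb i l w h z) \<cong>\<^sub>0 e_gen i l * realize (tri w h z)"
        using 2 l False by simp
      have "realize (Eb i l ((j, k) # w) h z) = f_gen j k * realize (Eb i l w h z)"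
        using l False by (simp add: Eb.simps realize_Fop)
      also have "\<dots> \<cong>\<^sub>0 f_gen j k * (e_gen i l * realize (tri w h z))"
        using jk IH by (intro ideq_mult_left) auto
      also have "f_gen j k * (e_gen i l * realize (tri w h z)) = (f_gen j k * e_gen i l) * realize (tri w h z)"
        by (simp add: mult.assoc)
      also have "\<dots> \<cong>\<^sub>0 (e_gen i l * f_gen j k) * realize (tri w h z)"
        using il jk False triw
        by (intro ideq_mult_right ideq_sym[OF ideq_relator] cross_relators.comm_e_f) auto
      finally show ?thesis
        unfolding jkw by (simp add: mult.assoc)
    next
      case True
      have i: "i \<in> index_set D"
        using il I_infty_index by auto
      have ik: "(i, k) \<in> I_infty D" using jk True by simp
      have sub: "k - n = 0 \<or> (i, k - n) \<in> I_infty D" "l - n = 0 \<or> (i, l - n) \<in> I_infty D" for n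
        using ik il by (auto intro: I_infty_mono)
      have eW: "e_gen i (l - n) \<in> W" and fW: "f_gen i (k - n) \<in> W" for n
        using sub by blast+
      define Y where "Y = realize (tri w h z)"
      have YW: "Y \<in> W" using triw by (simp add: Y_def)
      define P where "P n = e_gen i (l - n) * KK i (- int n) * f_gen i (k - n) * Y" for n
      define R where "R n = f_gen i (k - n) * KK i (int n) * e_gen i (l - n) * Y" for n
      have S1: "realize (Fop i (k - n) (Qop (\<lambda>x. int n * \<kappa> i x) (Eb i (l - n) w h z))) \<cong>\<^sub>0 R n"
        if n: "n \<le> min k l" for n
      proof -
        have IH: "realize (Eb i (l - n) w h z) \<cong>\<^sub>0 e_gen i (l - n) * Y"
          using 2(2)[of n] l True n sub(2)[of n] 2 by (simp add: Y_def)
        have "Eb i (l - n) w h z \<in> TG"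
          using 2 w sub by (intro Eb_TG) auto
        then have "realize (Qop (\<lambda>x. int n * \<kappa> i x) (Eb i (l - n) w h z)) \<cong>\<^sub>0 KK i (int n) * realize (Eb i (l - n) w h z)"
          using i by (intro realize_Qop) auto
        also have "\<dots> \<cong>\<^sub>0 KK i (int n) * (e_gen i (l - n) * Y)"
          using i IH by (intro ideq_mult_left) auto
        finally show ?thesis
          unfolding realize_Fop R_def mult.assoc by (rule ideq_mult_left[OF _ fW])
      qed
      have S2: "realize (qq (int n * wt (\<kappa> i) (fword i (k - n) w)) *\<^sub>s Eb i (l - n) (fword i (k - n) w) (\<lambda>x. h x - int n * \<kappa> i x) z) \<cong>\<^sub>0 P n"
        if n: "n \<in> {1..min k l}" for n
      proof -
        let ?c = "qq (int n * wt (\<kappa> i) (fword i (k - n) w))"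
        let ?t = "tri (fword i (k - n) w) (\<lambda>x. h x - int n * \<kappa> i x) z"
        have fw: "set (fword i (k - n) w) \<subseteq> I_infty D"
          using w sub by (intro fword_I_infty) auto
        have "realize (Eb i (l - n) (fword i (k - n) w) (\<lambda>x. h x - int n * \<kappa> i x) z) \<cong>\<^sub>0 e_gen i (l - n) * realize ?t"
          using 2(3)[of n] l True n sub(2)[of n] 2 i fw by (simp add: coweights_diff)
        then have 1: "realize (?c *\<^sub>s Eb i (l - n) (fword i (k - n) w) (\<lambda>x. h x - int n * \<kappa> i x) z)
            \<cong>\<^sub>0 e_gen i (l - n) * realize (?c *\<^sub>s ?t)"
          using ideq_scale[of _ _ _ ?c] by (simp del: realize_tri)
        have "(\<lambda>x. - int n * \<kappa> i x + h x) = (\<lambda>x. h x - int n * \<kappa> i x)"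
          by auto
        moreover have "- wt (\<lambda>x. - int n * \<kappa> i x) (fword i (k - n) w) = int n * wt (\<kappa> i) (fword i (k - n) w)"
          unfolding wt_scale by simp
        ultimately have "?c *\<^sub>s ?t = Qop (\<lambda>x. - int n * \<kappa> i x) (Fop i (k - n) (tri w h z))"
          by (simp only: Fop_tri Qop_tri)
        moreover have "realize (Qop (\<lambda>x. - int n * \<kappa> i x) (Fop i (k - n) (tri w h z)))
            \<cong>\<^sub>0 KK i (- int n) * realize (Fop i (k - n) (tri w h z))"
          using 2 i w sub by (intro realize_Qop Fop_TG tri_TG) auto
        ultimately have 2: "realize (?c *\<^sub>s ?t) \<cong>\<^sub>0 KK i (- int n) * (f_gen i (k - n) * Y)"
          by (simp only: realize_Fop Y_def)
        from 1 ideq_mult_left[OF 2 eW] show ?thesis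
          unfolding P_def mult.assoc by (rule ideq_trans)
      qed
      have L: "realize (Eb i l ((j, k) # w) h z) = (\<Sum>n\<le>min k l. dcoef i k l n *\<^sub>s realize (Fop i (k - n) (Qop (\<lambda>x. int n * \<kappa> i x) (Eb i (l - n) w h z))))
         - (\<Sum>n\<in>{1..min k l}. dcoef i k l n *\<^sub>s realize (qq (int n * wt (\<kappa> i) (fword i (k - n) w))
             *\<^sub>s Eb i (l - n) (fword i (k - n) w) (\<lambda>x. h x - int n * \<kappa> i x) z))"
        using l unfolding Eb.simps True[symmetric] by (simp only: realize_simps pm.scale_scale if_False simp_thms)
      have eq_R: "realize (Eb i l ((j, k) # w) h z)
        \<cong>\<^sub>0 (\<Sum>n\<le>min k l. dcoef i k l n *\<^sub>s R n) - (\<Sum>n\<in>{1..min k l}. dcoef i k l n *\<^sub>s P n)"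
        unfolding L by (intro ideq_diff ideq_sum ideq_scale S1 S2) auto
      have eq_P: "(\<Sum>n\<le>min k l. dcoef i k l n *\<^sub>s P n) \<cong>\<^sub>0 (\<Sum>n\<le>min k l. dcoef i k l n *\<^sub>s R n)"
      proof -
        have "sym_drinfeld i k l * Y \<in> I0"
          using ik il YW by (intro ideal_span_mult_right ideal_span_base cross_relators.drinfeld)
        moreover have "sym_drinfeld i k l * Y = (\<Sum>n\<le>min k l. dcoef i k l n *\<^sub>s P n) - (\<Sum>n\<le>min k l. dcoef i k l n *\<^sub>s R n)"
          unfolding sym_drinfeld_def sum_distrib_right mult_pscale_left left_diff_distrib pm.scale_right_diff_distrib
            P_def R_def by (rule sum_subtractf)
        ultimately show ?thesis by (simp only: ideq_def)
      qed
      have "realize (Eb i l ((j, k) # w) h z)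
        \<cong>\<^sub>0 (\<Sum>n\<le>min k l. dcoef i k l n *\<^sub>s P n) - (\<Sum>n\<in>{1..min k l}. dcoef i k l n *\<^sub>s P n)"
        by (rule ideq_trans[OF eq_R ideq_diff[OF ideq_sym[OF eq_P] ideq_refl]])
      also have "(\<Sum>n\<le>min k l. dcoef i k l n *\<^sub>s P n) - (\<Sum>n\<in>{1..min k l}. dcoef i k l n *\<^sub>s P n) = dcoef i k l 0 *\<^sub>s P 0"
      proof -
        have "{..min k l} = insert 0 {1..min k l}" by auto
        then show ?thesis by (simp only: sum.insert finite_atLeastAtMost) simp
      qed
      also have "\<dots> = e_gen i l * KK i 0 * (f_gen i k * Y)"
        using tau_0[OF i] by (simp add: P_def mult.assoc)
      also have "\<dots> \<cong>\<^sub>0 e_gen i l * 1 * (f_gen i k * Y)"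
        using il ik YW by (intro ideq_mult_left ideq_mult_right torus_eqv KK_0) auto
      finally show ?thesis
        using jkw True by (simp add: Y_def)
    qed
  qed
qed

lemma realize_Eop: "t \<in> TG \<Longrightarrow> l = 0 \<or> (i, l) \<in> I_infty D \<Longrightarrow> realize (Eop i l t) \<cong>\<^sub>0 e_gen i l * realize t"
  by (erule eqv_TG) (auto intro!: realize_Eb simp del: realize_tri)

lemma realize_act_word:
  assumes "set u \<subseteq> gens D" "t \<in> TG"
  shows "realize (act_word u t) \<cong>\<^sub>0 mon u * realize t"
  using assms(1)
proof (induction u)
  case (Cons g u)
  have T: "act_word u t \<in> TG"
    using Cons assms by (intro act_word_TG) auto
  have "realize (letter_op g (act_word u t)) \<cong>\<^sub>0 mon [g] * realize (act_word u t)"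
  proof -
    consider h where "g = Gq h" "h \<in> coweights" | i l where "g = Ge i l" "(i, l) \<in> I_infty D"
      | i l where "g = Gf i l" "(i, l) \<in> I_infty D"
      using Cons(2) unfolding gens_def by auto
    then show ?thesis
    proof cases
      case 1
      then show ?thesis using realize_Qop[OF T, of h] by (simp add: qexp_def letter_mon)
    next
      case 2
      then show ?thesis using realize_Eop[OF T, of l i] I_infty_pos[of i l] by (simp add: e_gen_def letter_mon)
    next
      case 3
      then show ?thesis using I_infty_pos[of i l] by (simp add: realize_Fop f_gen_def letter_mon)
    qed
  qed
  also have "mon [g] * realize (act_word u t) \<cong>\<^sub>0 mon [g] * (mon u * realize t)"
    using Cons by (intro ideq_mult_left) auto
  finally show ?case
    by (simp add: mon_Cons[of g u] mult.assoc)
qed simp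

lemma realize_act:
  assumes "x \<in> W" "t \<in> TG"
  shows "realize (act x t) \<cong>\<^sub>0 x * realize t"
  unfolding ideq_def
  by (rule plinear_word_span[of "\<lambda>x. realize (act x t) - x * realize t", OF _ _ _ assms(1)])
     (use realize_act_word[OF _ assms(2)] in \<open>auto simp: ideq_def intro!: plinear_intros plinear_realize'\<close>)

text \<open>The normal form of an element; \<open>1\<close> is the empty normal word.\<close>

definition nf :: "('i, 'p) falg \<Rightarrow> ('i, 'p) triv" where
  "nf x = act x 1"

lemma plinear_nf [simp, intro]: "plinear nf"
  unfolding nf_def[abs_def] by auto

lemmas nf_simps [simp] = plinear_simps[OF plinear_nf]

lemma one_TG: "1 \<in> TG"
  unfolding tri_one[symmetric] by (intro tri_TG) auto

lemma nf_TG: "x \<in> W \<Longrightarrow> nf x \<in> TG"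
  unfolding nf_def by (intro act_TG one_TG)

lemma realize_nf: "x \<in> W \<Longrightarrow> realize (nf x) \<cong>\<^sub>0 x"
proof -
  assume x: "x \<in> W"
  have "realize (nf x) \<cong>\<^sub>0 x * realize 1"
    unfolding nf_def using x by (intro realize_act one_TG)
  also have "x * realize 1 = x * qexp (\<lambda>_. 0)"
    unfolding tri_one[symmetric] by simp
  also have "\<dots> \<cong>\<^sub>0 x * 1"
    using x by (intro ideq_mult_left torus_eqv qexp_0)
  finally show ?thesis by simp
qed

text \<open>The two halves inside the space of normal words.\<close>

definition fT :: "'i free_alg \<Rightarrow> ('i, 'p) triv" where
  "fT = lin_ext (\<lambda>w. tri (letters w) (\<lambda>_. 0) [])"

definition eT :: "'i free_alg \<Rightarrow> ('i, 'p) triv" where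
  "eT = lin_ext (\<lambda>z. tri [] (\<lambda>_. 0) (letters z))"

lemma fT_mon [simp]: "fT (mon w) = tri w (\<lambda>_. 0) []" and eT_mon [simp]: "eT (mon w) = tri [] (\<lambda>_. 0) w"
  by (simp_all add: fT_def eT_def)

lemma plinear_fT [simp, intro]: "plinear fT" "plinear f \<Longrightarrow> plinear (\<lambda>x. fT (f x))"
  and plinear_eT [simp, intro]: "plinear eT" "plinear f \<Longrightarrow> plinear (\<lambda>x. eT (f x))"
  by (auto simp: fT_def eT_def)

lemma fT_mult: "fT (x * y) = fT x * fT y"
  by (rule free_bilinear_eqI[where f = "\<lambda>x y. fT (x * y)"]) (auto simp: mon_append[symmetric] tri_mult)

lemma eT_mult: "eT (x * y) = eT x * eT y"
  by (rule free_bilinear_eqI[where f = "\<lambda>x y. eT (x * y)"]) (auto simp: mon_append[symmetric] tri_mult)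

lemma act_fE_word: "set u \<subseteq> I_infty D \<Longrightarrow> act (fE (mon u)) t = tri u (\<lambda>_. 0) [] * t"
proof (induction u)
  case (Cons g u)
  obtain i l where g: "g = (i, l)" by force
  then have "l > 0" using Cons I_infty_pos by auto
  then show ?case
    using g Cons by (simp add: mon_Cons_gen Fop_def mult.assoc[symmetric] tri_mult)
qed (simp add: tri_one)

lemma act_fE: "x \<in> word_span (I_infty D) \<Longrightarrow> act (fE x) t = fT x * t"
  by (rule plinear_eq_on_word_span[of "\<lambda>x. act (fE x) t" "\<lambda>x. fT x * t"])
     (auto simp: act_fE_word)

text \<open>The action commutes with right multiplication by words in the \<open>e\<^sub>i\<^sub>l\<close>.\<close>

lemma act_word_right: "act_word u (t * tri [] (\<lambda>_. 0) z) = act_word u t * tri [] (\<lambda>_. 0) z"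
proof (induction u)
  case (Cons g u)
  then show ?case by (cases g) (auto simp: Qop_right Eop_right Fop_right)
qed simp

lemma act_word_eT: "act_word u (t * eT x) = act_word u t * eT x"
  by (rule plinear_eq_on[of "\<lambda>x. act_word u (t * eT x)" "\<lambda>x. act_word u t * eT x"])
     (auto simp: single_free_mon act_word_right intro!: plinear_compose[OF plinear_act_word])

lemma nf_eE_word: "set z \<subseteq> I_infty D \<Longrightarrow> nf (eE (mon z)) = tri [] (\<lambda>_. 0) z"
proof (induction z)
  case (Cons g z)
  obtain i l where g: "g = (i, l)" by force
  then have "l > 0" using Cons I_infty_pos by auto
  then show ?case
    using g Cons by (simp add: mon_Cons_gen nf_def Eb.simps)
qed (simp add: tri_one nf_def)

lemma nf_eE: "x \<in> word_span (I_infty D) \<Longrightarrow> nf (eE x) = eT x"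
  by (rule plinear_eq_on_word_span[of "\<lambda>x. nf (eE x)" eT]) (auto simp: nf_eE_word plinear_compose[OF plinear_nf])

lemma nf_realize:
  assumes "b \<in> TG" shows "nf (realize b) = b"
proof -
  have "nf (realize b) - b \<in> {0}"
  proof (rule plinear_TG[OF assms, of "\<lambda>b. nf (realize b) - b"])
    fix w z and h :: "'p \<Rightarrow> int" assume "set w \<subseteq> I_infty D" "h \<in> coweights" "set z \<subseteq> I_infty D"
    then show "nf (realize (tri w h z)) - tri w h z \<in> {0}"
      using nf_eE_word[of z] by (simp add: nf_def act_fE_word tri_mult)
  qed (auto intro!: plinear_intros plinear_compose[OF plinear_nf])
  then show ?thesis by simp
qed

text \<open>The kernel of the projection of \<open>TG\<close> onto \<open>F/J \<otimes> U\<^sup>0 \<otimes> F/J\<close>, where the normal words give \<open>TG = F \<otimes> U\<^sup>0 \<otimes> F\<close>.\<close>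

definition NT :: "('i, 'p) triv set" where
  "NT = pm.span ({fT r * tri [] h z |r h z. r \<in> J \<and> h \<in> coweights \<and> set z \<subseteq> I_infty D}
    \<union> {tri w h [] * eT r |r h w. r \<in> J \<and> h \<in> coweights \<and> set w \<subseteq> I_infty D})"

lemma subspace_NT [simp, intro]: "pm.subspace NT"
  by (simp add: NT_def)

lemma nf_JF:
  assumes "x \<in> JF" shows "nf x \<in> NT"
proof (rule plinear_ideal_span[OF plinear_nf _ _ assms])
  fix u v :: "('i, 'p) gen list" and s assume *: "set u \<subseteq> {}" "s \<in> fE ` J" "set v \<subseteq> gens D"
  then obtain r where r: "s = fE r" "r \<in> J" by auto
  have "nf (mon u * s * mon v) = fT r * nf (mon v)"
    using * r by (simp add: nf_def act_fE J_word_span)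
  moreover have "fT r * t \<in> NT" if "t \<in> TG" for t
  proof (rule plinear_TG[OF that, of "\<lambda>t. fT r * t"])
    fix w z and h :: "'p \<Rightarrow> int" assume **: "set w \<subseteq> I_infty D" "h \<in> coweights" "set z \<subseteq> I_infty D"
    have "fT r * tri w h z = fT (r * mon w) * tri [] h z"
      by (simp add: fT_mult mult.assoc tri_mult)
    moreover have "r * mon w \<in> J"
      using r ** by (intro J_mult) auto
    ultimately show "fT r * tri w h z \<in> NT"
      unfolding NT_def using ** by (intro pm.span_base) blast
  qed auto
  ultimately show "nf (mon u * s * mon v) \<in> NT"
    using * nf_TG[of "mon v"] by auto
qed auto

lemma nf_JE:
  assumes "x \<in> JE" shows "nf x \<in> NT"
proof (rule plinear_ideal_span[OF plinear_nf _ _ assms])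
  fix u v :: "('i, 'p) gen list" and s assume *: "set u \<subseteq> gens D" "s \<in> eE ` J" "set v \<subseteq> {}"
  then obtain r where r: "s = eE r" "r \<in> J" by auto
  have "nf (mon u * s * mon v) = act_word u (nf (eE r))"
    using * r by (simp add: nf_def)
  also have "nf (eE r) = eT r"
    using r by (intro nf_eE J_word_span)
  also have "act_word u (eT r) = nf (mon u) * eT r"
    using act_word_eT[of u 1 r] by (simp add: nf_def)
  finally have "nf (mon u * s * mon v) = nf (mon u) * eT r" .
  moreover have "t * eT r \<in> NT" if "t \<in> TG" for t
  proof (rule plinear_TG[OF that, of "\<lambda>t. t * eT r"])
    fix w z and h :: "'p \<Rightarrow> int" assume **: "set w \<subseteq> I_infty D" "h \<in> coweights" "set z \<subseteq> I_infty D"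
    have "tri w h z * eT r = tri w h [] * eT (mon z * r)"
      by (simp add: eT_mult mult.assoc[symmetric] tri_mult)
    moreover have "mon z * r \<in> J"
      using r ** by (intro J_mult) auto
    ultimately show "tri w h z * eT r \<in> NT"
      unfolding NT_def using ** by (intro pm.span_base) blast
  qed auto
  ultimately show "nf (mon u * s * mon v) \<in> NT"
    using * nf_TG[of "mon u"] by auto
qed auto

text \<open>The normal form of \<open>realize b\<close> is \<open>b\<close> and the normal form of each of the three summands of \<open>NN\<close> lies in \<open>NT\<close>.\<close>

lemma realize_NN_imp_NT:
  assumes "b \<in> TG" "realize b \<in> NN"
  shows "b \<in> NT"
proof -
  obtain x y z where *: "realize b = x + y + z" "x \<in> I0" "y \<in> JF" "z \<in> JE"
    using assms(2) by (auto simp: sum_set_def)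
  have "b = nf x + nf y + nf z"
    using nf_realize[OF assms(1)] * by simp
  moreover have "nf x = 0"
    unfolding nf_def using * by (intro act_I0)
  ultimately show ?thesis
    using nf_JF[OF *(3)] nf_JE[OF *(4)] pm.subspace_add[OF subspace_NT] by simp
qed

section \<open>The algebra \<open>U\<^sub>q\<close>\<close>

lemma relators_W: "r \<in> relators D \<tau> \<Longrightarrow> r \<in> W"
proof (induction rule: relators.induct)
  case (serre_e i j l n)
  then show ?case by (auto intro!: word_span_closed word_span_mult word_span_power simp: real_I_infty)
next
  case (serre_f i j l n)
  then show ?case by (auto intro!: word_span_closed word_span_mult word_span_power simp: real_I_infty)
next
  case (drinfeld i k l)
  have i: "i \<in> index_set D" using drinfeld I_infty_index by auto
  have k: "m = 0 \<or> (i, m) \<in> I_infty D" if "m + n = k" for m n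
    using drinfeld that by (auto intro: I_infty_mono)
  have l: "s = 0 \<or> (i, s) \<in> I_infty D" if "n + s = l" for n s
    using drinfeld that by (auto intro: I_infty_mono)
  have sums: "(\<Sum>(m, n, s) \<in> {(m, n, s). m + n = k \<and> n + s = l}. c m n s *\<^sub>s F m n s) \<in> W"
    if F: "\<And>m n s. m + n = k \<Longrightarrow> n + s = l \<Longrightarrow> F m n s \<in> W" for c F
    by (rule word_span_closed(4)) (use F in \<open>auto intro!: word_span_closed(3)\<close>)
  show ?case
    unfolding K_pow_eq using i
    by (intro word_span_closed(2) sums word_span_mult e_gen_W[OF l] f_gen_W[OF k]) (assumption | auto)+
qed auto

abbreviation II :: "('i, 'p) falg set" where "II \<equiv> defining_ideal D \<tau>"

text \<open>The defining ideal is the span of the products \<open>u r v\<close> of a relator \<open>r\<close> with words \<open>u\<close> and \<open>v\<close>.\<close>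

lemma defining_ideal_span: "II = ideal_span (gens D) (gens D) (relators D \<tau>)"
  unfolding defining_ideal_def using relators_W by (intro genideal_free_algebra) auto

lemma subspace_II: "pm.subspace II"
  by (simp add: defining_ideal_span)

lemma II_W: "x \<in> II \<Longrightarrow> x \<in> W"
  unfolding defining_ideal_span using relators_W by (intro ideal_span_subset_word_span) auto

lemma II_mult: "x \<in> II \<Longrightarrow> y \<in> W \<Longrightarrow> y * x \<in> II" "x \<in> II \<Longrightarrow> y \<in> W \<Longrightarrow> x * y \<in> II"
  unfolding defining_ideal_span by (auto intro: ideal_span_mult_left ideal_span_mult_right)

lemma II_relator: "r \<in> relators D \<tau> \<Longrightarrow> r \<in> II"
  unfolding defining_ideal_span by (rule ideal_span_base)

lemma II_subset_NN: "x \<in> II \<Longrightarrow> x \<in> NN"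
  unfolding defining_ideal_span
proof (erule plinear_ideal_span[of "\<lambda>x. x", rotated 3])
  fix u r v assume "set u \<subseteq> gens D" "r \<in> relators D \<tau>" "set v \<subseteq> gens D"
  then show "mon u * r * mon v \<in> NN"
    using relators_subset_NN by (intro NN_mult_left NN_mult_right) auto
qed auto

lemma torus_relators_II: "r \<in> torus_relators \<Longrightarrow> r \<in> II"
proof (induction rule: torus_relators.induct)
  case q_zero
  show ?case by (intro II_relator relators.q_zero)
next
  case (q_add h h')
  then show ?case by (intro II_relator relators.q_add)
next
  case (q_e h j l)
  then show ?case unfolding qq_def by (intro II_relator relators.q_e)
next
  case (q_f h j l)
  then show ?case unfolding qq_def by (intro II_relator relators.q_f)
qed

lemma ideal_span_II:
  assumes "S \<subseteq> II" "x \<in> ideal_span (gens D) (gens D) S" shows "x \<in> II"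
proof (rule plinear_ideal_span[of "\<lambda>x. x", OF _ _ _ assms(2)])
  fix u r v assume "set u \<subseteq> gens D" "r \<in> S" "set v \<subseteq> gens D"
  then show "mon u * r * mon v \<in> II"
    using assms(1) by (intro II_mult(2)[OF II_mult(1)]) auto
qed (auto simp: subspace_II)

lemma ideal_span_torus_II: "x \<in> ideal_span (gens D) (gens D) torus_relators \<Longrightarrow> x \<in> II"
  by (rule ideal_span_II[OF subsetI[OF torus_relators_II]])

lemma cross_relators_II: "r \<in> cross_relators \<Longrightarrow> r \<in> II"
proof (induction rule: cross_relators.induct)
  case (drinfeld i k l)
  from relators.drinfeld[OF this, of \<tau>, THEN II_relator]
    ideal_span_torus_II[OF sym_drinfeld_equiv[OF drinfeld, unfolded ideq_def]]
  show ?case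
    using pm.subspace_diff[OF subspace_II] by fastforce
qed (auto intro: torus_relators_II II_relator relators.comm_e_f)

lemma I0_II: "x \<in> I0 \<Longrightarrow> x \<in> II"
  by (rule ideal_span_II[OF subsetI[OF cross_relators_II]])

lemma serre_relators_II:
  assumes "r \<in> serre_relators" shows "fE r \<in> II" "eE r \<in> II"
proof -
  consider (serre) i j' l where "i \<in> real_indices D" "(j', l) \<in> I_infty D" "(j', l) \<noteq> (i, 1)"
      "r = serre_sum D i (nat (1 - int l * cartan D i j')) 0 (gen i 1) (gen j' l)"
    | (comm) i k j' l where "(i, k) \<in> I_infty D" "(j', l) \<in> I_infty D" "cartan D i j' = 0"
      "r = gen i k * gen j' l - gen j' l * gen i k"
    using assms unfolding serre_relators_def by blast
  then have "fE r \<in> II \<and> eE r \<in> II"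
  proof cases
    case serre
    show ?thesis
      unfolding serre(4) serre_image
      using relators.serre_e[OF serre(1-3) refl, of \<tau>] relators.serre_f[OF serre(1-3) refl, of \<tau>]
      by (auto intro: II_relator)
  next
    case comm
    then show ?thesis
      using relators.comm_e[OF comm(1-3), of \<tau>] relators.comm_f[OF comm(1-3), of \<tau>]
      by (auto intro: II_relator)
  qed
  then show "fE r \<in> II" "eE r \<in> II" by auto
qed

lemma fE_J_II: "r \<in> J \<Longrightarrow> fE r \<in> II"
  unfolding J_def
proof (erule plinear_ideal_span[of fE, rotated 3])
  fix u r v assume "set u \<subseteq> I_infty D" "r \<in> serre_relators" "set v \<subseteq> I_infty D"
  then show "fE (mon u * r * mon v) \<in> II"
    unfolding fE_mult by (intro II_mult(2)[OF II_mult(1)] serre_relators_II) auto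
qed (auto simp: subspace_II)

lemma eE_J_II: "r \<in> J \<Longrightarrow> eE r \<in> II"
  unfolding J_def
proof (erule plinear_ideal_span[of eE, rotated 3])
  fix u r v assume "set u \<subseteq> I_infty D" "r \<in> serre_relators" "set v \<subseteq> I_infty D"
  then show "eE (mon u * r * mon v) \<in> II"
    unfolding eE_mult by (intro II_mult(2)[OF II_mult(1)] serre_relators_II) auto
qed (auto simp: subspace_II)

sublocale U: fsupp_quotient "free_algebra (gens D)" "defining_ideal D \<tau>"
  by unfold_locales (auto simp: subspace_II intro: II_W)

abbreviation UU :: "(qfield, ('i, 'p) falg set) module" where "UU \<equiv> Uq D \<tau>"
abbreviation cl :: "('i, 'p) falg \<Rightarrow> ('i, 'p) falg set" where "cl \<equiv> Uq_class D \<tau>"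

lemma cl_simps:
  "cl x = cl y \<longleftrightarrow> x - y \<in> II" "carrier UU = cl ` W" "\<zero>\<^bsub>UU\<^esub> = cl 0"
  "cl x \<oplus>\<^bsub>UU\<^esub> cl y = cl (x + y)" "c \<odot>\<^bsub>UU\<^esub> cl x = cl (c *\<^sub>s x)"
  unfolding Uq_def Uq_class_def using U.carrier_Q
  by (simp_all add: U.cls_eq_iff U.zero_Q U.add_Q U.smult_Q)

lemma cl_mult: "x \<in> W \<Longrightarrow> y \<in> W \<Longrightarrow> cl x \<otimes>\<^bsub>UU\<^esub> cl y = cl (x * y)"
  unfolding Uq_def Uq_class_def
proof (rule U.cls_mult)
  fix a b assume *: "x \<in> W" "y \<in> W" "a - x \<in> II" "b - y \<in> II"
  have "(b - y) + y \<in> W"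
    by (rule word_span_closed(1)[OF II_W[OF *(4)] *(2)])
  then have "b \<in> W" by simp
  then have "(a - x) * b + x * (b - y) \<in> II"
    using * by (intro pm.subspace_add[OF subspace_II] II_mult) auto
  then show "a * b - x * y \<in> II" by (simp add: algebra_simps)
qed simp

lemma cl_one: "\<one>\<^bsub>UU\<^esub> = cl 1"
  by (simp add: Uq_def Uq_class_def quotient_module_def FactRing_def)

lemma module_U: "module scalars UU"
  unfolding Uq_def by (rule U.module_Q)

lemma ring_U: "ring UU"
proof (rule ringI)
  show "abelian_group UU" unfolding Uq_def by (rule U.abelian_group_Q)
  show "Group.monoid UU"
    by (rule monoidI) (auto simp: cl_simps(2) cl_mult cl_one mult.assoc)
qed (auto simp: cl_simps(2,4) cl_mult distrib_left distrib_right)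

lemma eqv_cl: "x \<cong>\<^sub>0 y \<Longrightarrow> cl x = cl y"
  unfolding cl_simps ideq_def by (rule I0_II)

lemma cl_neg: "x \<in> W \<Longrightarrow> \<ominus>\<^bsub>UU\<^esub> cl x = cl (- x)"
proof -
  assume x: "x \<in> W"
  interpret ring UU by (rule ring_U)
  have "- x \<in> W" using pm.subspace_neg[OF subspace_word_span x] .
  then show ?thesis
    using x by (intro minus_equality) (auto simp: cl_simps(2-4))
qed

text \<open>The subalgebra generated by the classes of some letters is the image of the free algebra on these letters.\<close>

lemma generated_subalgebra_U:
  fixes \<phi> :: "'g \<Rightarrow> ('i, 'p) gen"
  assumes \<phi>: "\<phi> ` G \<subseteq> gens D"
  shows "generated_subalgebra UU ((\<lambda>g. cl (mon [\<phi> g])) ` G) = cl ` alg_map \<phi> ` word_span G" (is "_ = ?S")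
    and "submodule (cl ` alg_map \<phi> ` word_span G) scalars UU"
proof -
  interpret ring UU by (rule ring_U)
  interpret M: module scalars UU by (rule module_U)
  have aW: "alg_map \<phi> x \<in> W" if "x \<in> word_span G" for x :: "'g free_mon \<Rightarrow>\<^sub>0 qfield"
    by (rule alg_map_word_span[OF that \<phi>])
  have mem: "cl y \<in> ?S" if "y = alg_map \<phi> x" "x \<in> word_span G" for x y
    using that by blast
  have neg: "- x \<in> word_span G" if "x \<in> word_span G" for x :: "'g free_mon \<Rightarrow>\<^sub>0 qfield"
    using pm.subspace_neg[OF subspace_word_span that] .
  have sub: "?S \<subseteq> carrier UU"
    using aW by (auto simp: cl_simps(2))
  have inv: "\<ominus>\<^bsub>UU\<^esub> a \<in> ?S" if "a \<in> ?S" for a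
    using that aW neg by (auto simp: cl_neg intro!: mem[of "- alg_map \<phi> x" "- x" for x])
  have add: "a \<oplus>\<^bsub>UU\<^esub> b \<in> ?S" if ab: "a \<in> ?S" "b \<in> ?S" for a b
  proof -
    obtain x y where "a = cl (alg_map \<phi> x)" "b = cl (alg_map \<phi> y)" "x \<in> word_span G" "y \<in> word_span G"
      using ab by auto
    then show ?thesis by (auto simp: cl_simps(4) intro!: mem[of _ "x + y"])
  qed
  have mult: "a \<otimes>\<^bsub>UU\<^esub> b \<in> ?S" if ab: "a \<in> ?S" "b \<in> ?S" for a b
  proof -
    obtain x y where "a = cl (alg_map \<phi> x)" "b = cl (alg_map \<phi> y)" "x \<in> word_span G" "y \<in> word_span G"
      using ab by auto
    then show ?thesis by (auto simp: cl_mult aW intro!: mem[of _ "x * y"])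
  qed
  have sm: "c \<odot>\<^bsub>UU\<^esub> a \<in> ?S" if a: "a \<in> ?S" for a c
  proof -
    obtain x where "a = cl (alg_map \<phi> x)" "x \<in> word_span G"
      using a by auto
    then show ?thesis by (auto simp: cl_simps(5) intro!: mem[of _ "c *\<^sub>s x"])
  qed
  have one: "\<one>\<^bsub>UU\<^esub> \<in> ?S" unfolding cl_one by (rule mem[of _ 1]) auto
  have zero: "\<zero>\<^bsub>UU\<^esub> \<in> ?S" unfolding cl_simps(3) by (rule mem[of _ 0]) auto
  have "subring ?S UU"
    by (rule subringI[OF sub one inv mult add])
  moreover show submod: "submodule ?S scalars UU"
    by (rule M.submoduleI[OF sub zero inv add]) (auto intro: sm)
  moreover have "(\<lambda>g. cl (mon [\<phi> g])) ` G \<subseteq> ?S"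
  proof safe
    fix g assume "g \<in> G"
    then show "cl (mon [\<phi> g]) \<in> ?S"
      by (intro mem[of _ "mon [g]"]) auto
  qed
  ultimately have le: "generated_subalgebra UU ((\<lambda>g. cl (mon [\<phi> g])) ` G) \<subseteq> ?S"
    unfolding generated_subalgebra_def by blast
  have "cl (alg_map \<phi> x) \<in> S" if S: "subring S UU" "submodule S scalars UU" "(\<lambda>g. cl (mon [\<phi> g])) ` G \<subseteq> S"
    and x: "x \<in> word_span G" for S x
  proof -
    note E = subringE[OF S(1)] M.submoduleE[OF S(2)]
    have word: "cl (mon (map \<phi> u)) \<in> S" if "set u \<subseteq> G" for u
      using that
    proof (induction u)
      case Nil
      then show ?case using E(3) by (simp add: cl_one)
    next
      case (Cons g u)
      have "set (map \<phi> u) \<subseteq> gens D" "\<phi> g \<in> gens D"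
        using Cons \<phi> by auto
      then have "cl (mon (\<phi> g # map \<phi> u)) = cl (mon [\<phi> g]) \<otimes>\<^bsub>UU\<^esub> cl (mon (map \<phi> u))"
        by (subst cl_mult) (auto simp: mon_append[symmetric])
      moreover have "\<dots> \<in> S"
        using Cons S(3) by (intro E(6)) auto
      ultimately show ?case by simp
    qed
    show ?thesis
      using x
    proof (induction rule: word_span_induct)
      case zero
      then show ?case using E(2) by (simp add: cl_simps(3))
    next
      case (step c u x)
      have "c \<odot>\<^bsub>UU\<^esub> cl (mon (map \<phi> u)) \<oplus>\<^bsub>UU\<^esub> cl (alg_map \<phi> x) \<in> S"
        using step word by (intro E(7) E(11)) auto
      then show ?case
        by (simp add: cl_simps(4,5))
    qed
  qed
  then show "generated_subalgebra UU ((\<lambda>g. cl (mon [\<phi> g])) ` G) = ?S"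
    using le unfolding generated_subalgebra_def by blast
qed

abbreviation Um :: "(qfield, ('i, 'p) falg set) module" where "Um \<equiv> U_minus D \<tau>"
abbreviation Uz :: "(qfield, ('i, 'p) falg set) module" where "Uz \<equiv> U_zero D \<tau>"
abbreviation Up :: "(qfield, ('i, 'p) falg set) module" where "Up \<equiv> U_plus D \<tau>"

lemma Um_simps [simp]: "add Um = add UU" "\<zero>\<^bsub>Um\<^esub> = \<zero>\<^bsub>UU\<^esub>" "module.smult Um = module.smult UU"
  and Uz_simps [simp]: "add Uz = add UU" "\<zero>\<^bsub>Uz\<^esub> = \<zero>\<^bsub>UU\<^esub>" "module.smult Uz = module.smult UU"
  and Up_simps [simp]: "add Up = add UU" "\<zero>\<^bsub>Up\<^esub> = \<zero>\<^bsub>UU\<^esub>" "module.smult Up = module.smult UU"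
  by (simp_all add: U_minus_def U_zero_def U_plus_def)

lemma gens_images: "(\<lambda>(i, l). Gf i l) ` I_infty D \<subseteq> gens D" "(\<lambda>(i, l). Ge i l) ` I_infty D \<subseteq> gens D"
  "Gq ` coweights \<subseteq> gens D"
  by (auto simp: gens_def)

lemma carrier_Um: "carrier Um = cl ` fE ` word_span (I_infty D)"
proof -
  have "{cl (f_gen i l) |i l. (i, l) \<in> I_infty D} = (\<lambda>g. cl (mon [(\<lambda>(i, l). Gf i l) g])) ` I_infty D"
  proof -
    have "{cl (f_gen i l) |i l. (i, l) \<in> I_infty D} = (\<lambda>(i, l). cl (f_gen i l)) ` I_infty D"
      by auto
    also have "\<dots> = (\<lambda>g. cl (mon [(\<lambda>(i, l). Gf i l) g])) ` I_infty D"
      by (rule image_cong) (auto simp: f_gen_def letter_mon dest: I_infty_pos)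
    finally show ?thesis .
  qed
  then show ?thesis
    using generated_subalgebra_U(1)[OF gens_images(1)] by (simp add: U_minus_def fE_def)
qed

lemma carrier_Up: "carrier Up = cl ` eE ` word_span (I_infty D)"
proof -
  have "{cl (e_gen i l) |i l. (i, l) \<in> I_infty D} = (\<lambda>g. cl (mon [(\<lambda>(i, l). Ge i l) g])) ` I_infty D"
  proof -
    have "{cl (e_gen i l) |i l. (i, l) \<in> I_infty D} = (\<lambda>(i, l). cl (e_gen i l)) ` I_infty D"
      by auto
    also have "\<dots> = (\<lambda>g. cl (mon [(\<lambda>(i, l). Ge i l) g])) ` I_infty D"
      by (rule image_cong) (auto simp: e_gen_def letter_mon dest: I_infty_pos)
    finally show ?thesis .
  qed
  then show ?thesis
    using generated_subalgebra_U(1)[OF gens_images(2)] by (simp add: U_plus_def eE_def)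
qed

lemma carrier_Uz: "carrier Uz = cl ` alg_map Gq ` word_span coweights"
proof -
  have "{cl (qexp h) |h. h \<in> coweights} = (\<lambda>h. cl (mon [Gq h])) ` coweights"
    by (auto simp: qexp_def letter_mon)
  then show ?thesis
    using generated_subalgebra_U(1)[OF gens_images(3)] by (simp add: U_zero_def)
qed

lemma module_Um: "module scalars Um"
  using submodule.submodule_is_module[OF generated_subalgebra_U(2)[OF gens_images(1)] module_U] carrier_Um
  by (simp add: U_minus_def fE_def)

lemma module_Up: "module scalars Up"
  using submodule.submodule_is_module[OF generated_subalgebra_U(2)[OF gens_images(2)] module_U] carrier_Up
  by (simp add: U_plus_def eE_def)

lemma module_Uz: "module scalars Uz"
  using submodule.submodule_is_module[OF generated_subalgebra_U(2)[OF gens_images(3)] module_U] carrier_Uz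
  by (simp add: U_zero_def)

text \<open>Every word in the \<open>q\<^sup>h\<close> equals a single \<open>q\<^sup>h\<close> in \<open>U\<^sub>q\<close>.\<close>

lemma torus_word:
  assumes "set hs \<subseteq> coweights"
  obtains h where "h \<in> coweights" "cl (mon (map Gq hs)) = cl (qexp h)"
proof -
  have "\<exists>h\<in>coweights. cl (mon (map Gq hs)) = cl (qexp h)"
    using assms
  proof (induction hs)
    case Nil
    have "cl 1 = cl (qexp (\<lambda>_. 0))"
      using eqv_cl[OF torus_eqv[OF qexp_0]] by simp
    then show ?case by auto
  next
    case (Cons h hs)
    then obtain h' where h': "h' \<in> coweights" "cl (mon (map Gq hs)) = cl (qexp h')"
      by auto
    have hs: "mon (map Gq hs) \<in> W" "h \<in> coweights"
      using Cons(2) gens_images(3) by (auto intro!: mon_in_word_span simp: image_subset_iff subset_iff)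
    have "cl (mon (map Gq (h # hs))) = cl (qexp h * mon (map Gq hs))"
      by (simp only: list.map mon_Cons[of "Gq h" "map Gq hs"] qexp_def letter_mon)
    also have "\<dots> = cl (qexp h) \<otimes>\<^bsub>UU\<^esub> cl (qexp h')"
      using hs h' by (simp add: cl_mult[symmetric])
    also have "\<dots> = cl (qexp (\<lambda>x. h x + h' x))"
      using hs h' eqv_cl[OF torus_eqv[OF qexp_add]] by (simp add: cl_mult)
    finally show ?case
      using hs h' by blast
  qed
  then show ?thesis using that by blast
qed

section \<open>The triangular decomposition\<close>

interpretation T1: tensor_product "U_minus D \<tau>" "U_zero D \<tau>"
  by (rule tensor_product.intro[OF module_Um module_Uz])

interpretation T2: tensor_product "tensor (U_minus D \<tau>) (U_zero D \<tau>)" "U_plus D \<tau>"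
  by (rule tensor_product.intro[OF T1.module_tensor module_Up])

abbreviation "TT \<equiv> tensor (tensor (U_minus D \<tau>) (U_zero D \<tau>)) (U_plus D \<tau>)"
abbreviation "pure3 x y z \<equiv> T2.pure (T1.pure x y) z"

lemma fE_Um: "x \<in> word_span (I_infty D) \<Longrightarrow> cl (fE x) \<in> carrier Um"
  and eE_Up: "x \<in> word_span (I_infty D) \<Longrightarrow> cl (eE x) \<in> carrier Up"
  by (auto simp: carrier_Um carrier_Up)

lemma alg_map_Uz: "x \<in> word_span coweights \<Longrightarrow> cl (alg_map Gq x) \<in> carrier Uz"
  by (auto simp: carrier_Uz)

lemma qexp_Uz: "h \<in> coweights \<Longrightarrow> cl (qexp h) \<in> carrier Uz"
  using alg_map_Uz[of "mon [h]"] by (simp add: qexp_def letter_mon)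

lemma carrier_U_subset: "carrier Um \<subseteq> carrier UU" "carrier Uz \<subseteq> carrier UU" "carrier Up \<subseteq> carrier UU"
  using alg_map_word_span[OF _ gens_images(3)]
  by (auto simp: carrier_Um carrier_Uz carrier_Up cl_simps(2))

text \<open>The map from normal words to the triple tensor product. It is defined by a representative in the free
  module, hence on all of the ambient type.\<close>

definition Psi :: "('i, 'p) triv \<Rightarrow> _" where
  "Psi b = T2.T.cls (lin_ext (\<lambda>(w, h, z). Poly_Mapping.single
     (T1.pure (cl (fE (mon (letters w)))) (cl (qexp h)), cl (eE (mon (letters z)))) 1) b)"

lemma Psi_tri: "Psi (tri w h z) = pure3 (cl (fE (mon w))) (cl (qexp h)) (cl (eE (mon z)))"
  by (simp add: Psi_def T2.pure_cls)

lemma Psi_add: "Psi (a + b) = Psi a \<oplus>\<^bsub>TT\<^esub> Psi b"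
  and Psi_smult: "Psi (c *\<^sub>s a) = c \<odot>\<^bsub>TT\<^esub> Psi a"
  and Psi_zero: "Psi 0 = \<zero>\<^bsub>TT\<^esub>"
  by (simp_all only: Psi_def lin_ext_simps T2.tensor_zero) (simp_all only: T2.tensor_Q T2.T.add_Q T2.T.smult_Q)

interpretation TT: module scalars TT
  by (rule T2.module_tensor)

lemma pure3_zero:
  "\<lbrakk>y \<in> carrier Uz; z \<in> carrier Up\<rbrakk> \<Longrightarrow> pure3 \<zero>\<^bsub>UU\<^esub> y z = \<zero>\<^bsub>TT\<^esub>"
  "\<lbrakk>x \<in> carrier Um; z \<in> carrier Up\<rbrakk> \<Longrightarrow> pure3 x \<zero>\<^bsub>UU\<^esub> z = \<zero>\<^bsub>TT\<^esub>"
  "\<lbrakk>x \<in> carrier Um; y \<in> carrier Uz\<rbrakk> \<Longrightarrow> pure3 x y \<zero>\<^bsub>UU\<^esub> = \<zero>\<^bsub>TT\<^esub>"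
  using T1.pure_zero_left[of y] T1.pure_zero_right[of x] T2.pure_zero_left[of z]
    T2.pure_zero_right[OF T1.pure_closed, of x y] by simp_all

lemma pure3_linear_left:
  assumes "x \<in> carrier Um" "x' \<in> carrier Um" "y \<in> carrier Uz" "z \<in> carrier Up"
  shows "pure3 (c \<odot>\<^bsub>UU\<^esub> x \<oplus>\<^bsub>UU\<^esub> x') y z = c \<odot>\<^bsub>TT\<^esub> pure3 x y z \<oplus>\<^bsub>TT\<^esub> pure3 x' y z"
proof -
  have cx: "c \<odot>\<^bsub>UU\<^esub> x \<in> carrier Um"
    using T1.M.smult_closed[OF _ assms(1), of c] by simp
  show ?thesis
    using T1.pure_add_left[OF cx assms(2,3)] T1.pure_smult_left[OF assms(1,3), of c]
      T2.pure_add_left[OF T1.pure_closed[OF cx assms(3)] T1.pure_closed[OF assms(2,3)] assms(4)]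
      T2.pure_smult_left[OF T1.pure_closed[OF assms(1,3)] assms(4), of c] by simp
qed

lemma pure3_linear_middle:
  assumes "x \<in> carrier Um" "y \<in> carrier Uz" "y' \<in> carrier Uz" "z \<in> carrier Up"
  shows "pure3 x (c \<odot>\<^bsub>UU\<^esub> y \<oplus>\<^bsub>UU\<^esub> y') z = c \<odot>\<^bsub>TT\<^esub> pure3 x y z \<oplus>\<^bsub>TT\<^esub> pure3 x y' z"
proof -
  have cy: "c \<odot>\<^bsub>UU\<^esub> y \<in> carrier Uz"
    using T1.N.smult_closed[OF _ assms(2), of c] by simp
  show ?thesis
    using T1.pure_add_right[OF assms(1) cy assms(3)] T1.pure_smult_right[OF assms(1,2), of c]
      T2.pure_add_left[OF T1.pure_closed[OF assms(1) cy] T1.pure_closed[OF assms(1,3)] assms(4)]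
      T2.pure_smult_left[OF T1.pure_closed[OF assms(1,2)] assms(4), of c] by simp
qed

lemma pure3_linear_right:
  assumes "x \<in> carrier Um" "y \<in> carrier Uz" "z \<in> carrier Up" "z' \<in> carrier Up"
  shows "pure3 x y (c \<odot>\<^bsub>UU\<^esub> z \<oplus>\<^bsub>UU\<^esub> z') = c \<odot>\<^bsub>TT\<^esub> pure3 x y z \<oplus>\<^bsub>TT\<^esub> pure3 x y z'"
proof -
  have cz: "c \<odot>\<^bsub>UU\<^esub> z \<in> carrier Up"
    using T2.N.smult_closed[OF _ assms(3), of c] by simp
  show ?thesis
    using T2.pure_add_right[OF T1.pure_closed[OF assms(1,2)] cz assms(4)]
      T2.pure_smult_right[OF T1.pure_closed[OF assms(1,2)] assms(3), of c] by simp
qed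

lemma cl_comb: "cl (c *\<^sub>s x + y) = c \<odot>\<^bsub>UU\<^esub> cl x \<oplus>\<^bsub>UU\<^esub> cl y"
  by (simp add: cl_simps(4,5))

lemma Psi_fT:
  assumes "x \<in> word_span (I_infty D)" "h \<in> coweights" "set z \<subseteq> I_infty D"
  shows "Psi (fT x * tri [] h z) = pure3 (cl (fE x)) (cl (qexp h)) (cl (eE (mon z)))"
  using assms(1)
proof (induction rule: word_span_induct)
  case zero
  show ?case
    using assms pure3_zero(1)[OF qexp_Uz eE_Up, of h "mon z"]
    by (simp add: Psi_zero cl_simps(3) module_hom.zero[OF plinear_fT(1)])
next
  case (step c u x)
  have "fT (c *\<^sub>s mon u + x) * tri [] h z = c *\<^sub>s tri u h z + fT x * tri [] h z"
    by (simp add: module_hom.add[OF plinear_fT(1)] module_hom.scale[OF plinear_fT(1)] distrib_right tri_mult)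
  then have "Psi (fT (c *\<^sub>s mon u + x) * tri [] h z)
    = pure3 (c \<odot>\<^bsub>UU\<^esub> cl (fE (mon u)) \<oplus>\<^bsub>UU\<^esub> cl (fE x)) (cl (qexp h)) (cl (eE (mon z)))"
    using step assms
    by (simp only: Psi_add Psi_smult Psi_tri step.IH)
       (intro pure3_linear_left[symmetric] fE_Um qexp_Uz eE_Up mon_in_word_span)
  then show ?case by (simp add: cl_comb)
qed

lemma Psi_eT:
  assumes "x \<in> word_span (I_infty D)" "h \<in> coweights" "set w \<subseteq> I_infty D"
  shows "Psi (tri w h [] * eT x) = pure3 (cl (fE (mon w))) (cl (qexp h)) (cl (eE x))"
  using assms(1)
proof (induction rule: word_span_induct)
  case zero
  show ?case
    using assms pure3_zero(3)[OF fE_Um qexp_Uz, of "mon w" h]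
    by (simp add: Psi_zero cl_simps(3) module_hom.zero[OF plinear_eT(1)])
next
  case (step c u x)
  have "tri w h [] * eT (c *\<^sub>s mon u + x) = c *\<^sub>s tri w h u + tri w h [] * eT x"
    by (simp add: module_hom.add[OF plinear_eT(1)] module_hom.scale[OF plinear_eT(1)] distrib_left tri_mult)
  then have "Psi (tri w h [] * eT (c *\<^sub>s mon u + x))
    = pure3 (cl (fE (mon w))) (cl (qexp h)) (c \<odot>\<^bsub>UU\<^esub> cl (eE (mon u)) \<oplus>\<^bsub>UU\<^esub> cl (eE x))"
    using step assms
    by (simp only: Psi_add Psi_smult Psi_tri step.IH)
       (intro pure3_linear_right[symmetric] fE_Um qexp_Uz eE_Up mon_in_word_span)
  then show ?case by (simp add: cl_comb)
qed

lemma Psi_NT: "b \<in> NT \<Longrightarrow> Psi b = \<zero>\<^bsub>TT\<^esub>"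
  unfolding NT_def
proof (induction rule: pm.span_induct_alt)
  case base
  show ?case by (rule Psi_zero)
next
  case (step c x y)
  have zero: "cl r = \<zero>\<^bsub>UU\<^esub>" if "r \<in> II" for r
    using that by (simp add: cl_simps)
  have "Psi x = \<zero>\<^bsub>TT\<^esub>"
    using step(1)
  proof
    assume "x \<in> {fT r * tri [] h z |r h z. r \<in> J \<and> h \<in> coweights \<and> set z \<subseteq> I_infty D}"
    then obtain r h z where *: "x = fT r * tri [] h z" "r \<in> J" "h \<in> coweights" "set z \<subseteq> I_infty D"
      by blast
    then show ?thesis
      using zero[OF fE_J_II] pure3_zero(1)[OF qexp_Uz eE_Up, of h "mon z"] by (simp add: Psi_fT J_word_span)
  next
    assume "x \<in> {tri w h [] * eT r |r h w. r \<in> J \<and> h \<in> coweights \<and> set w \<subseteq> I_infty D}"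
    then obtain r h w where *: "x = tri w h [] * eT r" "r \<in> J" "h \<in> coweights" "set w \<subseteq> I_infty D"
      by blast
    then show ?thesis
      using zero[OF eE_J_II] pure3_zero(3)[OF fE_Um qexp_Uz, of "mon w" h] by (simp add: Psi_eT J_word_span)
  qed
  then show ?case
    using step(2) TT.smult_r_null[of c] by (simp add: Psi_add Psi_smult)
qed

lemma Psi_surj_pure:
  assumes "x \<in> carrier Um" "y \<in> carrier Uz" "z \<in> carrier Up"
  shows "pure3 x y z \<in> Psi ` TG"
proof -
  have comb: "c \<odot>\<^bsub>TT\<^esub> a \<oplus>\<^bsub>TT\<^esub> b \<in> Psi ` TG" if ab: "a \<in> Psi ` TG" "b \<in> Psi ` TG" for a b c
  proof -
    obtain a' b' where "a = Psi a'" "b = Psi b'" "a' \<in> TG" "b' \<in> TG" using ab by blast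
    then have "c \<odot>\<^bsub>TT\<^esub> a \<oplus>\<^bsub>TT\<^esub> b = Psi (c *\<^sub>s a' + b')" "c *\<^sub>s a' + b' \<in> TG"
      by (auto simp: Psi_add Psi_smult intro!: TG_closed)
    then show ?thesis by blast
  qed
  have zero: "\<zero>\<^bsub>TT\<^esub> \<in> Psi ` TG"
    using pm.subspace_0[OF subspace_TG] by (auto simp: Psi_zero[symmetric])
  have A: "pure3 (cl (fE (mon w))) (cl (qexp h)) (cl (eE z')) \<in> Psi ` TG"
    if "set w \<subseteq> I_infty D" "h \<in> coweights" "z' \<in> word_span (I_infty D)" for w h z'
    unfolding Psi_eT[OF that(3,2,1), symmetric]
  proof (rule imageI)
    show "tri w h [] * eT z' \<in> TG"
      by (rule plinear_word_span[of "\<lambda>z. tri w h [] * eT z", OF _ _ _ that(3)])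
         (use that in \<open>auto simp: tri_mult intro!: tri_TG\<close>)
  qed
  have B: "pure3 (cl (fE (mon w))) (cl (alg_map Gq s)) (cl (eE z')) \<in> Psi ` TG"
    if w: "set w \<subseteq> I_infty D" and z': "z' \<in> word_span (I_infty D)" and s: "s \<in> word_span coweights" for w z' s
    using s
  proof (induction rule: word_span_induct)
    case zero
    show ?case
      using \<open>\<zero>\<^bsub>TT\<^esub> \<in> Psi ` TG\<close> pure3_zero(2)[OF fE_Um eE_Up, of "mon w" z'] w z' by (simp add: cl_simps(3))
  next
    case (step c u s)
    obtain h where h: "h \<in> coweights" "cl (mon (map Gq u)) = cl (qexp h)"
      using torus_word step by blast
    have "pure3 (cl (fE (mon w))) (cl (alg_map Gq (c *\<^sub>s mon u + s))) (cl (eE z'))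
      = c \<odot>\<^bsub>TT\<^esub> pure3 (cl (fE (mon w))) (cl (qexp h)) (cl (eE z'))
        \<oplus>\<^bsub>TT\<^esub> pure3 (cl (fE (mon w))) (cl (alg_map Gq s)) (cl (eE z'))"
      using step h w z' by (simp add: cl_comb h(2) pure3_linear_middle fE_Um qexp_Uz alg_map_Uz eE_Up)
    then show ?case
      using comb[OF A[OF w h(1) z'] step.IH] by simp
  qed
  have C: "pure3 (cl (fE x')) (cl (alg_map Gq s)) (cl (eE z')) \<in> Psi ` TG"
    if x': "x' \<in> word_span (I_infty D)" and z': "z' \<in> word_span (I_infty D)" and s: "s \<in> word_span coweights" for x' z' s
    using x'
  proof (induction rule: word_span_induct)
    case zero
    show ?case
      using \<open>\<zero>\<^bsub>TT\<^esub> \<in> Psi ` TG\<close> pure3_zero(1)[OF alg_map_Uz eE_Up, of s z'] s z' by (simp add: cl_simps(3))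
  next
    case (step c u x)
    have "pure3 (cl (fE (c *\<^sub>s mon u + x))) (cl (alg_map Gq s)) (cl (eE z'))
      = c \<odot>\<^bsub>TT\<^esub> pure3 (cl (fE (mon u))) (cl (alg_map Gq s)) (cl (eE z'))
        \<oplus>\<^bsub>TT\<^esub> pure3 (cl (fE x)) (cl (alg_map Gq s)) (cl (eE z'))"
      using step s z' by (simp add: cl_comb pure3_linear_left fE_Um alg_map_Uz eE_Up)
    then show ?case
      using comb[OF B[OF step(1) z' s] step.IH] by simp
  qed
  show ?thesis
    using assms C unfolding carrier_Um carrier_Uz carrier_Up by blast
qed

lemma Psi_surj:
  assumes "t \<in> carrier TT" shows "t \<in> Psi ` TG"
proof -
  have add: "a \<oplus>\<^bsub>TT\<^esub> b \<in> Psi ` TG" if ab: "a \<in> Psi ` TG" "b \<in> Psi ` TG" for a b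
  proof -
    obtain a' b' where "a = Psi a'" "b = Psi b'" "a' \<in> TG" "b' \<in> TG" using ab by blast
    then have "a \<oplus>\<^bsub>TT\<^esub> b = Psi (a' + b')" "a' + b' \<in> TG"
      by (auto simp: Psi_add intro!: TG_closed)
    then show ?thesis by blast
  qed
  have zero: "\<zero>\<^bsub>TT\<^esub> \<in> Psi ` TG"
    using pm.subspace_0[OF subspace_TG] by (auto simp: Psi_zero[symmetric])
  have pure: "T2.pure s z \<in> Psi ` TG" if s: "s \<in> carrier (tensor Um Uz)" and z: "z \<in> carrier Up" for s z
    using s
  proof (induction rule: T1.tensor_induct)
    case zero
    then show ?case using T2.pure_zero_left[OF z] \<open>\<zero>\<^bsub>TT\<^esub> \<in> Psi ` TG\<close> by simp
  next
    case (step x y t)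
    then show ?case
      using T2.pure_add_left[OF T1.pure_closed[OF step(1,2)] step(3) z] add[OF Psi_surj_pure[OF step(1,2) z]] by simp
  qed
  show ?thesis
    using assms
  proof (induction rule: T2.tensor_induct)
    case zero
    then show ?case by (rule \<open>\<zero>\<^bsub>TT\<^esub> \<in> Psi ` TG\<close>)
  next
    case (step x y t)
    then show ?case by (intro add pure)
  qed
qed

lemma Psi_closed: "b \<in> TG \<Longrightarrow> Psi b \<in> carrier TT"
  unfolding TG_def
proof (induction rule: pm.span_induct_alt)
  case base
  then show ?case by (simp add: Psi_zero)
next
  case (step c x y)
  then obtain w h z where "x = tri w h z" "set w \<subseteq> I_infty D" "h \<in> coweights" "set z \<subseteq> I_infty D"
    by blast
  then have "Psi x \<in> carrier TT"
    by (auto simp: Psi_tri intro!: T2.pure_closed T1.pure_closed qexp_Uz fE_Um eE_Up)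
  then show ?case
    using step(2) by (simp add: Psi_add Psi_smult)
qed

text \<open>If \<open>\<phi>\<close> is the map induced by multiplication then \<open>\<phi> (Psi b)\<close> is the class of \<open>realize b\<close>. So if \<open>\<phi>\<close> identifies two
  elements \<open>Psi b\<close> and \<open>Psi b'\<close>, then \<open>realize (b - b')\<close> lies in the defining ideal, \<open>b - b'\<close> lies in \<open>NT\<close>, and \<open>Psi\<close> agrees on
  \<open>b\<close> and \<open>b'\<close>.\<close>

theorem triangular_decomposition:
  "\<exists>\<phi> \<in> module_iso TT UU. \<forall>x \<in> carrier Um. \<forall>y \<in> carrier Uz. \<forall>z \<in> carrier Up.
     \<phi> (pure3 x y z) = x \<otimes>\<^bsub>UU\<^esub> y \<otimes>\<^bsub>UU\<^esub> z"
proof -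
  interpret U: ring UU by (rule ring_U)
  interpret MU: module scalars UU by (rule module_U)
  have sm_l: "(c \<odot>\<^bsub>UU\<^esub> x) \<otimes>\<^bsub>UU\<^esub> y = c \<odot>\<^bsub>UU\<^esub> (x \<otimes>\<^bsub>UU\<^esub> y)"
    and sm_r: "x \<otimes>\<^bsub>UU\<^esub> (c \<odot>\<^bsub>UU\<^esub> y) = c \<odot>\<^bsub>UU\<^esub> (x \<otimes>\<^bsub>UU\<^esub> y)"
    if "x \<in> carrier UU" "y \<in> carrier UU" for x y c
    using that by (auto simp: cl_simps(2,5) cl_mult)
  note sub = subsetD[OF carrier_U_subset(1)] subsetD[OF carrier_U_subset(2)] subsetD[OF carrier_U_subset(3)]
  obtain \<phi>1 where f1: "\<And>t. t \<in> carrier (tensor Um Uz) \<Longrightarrow> \<phi>1 t \<in> carrier UU"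
    "\<And>t t'. \<lbrakk>t \<in> carrier (tensor Um Uz); t' \<in> carrier (tensor Um Uz)\<rbrakk> \<Longrightarrow> \<phi>1 (t \<oplus>\<^bsub>tensor Um Uz\<^esub> t') = \<phi>1 t \<oplus>\<^bsub>UU\<^esub> \<phi>1 t'"
    "\<And>t c. t \<in> carrier (tensor Um Uz) \<Longrightarrow> \<phi>1 (c \<odot>\<^bsub>tensor Um Uz\<^esub> t) = c \<odot>\<^bsub>UU\<^esub> \<phi>1 t"
    "\<And>x y. \<lbrakk>x \<in> carrier Um; y \<in> carrier Uz\<rbrakk> \<Longrightarrow> \<phi>1 (T1.pure x y) = x \<otimes>\<^bsub>UU\<^esub> y"
    by (rule T1.tensor_lift[OF module_U, where \<beta> = "\<lambda>x y. x \<otimes>\<^bsub>UU\<^esub> y"])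
       (auto simp: sub U.l_distr U.r_distr sm_l sm_r)
  obtain \<phi> where f: "\<And>t. t \<in> carrier TT \<Longrightarrow> \<phi> t \<in> carrier UU"
    "\<And>t t'. \<lbrakk>t \<in> carrier TT; t' \<in> carrier TT\<rbrakk> \<Longrightarrow> \<phi> (t \<oplus>\<^bsub>TT\<^esub> t') = \<phi> t \<oplus>\<^bsub>UU\<^esub> \<phi> t'"
    "\<And>t c. t \<in> carrier TT \<Longrightarrow> \<phi> (c \<odot>\<^bsub>TT\<^esub> t) = c \<odot>\<^bsub>UU\<^esub> \<phi> t"
    "\<And>x y. \<lbrakk>x \<in> carrier (tensor Um Uz); y \<in> carrier Up\<rbrakk> \<Longrightarrow> \<phi> (T2.pure x y) = \<phi>1 x \<otimes>\<^bsub>UU\<^esub> y"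
    by (rule T2.tensor_lift[OF module_U, where \<beta> = "\<lambda>t z. \<phi>1 t \<otimes>\<^bsub>UU\<^esub> z"])
       (auto simp: sub f1 U.l_distr U.r_distr sm_l sm_r)
  have pure: "\<phi> (pure3 x y z) = x \<otimes>\<^bsub>UU\<^esub> y \<otimes>\<^bsub>UU\<^esub> z"
    if "x \<in> carrier Um" "y \<in> carrier Uz" "z \<in> carrier Up" for x y z
    using that by (simp add: f(4) f1(4) T1.pure_closed)
  have "Psi b \<in> carrier TT \<and> \<phi> (Psi b) = cl (realize b)" if "b \<in> TG" for b
    using that unfolding TG_def
  proof (induction rule: pm.span_induct_alt)
    case base
    have "\<phi> \<zero>\<^bsub>TT\<^esub> = \<zero>\<^bsub>UU\<^esub>"
      using f(3)[OF TT.zero_closed, of 0] TT.smult_l_null[OF TT.zero_closed]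
        MU.smult_l_null[OF f(1)[OF TT.zero_closed]] by simp
    then show ?case by (simp add: Psi_zero cl_simps(3))
  next
    case (step c x y)
    then obtain w h z where x: "x = tri w h z" "set w \<subseteq> I_infty D" "h \<in> coweights" "set z \<subseteq> I_infty D"
      by blast
    have xT: "Psi x \<in> carrier TT"
      using x Psi_closed[of x] by auto
    have "\<phi> (Psi x) = cl (fE (mon w)) \<otimes>\<^bsub>UU\<^esub> cl (qexp h) \<otimes>\<^bsub>UU\<^esub> cl (eE (mon z))"
      unfolding x(1) Psi_tri using x by (intro pure fE_Um qexp_Uz eE_Up) auto
    also have "\<dots> = cl (realize x)"
      using x by (simp add: cl_mult)
    finally have "\<phi> (Psi x) = cl (realize x)" .
    then show ?case
      using step(2) xT by (simp add: Psi_add Psi_smult f(2,3) cl_simps(4,5))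
  qed
  then have Psi: "\<phi> (Psi b) = cl (realize b)" if "b \<in> TG" for b
    using that by blast
  have inj: "inj_on \<phi> (carrier TT)"
  proof
    fix t t' assume "t \<in> carrier TT" "t' \<in> carrier TT" and eq: "\<phi> t = \<phi> t'"
    then obtain b b' where b: "t = Psi b" "t' = Psi b'" "b \<in> TG" "b' \<in> TG"
      using Psi_surj by blast
    have "b - b' \<in> TG"
      using b by (intro TG_closed)
    moreover have "realize (b - b') \<in> II"
      using eq b by (simp add: Psi cl_simps)
    ultimately have "b - b' \<in> NT"
      by (intro realize_NN_imp_NT II_subset_NN)
    then have "Psi ((b - b') + b') = \<zero>\<^bsub>TT\<^esub> \<oplus>\<^bsub>TT\<^esub> Psi b'"
      by (simp only: Psi_add Psi_NT)
    then show "t = t'"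
      using b Psi_closed by simp
  qed
  have surj: "\<phi> ` carrier TT = carrier UU"
  proof
    show "\<phi> ` carrier TT \<subseteq> carrier UU" using f(1) by auto
    show "carrier UU \<subseteq> \<phi> ` carrier TT"
    proof
      fix u assume "u \<in> carrier UU"
      then obtain x where x: "u = cl x" "x \<in> W" by (auto simp: cl_simps(2))
      have "u = cl (realize (nf x))"
        unfolding x(1) using eqv_cl[OF realize_nf[OF x(2)]] by simp
      then have "u = \<phi> (Psi (nf x))"
        using Psi nf_TG x by simp
      then show "u \<in> \<phi> ` carrier TT"
        using Psi_closed nf_TG x by blast
    qed
  qed
  have "\<phi> \<in> module_iso TT UU"
    unfolding module_iso_def iso_def hom_def bij_betw_def using f inj surj by auto
  then show ?thesis
    using pure by blast
qed

end

theorem theorem3p2: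
  fixes D :: "('i, 'p::ab_group_add) bc_datum"
    and \<tau> :: "'i \<Rightarrow> nat \<Rightarrow> qfield"
  assumes "borcherds_cartan_datum D"
    and "admissible_tau D \<tau>"
  shows "\<exists>\<phi> \<in> module_iso
           (tensor (tensor (U_minus D \<tau>) (U_zero D \<tau>)) (U_plus D \<tau>)) (Uq D \<tau>).
         \<forall>x \<in> carrier (U_minus D \<tau>). \<forall>y \<in> carrier (U_zero D \<tau>). \<forall>z \<in> carrier (U_plus D \<tau>).
           \<phi> (pure_tensor (tensor (U_minus D \<tau>) (U_zero D \<tau>)) (U_plus D \<tau>)
                (pure_tensor (U_minus D \<tau>) (U_zero D \<tau>) x y) z)
           = x \<otimes>\<^bsub>Uq D \<tau>\<^esub> y \<otimes>\<^bsub>Uq D \<tau>\<^esub> z"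
proof -
  have "bozec_datum D \<tau>"
    using assms by (auto simp: bozec_datum_def bozec_datum_axioms_def admissible_tau_def)
  then show ?thesis
    by (rule bozec_datum.triangular_decomposition)
qed

end
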